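(* Assume Projective Determinacy. Let $n\ge1$ and let $\mathcal{S}=\{A_1,\dots,A_m\}$ be a finite (nonempty) family of $E^1_n$ sets. Then the Rogers semilattice $\mathcal{R}^1_n(\mathcal{S})$ has a greatest element if and only if $\mathcal{S}$ contains a least element with respect to set-theoretic inclusion $\subseteq$.
   Context: Work in ZF+DC+PD. $E^1_n$ denotes $\Pi^1_n$ if $n$ is odd and $\Sigma^1_n$ if $n$ is even (lightface). A numbering of a countable $\mathcal{S}\subset P(\omega)$ is a surjection $\nu:\omega\to\mathcal{S}$; it is $E^1_n$-computable if $\{\langle k,x\rangle: x\in\nu(k)\}\in E^1_n$. $\nu\le\mu$ iff $\nu=\mu\circ f$ for some total computable $f$; $\nu\equiv\mu$ iff $\nu\le\mu\le\nu$. $\mathcal{R}^1_n(\mathcal{S})$ is the set of $\equiv$-classes of $E^1_n$-computable numberings of $\mathcal{S}$, ordered by $\le$, with join induced by $(\nu\oplus\mu)(2x)=\nu(x)$, $(\nu\oplus\mu)(2x+1)=\mu(x)$. *)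

theory Defs
  imports "HOL-Library.Nat_Bijection" "HOL-Analysis.Function_Topology" "HOL-Algebra.Lattice"
begin

section \<open>Computable functions\<close>

text \<open>Programs for partial recursive functions; \<open>rec_eval p xs y\<close> means that \<open>p\<close> halts on the
  argument list \<open>xs\<close> with output \<open>y\<close>. In \<open>PrimRec f g\<close> the recursion argument comes first, and in
  \<open>Mu f\<close> the variable searched for is the first argument of \<open>f\<close>.\<close>

datatype recprog =
    Zero
  | Succ
  | Proj nat
  | Comp recprog "recprog list"
  | PrimRec recprog recprog
  | Mu recprog

inductive rec_eval :: "recprog \<Rightarrow> nat list \<Rightarrow> nat \<Rightarrow> bool" where
  Zero: "rec_eval Zero xs 0"
| Succ: "rec_eval Succ [x] (Suc x)"
| Proj: "i < length xs \<Longrightarrow> rec_eval (Proj i) xs (xs ! i)"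
| Comp: "length ys = length gs \<Longrightarrow> (\<forall>i<length gs. rec_eval (gs ! i) xs (ys ! i))
    \<Longrightarrow> rec_eval f ys z \<Longrightarrow> rec_eval (Comp f gs) xs z"
| PrimRec_0: "rec_eval f xs y \<Longrightarrow> rec_eval (PrimRec f g) (0 # xs) y"
| PrimRec_Suc: "rec_eval (PrimRec f g) (n # xs) r \<Longrightarrow> rec_eval g (n # r # xs) y
    \<Longrightarrow> rec_eval (PrimRec f g) (Suc n # xs) y"
| Mu: "rec_eval f (n # xs) 0 \<Longrightarrow> (\<forall>i<n. \<exists>v. rec_eval f (i # xs) (Suc v))
    \<Longrightarrow> rec_eval (Mu f) xs n"

definition computable :: "(nat \<Rightarrow> nat) \<Rightarrow> bool" where
  "computable f \<longleftrightarrow> (\<exists>p. \<forall>x. rec_eval p [x] (f x))"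


section \<open>The lightface analytical hierarchy on sets of natural numbers\<close>

text \<open>Formulas of second-order arithmetic with number variables and variables for functions from
  \<open>\<omega>\<close> to \<open>\<omega>\<close>; \<open>FApp i t\<close> is the value at \<open>t\<close> of the \<open>i\<close>-th function variable. The quantifiers
  \<open>ExN\<close>, \<open>AllN\<close> bind number variables, \<open>ExF\<close>, \<open>AllF\<close> bind function variables.\<close>

datatype trm =
    NVar nat
  | TZero
  | TSucc trm
  | TPlus trm trm
  | TTimes trm trm
  | FApp nat trm

datatype fm =
    Eq trm trm
  | Neg fm
  | Conj fm fm
  | ExN nat fm
  | AllN nat fm
  | ExF nat fm
  | AllF nat fm

primrec tval :: "(nat \<Rightarrow> nat) \<Rightarrow> (nat \<Rightarrow> nat \<Rightarrow> nat) \<Rightarrow> trm \<Rightarrow> nat" where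
  "tval s F (NVar i) = s i"
| "tval s F TZero = 0"
| "tval s F (TSucc t) = Suc (tval s F t)"
| "tval s F (TPlus t u) = tval s F t + tval s F u"
| "tval s F (TTimes t u) = tval s F t * tval s F u"
| "tval s F (FApp i t) = F i (tval s F t)"

primrec sat :: "(nat \<Rightarrow> nat) \<Rightarrow> (nat \<Rightarrow> nat \<Rightarrow> nat) \<Rightarrow> fm \<Rightarrow> bool" where
  "sat s F (Eq t u) \<longleftrightarrow> tval s F t = tval s F u"
| "sat s F (Neg \<phi>) \<longleftrightarrow> \<not> sat s F \<phi>"
| "sat s F (Conj \<phi> \<psi>) \<longleftrightarrow> sat s F \<phi> \<and> sat s F \<psi>"
| "sat s F (ExN i \<phi>) \<longleftrightarrow> (\<exists>a. sat (s(i := a)) F \<phi>)"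
| "sat s F (AllN i \<phi>) \<longleftrightarrow> (\<forall>a. sat (s(i := a)) F \<phi>)"
| "sat s F (ExF i \<phi>) \<longleftrightarrow> (\<exists>\<alpha>. sat s (F(i := \<alpha>)) \<phi>)"
| "sat s F (AllF i \<phi>) \<longleftrightarrow> (\<forall>\<alpha>. sat s (F(i := \<alpha>)) \<phi>)"

primrec arithmetical :: "fm \<Rightarrow> bool" where
  "arithmetical (Eq t u) \<longleftrightarrow> True"
| "arithmetical (Neg \<phi>) \<longleftrightarrow> arithmetical \<phi>"
| "arithmetical (Conj \<phi> \<psi>) \<longleftrightarrow> arithmetical \<phi> \<and> arithmetical \<psi>"
| "arithmetical (ExN i \<phi>) \<longleftrightarrow> arithmetical \<phi>"
| "arithmetical (AllN i \<phi>) \<longleftrightarrow> arithmetical \<phi>"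
| "arithmetical (ExF i \<phi>) \<longleftrightarrow> False"
| "arithmetical (AllF i \<phi>) \<longleftrightarrow> False"

fun Sigma_fm :: "nat \<Rightarrow> fm set" and Pi_fm :: "nat \<Rightarrow> fm set" where
  "Sigma_fm 0 = {\<phi>. arithmetical \<phi>}"
| "Sigma_fm (Suc n) = {ExF i \<phi> | i \<phi>. \<phi> \<in> Pi_fm n}"
| "Pi_fm 0 = {\<phi>. arithmetical \<phi>}"
| "Pi_fm (Suc n) = {AllF i \<phi> | i \<phi>. \<phi> \<in> Sigma_fm n}"

text \<open>The argument is the value of number variable 0. Any other free variable denotes 0 or the
  constant zero function, so that no parameters are available.\<close>

definition defined_set :: "fm \<Rightarrow> nat set" where
  "defined_set \<phi> = {x. sat ((\<lambda>_. 0)(0 := x)) (\<lambda>_ _. 0) \<phi>}"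

definition Sigma11 :: "nat \<Rightarrow> nat set set" where
  "Sigma11 n = defined_set ` Sigma_fm n"

definition Pi11 :: "nat \<Rightarrow> nat set set" where
  "Pi11 n = defined_set ` Pi_fm n"

definition E11 :: "nat \<Rightarrow> nat set set" where
  "E11 n = (if odd n then Pi11 n else Sigma11 n)"


section \<open>Projective determinacy\<close>

text \<open>The boldface projective subsets of Baire space, where \<open>nat \<Rightarrow> nat\<close> carries the product of
  the discrete topologies.\<close>

inductive_set projective :: "(nat \<Rightarrow> nat) set set" where
  closed: "closed A \<Longrightarrow> A \<in> projective"
| Compl: "A \<in> projective \<Longrightarrow> - A \<in> projective"
| Int: "A \<in> projective \<Longrightarrow> B \<in> projective \<Longrightarrow> A \<inter> B \<in> projective"
| image: "A \<in> projective \<Longrightarrow> continuous_on UNIV f \<Longrightarrow> f ` A \<in> projective"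

text \<open>In the game with payoff set \<open>A\<close>, player I chooses the values of \<open>x\<close> at even places, player II
  those at odd places, and player I wins the run \<open>x\<close> if \<open>x \<in> A\<close>. A strategy maps the finite
  sequence of all previous moves to the next move.\<close>

definition determined :: "(nat \<Rightarrow> nat) set \<Rightarrow> bool" where
  "determined A \<longleftrightarrow>
     (\<exists>\<sigma> :: nat list \<Rightarrow> nat. \<forall>x. (\<forall>i. even i \<longrightarrow> x i = \<sigma> (map x [0..<i])) \<longrightarrow> x \<in> A) \<or>
     (\<exists>\<tau> :: nat list \<Rightarrow> nat. \<forall>x. (\<forall>i. odd i \<longrightarrow> x i = \<tau> (map x [0..<i])) \<longrightarrow> x \<notin> A)"

definition PD :: bool where
  "PD \<longleftrightarrow> (\<forall>A \<in> projective. determined A)"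


section \<open>Numberings and Rogers semilattices\<close>

definition E11_numberings :: "nat \<Rightarrow> nat set set \<Rightarrow> (nat \<Rightarrow> nat set) set" where
  "E11_numberings n S =
     {\<nu>. range \<nu> = S \<and> {prod_encode (k, x) | k x. x \<in> \<nu> k} \<in> E11 n}"

definition reducible :: "(nat \<Rightarrow> nat set) \<Rightarrow> (nat \<Rightarrow> nat set) \<Rightarrow> bool" where
  "reducible \<nu> \<mu> \<longleftrightarrow> (\<exists>f. computable f \<and> \<nu> = \<mu> \<circ> f)"

definition numbering_equiv ::
    "nat \<Rightarrow> nat set set \<Rightarrow> ((nat \<Rightarrow> nat set) \<times> (nat \<Rightarrow> nat set)) set" where
  "numbering_equiv n S =
     {(\<nu>, \<mu>). \<nu> \<in> E11_numberings n S \<and> \<mu> \<in> E11_numberings n S \<and> reducible \<nu> \<mu> \<and> reducible \<mu> \<nu>}"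

text \<open>Only the order is recorded; the join induced by the direct sum of numberings is the binary
  supremum of this order.\<close>

definition Rogers :: "nat \<Rightarrow> nat set set \<Rightarrow> (nat \<Rightarrow> nat set) set gorder" where
  "Rogers n S =
     \<lparr>carrier = E11_numberings n S // numbering_equiv n S,
      eq = (=),
      le = (\<lambda>a b. \<exists>\<nu>\<in>a. \<exists>\<mu>\<in>b. reducible \<nu> \<mu>)\<rparr>"

lemma reducible_refl: "reducible \<nu> \<nu>"
proof -
  have "rec_eval (Proj 0) [x] x" for x
    using rec_eval.Proj[of 0 "[x]"] by simp
  then have "computable id" by (auto simp: computable_def)
  then show ?thesis by (auto simp: reducible_def)
qed

lemma reducible_trans:
  assumes "reducible \<nu> \<mu>" "reducible \<mu> \<rho>"
  shows "reducible \<nu> \<rho>"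
proof -
  obtain f g where f: "computable f" "\<nu> = \<mu> \<circ> f" and g: "computable g" "\<mu> = \<rho> \<circ> g"
    using assms by (auto simp: reducible_def)
  obtain p q where p: "\<And>x. rec_eval p [x] (f x)" and q: "\<And>x. rec_eval q [x] (g x)"
    using f(1) g(1) by (auto simp: computable_def)
  have "rec_eval (Comp q [p]) [x] (g (f x))" for x
    by (rule rec_eval.Comp[of "[f x]"]) (use p q in auto)
  then have "computable (g \<circ> f)" by (auto simp: computable_def)
  then show ?thesis using f(2) g(2) by (auto simp: reducible_def comp_assoc)
qed

lemma equiv_numbering_equiv: "equiv (E11_numberings n S) (numbering_equiv n S)"
proof (rule equivI)
  show "numbering_equiv n S \<subseteq> E11_numberings n S \<times> E11_numberings n S"
    by (auto simp: numbering_equiv_def)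
  show "refl_on (E11_numberings n S) (numbering_equiv n S)"
    by (simp add: refl_on_def numbering_equiv_def reducible_refl)
  show "sym (numbering_equiv n S)"
    by (simp add: sym_def numbering_equiv_def)
  show "trans (numbering_equiv n S)"
    unfolding trans_def numbering_equiv_def by (clarsimp, meson reducible_trans)
qed

lemma Rogers_le_iff:
  assumes "\<nu> \<in> E11_numberings n S" "\<mu> \<in> E11_numberings n S"
  shows "numbering_equiv n S `` {\<nu>} \<sqsubseteq>\<^bsub>Rogers n S\<^esub> numbering_equiv n S `` {\<mu>} \<longleftrightarrow> reducible \<nu> \<mu>"
proof -
  have "reducible \<nu> \<mu>" if "(\<nu>, \<nu>') \<in> numbering_equiv n S" "(\<mu>, \<mu>') \<in> numbering_equiv n S"
    "reducible \<nu>' \<mu>'" for \<nu>' \<mu>'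
    using that unfolding numbering_equiv_def by (clarsimp, meson reducible_trans)
  moreover have "(\<nu>, \<nu>) \<in> numbering_equiv n S" "(\<mu>, \<mu>) \<in> numbering_equiv n S"
    using assms by (simp_all add: numbering_equiv_def reducible_refl)
  ultimately show ?thesis unfolding Rogers_def by (simp, blast)
qed

lemma partial_order_Rogers: "partial_order (Rogers n S)"
proof -
  have car: "\<exists>\<nu>\<in>E11_numberings n S. a = numbering_equiv n S `` {\<nu>}" if "a \<in> carrier (Rogers n S)" for a
    using that by (auto simp: Rogers_def quotient_def)
  have eq: "(.=\<^bsub>Rogers n S\<^esub>) = (=)" by (simp add: Rogers_def)
  show ?thesis
  proof (unfold_locales, unfold eq)
    fix x assume "x \<in> carrier (Rogers n S)"
    then show "x \<sqsubseteq>\<^bsub>Rogers n S\<^esub> x"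
      using car Rogers_le_iff reducible_refl by metis
  next
    fix x y assume "x \<sqsubseteq>\<^bsub>Rogers n S\<^esub> y" "y \<sqsubseteq>\<^bsub>Rogers n S\<^esub> x"
      "x \<in> carrier (Rogers n S)" "y \<in> carrier (Rogers n S)"
    then obtain \<nu> \<mu> where *: "\<nu> \<in> E11_numberings n S" "\<mu> \<in> E11_numberings n S"
      "x = numbering_equiv n S `` {\<nu>}" "y = numbering_equiv n S `` {\<mu>}"
      "reducible \<nu> \<mu>" "reducible \<mu> \<nu>"
      using car Rogers_le_iff by metis
    then have "(\<nu>, \<mu>) \<in> numbering_equiv n S" by (simp add: numbering_equiv_def)
    then show "x = y"
      using * equiv_class_eq[OF equiv_numbering_equiv] by simp
  next
    fix x y z assume le: "x \<sqsubseteq>\<^bsub>Rogers n S\<^esub> y" "y \<sqsubseteq>\<^bsub>Rogers n S\<^esub> z"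
      and xyz: "x \<in> carrier (Rogers n S)" "y \<in> carrier (Rogers n S)" "z \<in> carrier (Rogers n S)"
    obtain \<nu> where \<nu>: "\<nu> \<in> E11_numberings n S" "x = numbering_equiv n S `` {\<nu>}"
      using car[OF xyz(1)] by blast
    obtain \<mu> where \<mu>: "\<mu> \<in> E11_numberings n S" "y = numbering_equiv n S `` {\<mu>}"
      using car[OF xyz(2)] by blast
    obtain \<rho> where \<rho>: "\<rho> \<in> E11_numberings n S" "z = numbering_equiv n S `` {\<rho>}"
      using car[OF xyz(3)] by blast
    have "reducible \<nu> \<mu>" "reducible \<mu> \<rho>"
      using le Rogers_le_iff[OF \<nu>(1) \<mu>(1)] Rogers_le_iff[OF \<mu>(1) \<rho>(1)]
      unfolding \<nu>(2) \<mu>(2) \<rho>(2) by blast+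
    then have "reducible \<nu> \<rho>" by (rule reducible_trans)
    then show "x \<sqsubseteq>\<^bsub>Rogers n S\<^esub> z"
      unfolding \<nu>(2) \<rho>(2) Rogers_le_iff[OF \<nu>(1) \<rho>(1)] .
  qed simp_all
qed

end

theory Submission
  imports Defs "HOL-Library.Extended_Nat"
begin

text \<open>The prewellordering property of \<open>E\<^sup>1\<^sub>n\<close> (first periodicity theorem, from projective determinacy) is
  what the theorem needs: it provides a norm \<open>\<phi>\<close> along which an \<open>E\<^sup>1\<^sub>n\<close> set is enumerated in stages.

  If \<open>S\<close> has a least element, fix a finite set \<open>F\<close> that tells the members of \<open>S\<close> apart with respect to
  inclusion, and turn an arbitrary \<open>E\<^sup>1\<^sub>n\<close> set \<open>V\<close> into the union of the least element and of all
  \<open>A \<in> S\<close> for which at some stage exactly the elements \<open>A \<inter> F\<close> of \<open>F\<close> have appeared in \<open>V\<close>. These \<open>A\<close>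
  form a chain, so the result lies in \<open>S\<close>, and it is \<open>V\<close> if \<open>V \<in> S\<close>. Applied to the sections of a universal
  set this yields a greatest numbering.

  If \<open>S\<close> has no least element, choose \<open>a\<^sub>A \<in> A - B\<^sub>A\<close> with \<open>B\<^sub>A \<in> S\<close> for each \<open>A \<in> S\<close>. Given a numbering \<open>\<mu>\<close>,
  the reduction property selects for every \<open>y\<close> one \<open>A\<close> with \<open>a\<^sub>A \<in> \<mu> y\<close>; then \<open>g y = B\<^sub>A\<close> differs from \<open>\<mu> y\<close>, and
  diagonalizing \<open>g\<close> against all computable functions gives a numbering that is not reducible to \<open>\<mu>\<close>.\<close>

section \<open>Total functions arithmetical in an oracle\<close>

text \<open>The stages of the overview are ordinals, and no class of the hierarchy speaks about
  them. What is available are two comparisons of points: \<open>x\<close> is enumerated and no later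
  than \<open>y\<close>, and \<open>x\<close> is enumerated strictly before \<open>y\<close>. Both
  are in E^1_n, their negations in general are not, so both directions use them positively and in
  finite combinations only, which the finiteness of \<open>S\<close> permits. The prewellordering
  property passes from \<Pi> to the next \<Sigma> by taking the least norm of a witness, and from
  \<Sigma> to the next \<Pi> by comparing norms in a game, which has to be determined. This is the
  origin of the parity in E^1_n. All classes rest on total functions arithmetical in an oracle. They
  have codes, and evaluating a code is \<Delta>^1_1. This yields universal sets, and it simplifies
  the diagonalization: instead of the computable functions it treats the larger family of all coded
  functions, so that no divergence has to be handled.\<close>

abbreviation pr :: "nat \<Rightarrow> nat \<Rightarrow> nat" where "pr a b \<equiv> prod_encode (a, b)"
abbreviation p1 :: "nat \<Rightarrow> nat" where "p1 z \<equiv> fst (prod_decode z)"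
abbreviation p2 :: "nat \<Rightarrow> nat" where "p2 z \<equiv> snd (prod_decode z)"

datatype ix = IZero | ISucc | IFst | ISnd | IOrc
  | IPair ix ix | IComp ix ix | IIter ix | IMu ix

text \<open>\<open>IMu f\<close> returns the successor of the least zero, and \<open>0\<close> if there is none. Since the witness is part
  of the value, the clauses that define \<open>den\<close> are purely universal; this replaces Skolemization below.\<close>

primrec den :: "(nat \<Rightarrow> nat) \<Rightarrow> ix \<Rightarrow> nat \<Rightarrow> nat" where
  "den \<alpha> IZero = (\<lambda>x. 0)"
| "den \<alpha> ISucc = Suc"
| "den \<alpha> IFst = (\<lambda>x. p1 x)"
| "den \<alpha> ISnd = (\<lambda>x. p2 x)"
| "den \<alpha> IOrc = \<alpha>"
| "den \<alpha> (IPair f g) = (\<lambda>x. pr (den \<alpha> f x) (den \<alpha> g x))"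
| "den \<alpha> (IComp f g) = (\<lambda>x. den \<alpha> f (den \<alpha> g x))"
| "den \<alpha> (IIter f) = (\<lambda>x. (den \<alpha> f ^^ p1 x) (p2 x))"
| "den \<alpha> (IMu f) = (\<lambda>x. if \<exists>a. den \<alpha> f (pr a x) = 0
      then Suc (LEAST a. den \<alpha> f (pr a x) = 0) else 0)"

definition Dfun :: "(nat \<Rightarrow> (nat \<Rightarrow> nat) \<Rightarrow> nat) \<Rightarrow> bool" where
  "Dfun f \<longleftrightarrow> (\<exists>c. \<forall>x \<alpha>. f x \<alpha> = den \<alpha> c x)"

text \<open>Truth is coded by 0, because \<open>IMu\<close> searches for zeros.\<close>

definition Dpred :: "(nat \<Rightarrow> (nat \<Rightarrow> nat) \<Rightarrow> bool) \<Rightarrow> bool" where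
  "Dpred P \<longleftrightarrow> Dfun (\<lambda>x \<alpha>. if P x \<alpha> then 0 else 1)"

section \<open>Closure of the base level under arithmetic, logic and number quantifiers\<close>

lemma Dfun_den: "Dfun (\<lambda>x \<alpha>. den \<alpha> c x)"
  by (auto simp: Dfun_def)

lemma Dfun_comp: "Dfun g \<Longrightarrow> Dfun f \<Longrightarrow> Dfun (\<lambda>x \<alpha>. g (f x \<alpha>) \<alpha>)"
proof -
  assume "Dfun g" "Dfun f"
  then obtain c d where "\<And>x \<alpha>. g x \<alpha> = den \<alpha> c x" "\<And>x \<alpha>. f x \<alpha> = den \<alpha> d x"
    by (auto simp: Dfun_def)
  then have "\<forall>x \<alpha>. g (f x \<alpha>) \<alpha> = den \<alpha> (IComp c d) x" by simp
  then show ?thesis unfolding Dfun_def by blast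
qed

lemma Dfun_pr: "Dfun f \<Longrightarrow> Dfun g \<Longrightarrow> Dfun (\<lambda>x \<alpha>. pr (f x \<alpha>) (g x \<alpha>))"
proof -
  assume "Dfun g" "Dfun f"
  then obtain c d where "\<And>x \<alpha>. g x \<alpha> = den \<alpha> c x" "\<And>x \<alpha>. f x \<alpha> = den \<alpha> d x"
    by (auto simp: Dfun_def)
  then have "\<forall>x \<alpha>. pr (f x \<alpha>) (g x \<alpha>) = den \<alpha> (IPair d c) x" by simp
  then show ?thesis unfolding Dfun_def by blast
qed

lemma Dfun_zero: "Dfun (\<lambda>x \<alpha>. 0)"
  using Dfun_den[of IZero] by simp

lemma Dfun_Suc: "Dfun f \<Longrightarrow> Dfun (\<lambda>x \<alpha>. Suc (f x \<alpha>))"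
  using Dfun_comp[OF Dfun_den[of ISucc]] by simp

lemma Dfun_const: "Dfun (\<lambda>x \<alpha>. k)"
  by (induction k) (auto intro: Dfun_zero Dfun_Suc)

lemma Dfun_p1: "Dfun f \<Longrightarrow> Dfun (\<lambda>x \<alpha>. p1 (f x \<alpha>))"
  using Dfun_comp[OF Dfun_den[of IFst]] by simp

lemma Dfun_p2: "Dfun f \<Longrightarrow> Dfun (\<lambda>x \<alpha>. p2 (f x \<alpha>))"
  using Dfun_comp[OF Dfun_den[of ISnd]] by simp

lemma Dfun_orc: "Dfun f \<Longrightarrow> Dfun (\<lambda>x \<alpha>. \<alpha> (f x \<alpha>))"
  using Dfun_comp[OF Dfun_den[of IOrc]] by simp

lemma Dfun_id: "Dfun (\<lambda>x \<alpha>. x)"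
  using Dfun_den[of "IPair IFst ISnd"] by simp

text \<open>\<open>IIter\<close> iterates a unary function, so the parameter \<open>x\<close>
  travels unchanged in the second component of the state.\<close>

lemma Dfun_iter_param:
  assumes "Dfun (\<lambda>z \<alpha>. g (p1 z) (p2 z) \<alpha>)" "Dfun k" "Dfun s"
  shows "Dfun (\<lambda>x \<alpha>. ((\<lambda>s. g s x \<alpha>) ^^ k x \<alpha>) (s x \<alpha>))"
proof -
  have "Dfun (\<lambda>z \<alpha>. pr (g (p1 z) (p2 z) \<alpha>) (p2 z))"
    by (intro Dfun_pr assms Dfun_p2 Dfun_id)
  then obtain c where c: "\<And>z \<alpha>. den \<alpha> c z = pr (g (p1 z) (p2 z) \<alpha>) (p2 z)"
    by (auto simp: Dfun_def)
  have it: "(den \<alpha> c ^^ m) (pr t x) = pr (((\<lambda>s. g s x \<alpha>) ^^ m) t) x" for m t x \<alpha>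
    by (induction m) (auto simp: c)
  have "Dfun (\<lambda>x \<alpha>. p1 (den \<alpha> (IIter c) (pr (k x \<alpha>) (pr (s x \<alpha>) x))))"
    by (intro Dfun_p1 Dfun_comp[OF Dfun_den] Dfun_pr assms Dfun_id)
  then show ?thesis by (simp add: it)
qed

text \<open>Branching by iteration: applying the constant function with value
  \<open>g x \<alpha>\<close> zero times leaves \<open>f x \<alpha>\<close>, and any positive number
  of times yields \<open>g x \<alpha>\<close>.\<close>

lemma Dfun_if0:
  assumes "Dfun c" "Dfun f" "Dfun g"
  shows "Dfun (\<lambda>x \<alpha>. if c x \<alpha> = 0 then f x \<alpha> else g x \<alpha>)"
proof -
  have *: "((\<lambda>s. b) ^^ m) a = (if m = 0 then a else b)" for m and a b :: nat
    by (cases m) auto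
  show ?thesis
    using Dfun_iter_param[OF Dfun_comp[OF assms(3) Dfun_p2[OF Dfun_id]] assms(1,2)]
    by (simp add: *)
qed

lemma Dfun_plus:
  assumes "Dfun f" "Dfun g"
  shows "Dfun (\<lambda>x \<alpha>. f x \<alpha> + g x \<alpha>)"
proof -
  have *: "((\<lambda>s. Suc s) ^^ m) a = a + m" for m a
    by (induction m) auto
  show ?thesis
    using Dfun_iter_param[OF Dfun_Suc[OF Dfun_p1[OF Dfun_id]] assms(2,1)]
    by (simp add: * add.commute)
qed

lemma Dfun_times:
  assumes "Dfun f" "Dfun g"
  shows "Dfun (\<lambda>x \<alpha>. f x \<alpha> * g x \<alpha>)"
proof -
  have *: "((\<lambda>s. s + b) ^^ m) 0 = m * b" for m and b :: nat
    by (induction m) auto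
  have "Dfun (\<lambda>z \<alpha>. p1 z + g (p2 z) \<alpha>)"
    by (intro Dfun_plus Dfun_p1 Dfun_id Dfun_comp[OF assms(2)] Dfun_p2)
  from Dfun_iter_param[OF this assms(1) Dfun_zero] show ?thesis
    by (simp add: *)
qed

lemma Dfun_pred:
  assumes "Dfun f"
  shows "Dfun (\<lambda>x \<alpha>. f x \<alpha> - 1)"
proof -
  have *: "((\<lambda>s. pr (p2 s) (Suc (p2 s))) ^^ m) (pr 0 0) = pr (m - 1) m" for m
    by (induction m) auto
  have "Dfun (\<lambda>z \<alpha>. pr (p2 (p1 z)) (Suc (p2 (p1 z))))"
    by (intro Dfun_pr Dfun_Suc Dfun_p1 Dfun_p2 Dfun_id)
  from Dfun_p1[OF Dfun_iter_param[OF this assms Dfun_pr[OF Dfun_zero Dfun_zero]]] show ?thesis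
    by (simp add: *)
qed

lemma Dfun_minus:
  assumes "Dfun f" "Dfun g"
  shows "Dfun (\<lambda>x \<alpha>. f x \<alpha> - g x \<alpha>)"
proof -
  have *: "((\<lambda>s. s - Suc 0) ^^ m) a = a - m" for m a
    by (induction m) auto
  show ?thesis
    using Dfun_iter_param[OF Dfun_pred[OF Dfun_p1[OF Dfun_id]] assms(2,1)]
    by (simp add: *)
qed

lemma Dpred_eq0: "Dfun f \<Longrightarrow> Dpred (\<lambda>x \<alpha>. f x \<alpha> = 0)"
  unfolding Dpred_def by (intro Dfun_if0 Dfun_const)

lemma if_not: "(if \<not> b then x else y) = (if b then y else x)"
  by simp

lemma if01_eq_0: "((if b then 0 else (1::nat)) = 0) = b"
  by simp

lemma Dfun_If:
  assumes "Dpred P" "Dfun f" "Dfun g"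
  shows "Dfun (\<lambda>x \<alpha>. if P x \<alpha> then f x \<alpha> else g x \<alpha>)"
  using Dfun_if0[OF assms(1)[unfolded Dpred_def] assms(2,3)] unfolding if01_eq_0 .

lemma Dpred_not: "Dpred P \<Longrightarrow> Dpred (\<lambda>x \<alpha>. \<not> P x \<alpha>)"
  using Dfun_If[OF _ Dfun_const[of 1] Dfun_const[of 0], of P]
  unfolding Dpred_def[of "\<lambda>x \<alpha>. \<not> P x \<alpha>"] if_not by simp

lemma Dpred_conj: "Dpred P \<Longrightarrow> Dpred Q \<Longrightarrow> Dpred (\<lambda>x \<alpha>. P x \<alpha> \<and> Q x \<alpha>)"
proof -
  assume "Dpred P" "Dpred Q"
  then have "Dfun (\<lambda>x \<alpha>. if P x \<alpha> then (if Q x \<alpha> then 0 else 1) else 1)"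
    by (intro Dfun_If Dfun_const)
  moreover have "(\<lambda>x \<alpha>. if P x \<alpha> then (if Q x \<alpha> then 0 else 1) else (1::nat))
     = (\<lambda>x \<alpha>. if P x \<alpha> \<and> Q x \<alpha> then 0 else 1)"
    by (auto simp: fun_eq_iff)
  ultimately show ?thesis by (simp add: Dpred_def)
qed

lemma Dpred_disj: "Dpred P \<Longrightarrow> Dpred Q \<Longrightarrow> Dpred (\<lambda>x \<alpha>. P x \<alpha> \<or> Q x \<alpha>)"
  using Dpred_not[OF Dpred_conj[OF Dpred_not Dpred_not]] by simp

lemma Dpred_imp: "Dpred P \<Longrightarrow> Dpred Q \<Longrightarrow> Dpred (\<lambda>x \<alpha>. P x \<alpha> \<longrightarrow> Q x \<alpha>)"
  using Dpred_not[OF Dpred_conj[OF _ Dpred_not]] by simp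

lemma Dpred_eq: "Dfun f \<Longrightarrow> Dfun g \<Longrightarrow> Dpred (\<lambda>x \<alpha>. f x \<alpha> = g x \<alpha>)"
proof -
  assume a: "Dfun f" "Dfun g"
  have "Dpred (\<lambda>x \<alpha>. (f x \<alpha> - g x \<alpha>) + (g x \<alpha> - f x \<alpha>) = 0)"
    by (intro Dpred_eq0 Dfun_plus Dfun_minus a)
  moreover have "(\<lambda>x \<alpha>. (f x \<alpha> - g x \<alpha>) + (g x \<alpha> - f x \<alpha>) = 0) = (\<lambda>x \<alpha>. f x \<alpha> = g x \<alpha>)"
    by (auto simp: fun_eq_iff)
  ultimately show ?thesis by simp
qed

lemma Dpred_le: "Dfun f \<Longrightarrow> Dfun g \<Longrightarrow> Dpred (\<lambda>x \<alpha>. f x \<alpha> \<le> g x \<alpha>)"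
  using Dpred_eq0[OF Dfun_minus, of f g] by simp

lemma Dpred_less: "Dfun f \<Longrightarrow> Dfun g \<Longrightarrow> Dpred (\<lambda>x \<alpha>. f x \<alpha> < g x \<alpha>)"
  using Dpred_not[OF Dpred_le, of g f] by (simp add: not_le)

lemma Dpred_ex:
  assumes "Dpred (\<lambda>z \<alpha>. P (p1 z) (p2 z) \<alpha>)"
  shows "Dpred (\<lambda>x \<alpha>. \<exists>a. P a x \<alpha>)"
proof -
  obtain c where c: "\<And>z \<alpha>. den \<alpha> c z = (if P (p1 z) (p2 z) \<alpha> then 0 else 1)"
    using assms unfolding Dpred_def Dfun_def by metis
  have "Dpred (\<lambda>x \<alpha>. \<not> den \<alpha> (IMu c) x = 0)"
    by (intro Dpred_not Dpred_eq0 Dfun_den)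
  then show ?thesis unfolding den.simps c if01_eq_0 by (simp split: if_split_asm cong: if_cong)
qed

lemma Dpred_all:
  assumes "Dpred (\<lambda>z \<alpha>. P (p1 z) (p2 z) \<alpha>)"
  shows "Dpred (\<lambda>x \<alpha>. \<forall>a. P a x \<alpha>)"
  using Dpred_not[OF Dpred_ex[OF Dpred_not[OF assms]]] by simp

lemma Dfun_least:
  assumes "Dpred (\<lambda>z \<alpha>. P (p1 z) (p2 z) \<alpha>)"
  shows "Dfun (\<lambda>x \<alpha>. if \<exists>a. P a x \<alpha> then Suc (LEAST a. P a x \<alpha>) else 0)"
proof -
  obtain c where c: "\<And>z \<alpha>. den \<alpha> c z = (if P (p1 z) (p2 z) \<alpha> then 0 else 1)"
    using assms unfolding Dpred_def Dfun_def by metis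
  show ?thesis
    using Dfun_den[of "IMu c"] unfolding den.simps c if01_eq_0 by (simp cong: if_cong)
qed

lemma Dpred_comp: "Dpred P \<Longrightarrow> Dfun f \<Longrightarrow> Dpred (\<lambda>x \<alpha>. P (f x \<alpha>) \<alpha>)"
  unfolding Dpred_def by (rule Dfun_comp)

lemmas D_intros = Dfun_pr Dfun_Suc Dfun_const Dfun_p1 Dfun_p2 Dfun_orc Dfun_id Dfun_plus Dfun_times
  Dfun_If Dpred_not Dpred_conj Dpred_disj Dpred_imp Dpred_eq Dpred_le Dpred_less

section \<open>Substitution of definable oracles\<close>

definition Dop :: "(nat \<Rightarrow> (nat \<Rightarrow> nat) \<Rightarrow> nat \<Rightarrow> nat) \<Rightarrow> bool" where
  "Dop H \<longleftrightarrow> Dfun (\<lambda>z \<alpha>. H (p1 z) \<alpha> (p2 z))"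

lemma Dfun_app: "Dop H \<Longrightarrow> Dfun f \<Longrightarrow> Dfun g \<Longrightarrow> Dfun (\<lambda>x \<alpha>. H (f x \<alpha>) \<alpha> (g x \<alpha>))"
  using Dfun_comp[OF _ Dfun_pr, of "\<lambda>z \<alpha>. H (p1 z) \<alpha> (p2 z)" f g]
  by (simp add: Dop_def)

text \<open>\<open>IOrc\<close> is replaced by a definition of \<open>H\<close> inside the code
  \<open>c\<close>. The parameter \<open>p1 z\<close> of the new oracle has to survive iteration and
  search, so these two cases rearrange the pairs before the induction hypothesis applies.\<close>

lemma Dfun_den_subst:
  assumes H: "Dop H"
  shows "Dfun (\<lambda>z \<alpha>. den (H (p1 z) \<alpha>) c (p2 z))"
proof (induction c)
  case IOrc
  then show ?case using H by (simp add: Dop_def)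
next
  case (IComp f g)
  have "Dfun (\<lambda>z \<alpha>. pr (p1 z) (den (H (p1 z) \<alpha>) g (p2 z)))"
    by (intro Dfun_pr Dfun_p1 Dfun_id IComp)
  from Dfun_comp[OF IComp(1) this] show ?case by simp
next
  case (IIter f)
  have "Dfun (\<lambda>z \<alpha>. den (H (p1 (p2 z)) \<alpha>) f (p1 z))"
    using Dfun_comp[OF IIter, of "\<lambda>z \<alpha>. pr (p1 (p2 z)) (p1 z)"]
    by (simp add: Dfun_pr Dfun_p1 Dfun_p2 Dfun_id)
  from Dfun_iter_param[OF this, of "\<lambda>z \<alpha>. p1 (p2 z)" "\<lambda>z \<alpha>. p2 (p2 z)"]
  show ?case by (simp add: Dfun_p1 Dfun_p2 Dfun_id)
next
  case (IMu f)
  have "Dpred (\<lambda>z \<alpha>. den (H (p1 (p2 z)) \<alpha>) f (pr (p1 z) (p2 (p2 z))) = 0)"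
    using Dfun_comp[OF IMu, of "\<lambda>z \<alpha>. pr (p1 (p2 z)) (pr (p1 z) (p2 (p2 z)))"]
    by (intro Dpred_eq0) (simp add: D_intros)
  from Dfun_least[OF this] show ?case by simp
qed (auto intro!: D_intros)

lemma Dfun_subst:
  assumes "Dfun g" "Dfun f" "Dop H"
  shows "Dfun (\<lambda>x \<alpha>. g (f x \<alpha>) (H x \<alpha>))"
proof -
  obtain c where c: "\<And>z \<alpha>. g z \<alpha> = den \<alpha> c z"
    using assms unfolding Dfun_def by metis
  show ?thesis
    using Dfun_comp[OF Dfun_den_subst[OF assms(3)] Dfun_pr[OF Dfun_id assms(2)], of c]
    by (simp add: c)
qed

lemma Dpred_subst:
  assumes "Dpred P" "Dfun f" "Dop H"
  shows "Dpred (\<lambda>x \<alpha>. P (f x \<alpha>) (H x \<alpha>))"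
  using Dfun_subst assms unfolding Dpred_def by fastforce

definition jn :: "(nat \<Rightarrow> nat) \<Rightarrow> (nat \<Rightarrow> nat) \<Rightarrow> nat \<Rightarrow> nat" where
  "jn \<alpha> \<beta> k = (if even k then \<alpha> (k div 2) else \<beta> (k div 2))"
definition lft :: "(nat \<Rightarrow> nat) \<Rightarrow> nat \<Rightarrow> nat" where "lft \<gamma> k = \<gamma> (2 * k)"
definition rgt :: "(nat \<Rightarrow> nat) \<Rightarrow> nat \<Rightarrow> nat" where "rgt \<gamma> k = \<gamma> (Suc (2 * k))"

lemma lft_jn [simp]: "lft (jn \<alpha> \<beta>) = \<alpha>" and rgt_jn [simp]: "rgt (jn \<alpha> \<beta>) = \<beta>"
  and jn_lft_rgt [simp]: "jn (lft \<gamma>) (rgt \<gamma>) = \<gamma>"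
  by (auto simp: fun_eq_iff lft_def rgt_def jn_def)

lemma Dop_orc: "Dop (\<lambda>x \<alpha>. \<alpha>)"
  unfolding Dop_def by (intro D_intros)

lemma Dop_const: "Dop (\<lambda>x \<alpha> k. m)"
  unfolding Dop_def by (intro D_intros)

lemma Dop_lft: "Dop H \<Longrightarrow> Dop (\<lambda>x \<alpha>. lft (H x \<alpha>))"
  unfolding Dop_def[of "\<lambda>x \<alpha>. lft (H x \<alpha>)"] lft_def by (intro D_intros Dfun_app[of H])

lemma Dop_rgt: "Dop H \<Longrightarrow> Dop (\<lambda>x \<alpha>. rgt (H x \<alpha>))"
  unfolding Dop_def[of "\<lambda>x \<alpha>. rgt (H x \<alpha>)"] rgt_def by (intro D_intros Dfun_app[of H])

lemma Dfun_div2: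
  assumes "Dfun f" shows "Dfun (\<lambda>x \<alpha>. f x \<alpha> div 2)"
proof -
  have *: "((\<lambda>s. pr (p2 s) (Suc (p1 s))) ^^ m) (pr 0 0) = pr (m div 2) (Suc m div 2)" for m
    by (induction m) auto
  have "Dfun (\<lambda>z \<alpha>. pr (p2 (p1 z)) (Suc (p1 (p1 z))))"
    by (intro D_intros)
  from Dfun_p1[OF Dfun_iter_param[OF this assms Dfun_pr[OF Dfun_zero Dfun_zero]]] show ?thesis
    by (simp add: *)
qed

lemma Dpred_even:
  assumes "Dfun f" shows "Dpred (\<lambda>x \<alpha>. even (f x \<alpha>))"
proof -
  have "Dpred (\<lambda>x \<alpha>. 2 * (f x \<alpha> div 2) = f x \<alpha>)"
    by (intro D_intros Dfun_div2 assms)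
  moreover have "(2 * (a div 2) = a) = even a" for a :: nat
    by presburger
  ultimately show ?thesis by simp
qed

lemma Dop_jn: "Dop H \<Longrightarrow> Dop K \<Longrightarrow> Dop (\<lambda>x \<alpha>. jn (H x \<alpha>) (K x \<alpha>))"
  unfolding Dop_def[of "\<lambda>x \<alpha>. jn (H x \<alpha>) (K x \<alpha>)"] jn_def
  by (intro D_intros Dpred_even Dfun_div2 Dfun_app[of H] Dfun_app[of K])

lemma Dop_subst:
  assumes "Dop G" "Dfun f" "Dop H"
  shows "Dop (\<lambda>x \<alpha>. G (f x \<alpha>) (H x \<alpha>))"
proof -
  have "Dop (\<lambda>z \<alpha>. H (p1 z) \<alpha>)" unfolding Dop_def by (intro Dfun_app[OF assms(3)] D_intros)
  moreover have "Dfun (\<lambda>z \<alpha>. pr (f (p1 z) \<alpha>) (p2 z))"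
    by (intro D_intros Dfun_comp[OF assms(2)])
  ultimately have "Dfun (\<lambda>z \<alpha>. (\<lambda>z \<alpha>. G (p1 z) \<alpha> (p2 z)) (pr (f (p1 z) \<alpha>) (p2 z)) (H (p1 z) \<alpha>))"
    by (intro Dfun_subst[OF assms(1)[unfolded Dop_def]])
  then show ?thesis by (simp add: Dop_def)
qed

lemmas Dop_intros = Dop_orc Dop_const Dop_lft Dop_rgt Dop_jn

section \<open>The analytical hierarchy over this class\<close>

text \<open>\<open>Sg n\<close> and \<open>Pg n\<close> are the lightface classes \<open>\<Sigma>\<^sup>1\<^sub>n\<close> and \<open>\<Pi>\<^sup>1\<^sub>n\<close> of relations between a number and a function;
  several functions are packed into one by \<open>jn\<close>.\<close>

primrec Sg :: "nat \<Rightarrow> (nat \<Rightarrow> (nat \<Rightarrow> nat) \<Rightarrow> bool) \<Rightarrow> bool" where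
  "Sg 0 P = Dpred P"
| "Sg (Suc n) P = (\<exists>Q. Sg n (\<lambda>x \<alpha>. \<not> Q x \<alpha>) \<and> P = (\<lambda>x \<alpha>. \<exists>\<beta>. Q x (jn \<alpha> \<beta>)))"

abbreviation Pg :: "nat \<Rightarrow> (nat \<Rightarrow> (nat \<Rightarrow> nat) \<Rightarrow> bool) \<Rightarrow> bool" where
  "Pg n P \<equiv> Sg n (\<lambda>x \<alpha>. \<not> P x \<alpha>)"

lemma Sg_SucI: "Pg n Q \<Longrightarrow> Sg (Suc n) (\<lambda>x \<alpha>. \<exists>\<beta>. Q x (jn \<alpha> \<beta>))"
  by auto

lemma Pg_SucI: "Sg n Q \<Longrightarrow> Pg (Suc n) (\<lambda>x \<alpha>. \<forall>\<beta>. Q x (jn \<alpha> \<beta>))"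
  using Sg_SucI[of n "\<lambda>x \<alpha>. \<not> Q x \<alpha>"] by simp

text \<open>The function bound by the next quantifier occupies the right half of the oracle, so in
  the induction the substitution acts on the left half alone.\<close>

lemma Sg_subst:
  "Sg n P \<Longrightarrow> Dfun f \<Longrightarrow> Dop H \<Longrightarrow> Sg n (\<lambda>x \<alpha>. P (f x \<alpha>) (H x \<alpha>))"
proof (induction n arbitrary: P f H)
  case 0
  then show ?case by (simp add: Dpred_subst)
next
  case (Suc n)
  then obtain Q where Q: "Pg n Q" "P = (\<lambda>x \<alpha>. \<exists>\<beta>. Q x (jn \<alpha> \<beta>))" by auto
  have 1: "Dfun (\<lambda>x \<alpha>. f x (lft \<alpha>))"
    by (intro Dfun_subst[OF Suc.prems(2)] D_intros Dop_intros)
  have 2: "Dop (\<lambda>x \<alpha>. jn (H x (lft \<alpha>)) (rgt \<alpha>))"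
    by (intro Dop_intros Dop_subst[OF Suc.prems(3)] D_intros)
  have "Pg n (\<lambda>x \<alpha>. Q (f x (lft \<alpha>)) (jn (H x (lft \<alpha>)) (rgt \<alpha>)))"
    using Suc.IH[OF Q(1) 1 2] .
  from Sg_SucI[OF this] show ?case by (simp add: Q)
qed

lemma Pg_subst:
  "Pg n P \<Longrightarrow> Dfun f \<Longrightarrow> Dop H \<Longrightarrow> Pg n (\<lambda>x \<alpha>. P (f x \<alpha>) (H x \<alpha>))"
  using Sg_subst[of n "\<lambda>x \<alpha>. \<not> P x \<alpha>"] by simp

lemma Sg_Suc_Pg: assumes "Pg n P" shows "Sg (Suc n) P"
proof -
  have "Pg n (\<lambda>x \<alpha>. P x (lft \<alpha>))"
    by (intro Pg_subst[OF assms] D_intros Dop_intros)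
  from Sg_SucI[OF this] show ?thesis by simp
qed

lemma Pg_Suc_Sg: "Sg n P \<Longrightarrow> Pg (Suc n) P"
  using Sg_Suc_Pg[of n "\<lambda>x \<alpha>. \<not> P x \<alpha>"] by simp

lemma Sg_ExF:
  assumes "Sg (Suc n) P"
  shows "Sg (Suc n) (\<lambda>x \<alpha>. \<exists>\<beta>. P x (jn \<alpha> \<beta>))"
proof -
  obtain Q where Q: "Pg n Q" "P = (\<lambda>x \<alpha>. \<exists>\<beta>. Q x (jn \<alpha> \<beta>))" using assms by auto
  have "Pg n (\<lambda>x \<gamma>. Q x (jn (jn (lft \<gamma>) (lft (rgt \<gamma>))) (rgt (rgt \<gamma>))))"
    by (intro Pg_subst[OF Q(1)] D_intros Dop_intros)
  from Sg_SucI[OF this] have "Sg (Suc n) (\<lambda>x \<alpha>. \<exists>\<beta>. Q x (jn (jn \<alpha> (lft \<beta>)) (rgt \<beta>)))"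
    by simp
  moreover have "(\<exists>\<beta>. Q x (jn (jn \<alpha> (lft \<beta>)) (rgt \<beta>))) \<longleftrightarrow> (\<exists>\<beta>. P x (jn \<alpha> \<beta>))" for x \<alpha>
    unfolding Q by (metis lft_jn rgt_jn)
  ultimately show ?thesis by simp
qed

lemma Pg_AllF: "Pg (Suc n) P \<Longrightarrow> Pg (Suc n) (\<lambda>x \<alpha>. \<forall>\<beta>. P x (jn \<alpha> \<beta>))"
  using Sg_ExF[of n "\<lambda>x \<alpha>. \<not> P x \<alpha>"] by simp

text \<open>Conjunction and disjunction are treated together, since the negation hidden in
  \<open>Pg\<close> exchanges them at each level. A conjunction needs two independent witnesses, the
  halves of one function; a disjunction can use a common one.\<close>

lemma Sg_Pg_conj_disj:
  "(Sg n P \<longrightarrow> Sg n Q \<longrightarrow> Sg n (\<lambda>x \<alpha>. P x \<alpha> \<and> Q x \<alpha>)) \<and>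
   (Sg n P \<longrightarrow> Sg n Q \<longrightarrow> Sg n (\<lambda>x \<alpha>. P x \<alpha> \<or> Q x \<alpha>))"
proof (induction n arbitrary: P Q)
  case 0
  then show ?case by (simp add: Dpred_conj Dpred_disj)
next
  case (Suc n)
  have "Sg (Suc n) (\<lambda>x \<alpha>. P x \<alpha> \<and> Q x \<alpha>) \<and> Sg (Suc n) (\<lambda>x \<alpha>. P x \<alpha> \<or> Q x \<alpha>)"
    if PQ: "Sg (Suc n) P" "Sg (Suc n) Q"
  proof -
    obtain R where R: "Pg n R" "P = (\<lambda>x \<alpha>. \<exists>\<beta>. R x (jn \<alpha> \<beta>))" using PQ(1) unfolding Sg.simps by blast
    obtain S where S: "Pg n S" "Q = (\<lambda>x \<alpha>. \<exists>\<beta>. S x (jn \<alpha> \<beta>))" using PQ(2) unfolding Sg.simps by blast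
    have "Pg n (\<lambda>x \<gamma>. R x (jn (lft \<gamma>) (lft (rgt \<gamma>))))" "Pg n (\<lambda>x \<gamma>. S x (jn (lft \<gamma>) (rgt (rgt \<gamma>))))"
      by (intro Pg_subst[OF R(1)] Pg_subst[OF S(1)] D_intros Dop_intros)+
    then have "Pg n (\<lambda>x \<gamma>. R x (jn (lft \<gamma>) (lft (rgt \<gamma>))) \<and> S x (jn (lft \<gamma>) (rgt (rgt \<gamma>))))"
      using Suc.IH unfolding de_Morgan_conj by blast
    from Sg_SucI[OF this] have 1:
       "Sg (Suc n) (\<lambda>x \<alpha>. \<exists>\<beta>. R x (jn \<alpha> (lft \<beta>)) \<and> S x (jn \<alpha> (rgt \<beta>)))"
      by simp
    have "Pg n (\<lambda>x \<gamma>. R x \<gamma> \<or> S x \<gamma>)" using R S Suc.IH unfolding de_Morgan_disj by blast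
    from Sg_SucI[OF this] have 2: "Sg (Suc n) (\<lambda>x \<alpha>. \<exists>\<beta>. R x (jn \<alpha> \<beta>) \<or> S x (jn \<alpha> \<beta>))"
      by simp
    have "(\<exists>\<beta>. R x (jn \<alpha> (lft \<beta>)) \<and> S x (jn \<alpha> (rgt \<beta>))) \<longleftrightarrow> P x \<alpha> \<and> Q x \<alpha>" for x \<alpha>
      unfolding R S by (metis lft_jn rgt_jn)
    moreover have "(\<exists>\<beta>. R x (jn \<alpha> \<beta>) \<or> S x (jn \<alpha> \<beta>)) \<longleftrightarrow> P x \<alpha> \<or> Q x \<alpha>" for x \<alpha>
      unfolding R S by blast
    ultimately show ?thesis using 1 2 by simp
  qed
  then show ?case by blast
qed

lemma Sg_conj: "Sg n P \<Longrightarrow> Sg n Q \<Longrightarrow> Sg n (\<lambda>x \<alpha>. P x \<alpha> \<and> Q x \<alpha>)"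
  and Sg_disj: "Sg n P \<Longrightarrow> Sg n Q \<Longrightarrow> Sg n (\<lambda>x \<alpha>. P x \<alpha> \<or> Q x \<alpha>)"
  using Sg_Pg_conj_disj by auto

lemma Pg_conj: "Pg n P \<Longrightarrow> Pg n Q \<Longrightarrow> Pg n (\<lambda>x \<alpha>. P x \<alpha> \<and> Q x \<alpha>)"
  and Pg_disj: "Pg n P \<Longrightarrow> Pg n Q \<Longrightarrow> Pg n (\<lambda>x \<alpha>. P x \<alpha> \<or> Q x \<alpha>)"
  using Sg_disj[of n "\<lambda>x \<alpha>. \<not> P x \<alpha>" "\<lambda>x \<alpha>. \<not> Q x \<alpha>"]
   Sg_conj[of n "\<lambda>x \<alpha>. \<not> P x \<alpha>" "\<lambda>x \<alpha>. \<not> Q x \<alpha>"] by auto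

text \<open>An existential number is the value of a function at 0. The universal number quantifier
  passes across the existential function quantifier by countable choice: the witnesses for all
  \<open>a\<close> are stored in one function with rows
  \<open>\<lambda>k. \<beta> (pr a k)\<close>.\<close>

lemma Sg_num_quants:
  assumes "Sg n (\<lambda>z \<alpha>. P (p1 z) (p2 z) \<alpha>)"
  shows "Sg n (\<lambda>x \<alpha>. \<exists>a. P a x \<alpha>) \<and> Sg n (\<lambda>x \<alpha>. \<forall>a. P a x \<alpha>)"
  using assms
proof (induction n arbitrary: P)
  case 0
  then show ?case by (simp add: Dpred_ex Dpred_all)
next
  case (Suc n)
  have "Sg (Suc n) (\<lambda>x \<alpha>. P (p1 (pr (rgt \<alpha> 0) x)) (p2 (pr (rgt \<alpha> 0) x)) (lft \<alpha>))"
    unfolding rgt_def by (intro Sg_subst[OF Suc.prems] D_intros Dop_intros)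
  from Sg_ExF[OF this] have "Sg (Suc n) (\<lambda>x \<alpha>. \<exists>\<beta>::nat \<Rightarrow> nat. P (\<beta> 0) x \<alpha>)" by simp
  moreover have "(\<exists>\<beta>::nat\<Rightarrow>nat. P (\<beta> 0) x \<alpha>) \<longleftrightarrow> (\<exists>a. P a x \<alpha>)" for x \<alpha>
    by (auto intro: exI[of _ "\<lambda>_. a" for a])
  ultimately have ex: "Sg (Suc n) (\<lambda>x \<alpha>. \<exists>a. P a x \<alpha>)" by simp
  obtain Q where Q: "Pg n Q" "(\<lambda>z \<alpha>. P (p1 z) (p2 z) \<alpha>) = (\<lambda>x \<alpha>. \<exists>\<beta>. Q x (jn \<alpha> \<beta>))"
    using Suc.prems by auto
  have PQ: "P a x \<alpha> \<longleftrightarrow> (\<exists>\<beta>. Q (pr a x) (jn \<alpha> \<beta>))" for a x \<alpha>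
    using fun_cong[OF fun_cong[OF Q(2), of "pr a x"], of \<alpha>] by simp
  have "Dop (\<lambda>z \<gamma>. jn (lft \<gamma>) (\<lambda>k. rgt \<gamma> (pr (p1 z) k)))"
    unfolding rgt_def by (intro Dop_intros) (unfold Dop_def, intro D_intros)
  then have "Pg n (\<lambda>z \<gamma>. Q (pr (p1 z) (p2 z)) (jn (lft \<gamma>) (\<lambda>k. rgt \<gamma> (pr (p1 z) k))))"
    by (intro Pg_subst[OF Q(1)] D_intros)
  then have "Pg n (\<lambda>x \<gamma>. \<forall>a. Q (pr a x) (jn (lft \<gamma>) (\<lambda>k. rgt \<gamma> (pr a k))))"
    using Suc.IH[of "\<lambda>a x \<gamma>. \<not> Q (pr a x) (jn (lft \<gamma>) (\<lambda>k. rgt \<gamma> (pr a k)))"] by simp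
  from Sg_SucI[OF this] have "Sg (Suc n) (\<lambda>x \<alpha>. \<exists>\<beta>. \<forall>a. Q (pr a x) (jn \<alpha> (\<lambda>k. \<beta> (pr a k))))"
    by simp
  moreover have "(\<exists>\<beta>. \<forall>a. Q (pr a x) (jn \<alpha> (\<lambda>k. \<beta> (pr a k)))) \<longleftrightarrow> (\<forall>a. P a x \<alpha>)" for x \<alpha>
  proof
    assume "\<forall>a. P a x \<alpha>"
    then have "\<forall>a. \<exists>\<beta>. Q (pr a x) (jn \<alpha> \<beta>)" by (simp add: PQ)
    then obtain B where B: "\<And>a. Q (pr a x) (jn \<alpha> (B a))" by metis
    show "\<exists>\<beta>. \<forall>a. Q (pr a x) (jn \<alpha> (\<lambda>k. \<beta> (pr a k)))"
      by (rule exI[of _ "\<lambda>z. B (p1 z) (p2 z)"]) (simp add: B)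
  qed (auto simp: PQ)
  ultimately show ?case using ex by simp
qed

lemma Sg_exN: "Sg n (\<lambda>z \<alpha>. P (p1 z) (p2 z) \<alpha>) \<Longrightarrow> Sg n (\<lambda>x \<alpha>. \<exists>a. P a x \<alpha>)"
  using Sg_num_quants by blast

lemma Pg_exN: "Pg n (\<lambda>z \<alpha>. P (p1 z) (p2 z) \<alpha>) \<Longrightarrow> Pg n (\<lambda>x \<alpha>. \<exists>a. P a x \<alpha>)"
  using Sg_num_quants[of n "\<lambda>a x \<alpha>. \<not> P a x \<alpha>"] by simp

lemma Delta_mono:
  assumes "Sg n P" "Pg n P" "n \<le> m"
  shows "Sg m P \<and> Pg m P"
  using assms(3,1,2) by (induction m rule: dec_induct) (auto dest: Sg_Suc_Pg Pg_Suc_Sg simp del: Sg.simps)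

lemma Dpred_Delta: "Dpred P \<Longrightarrow> Sg n P \<and> Pg n P"
  using Delta_mono[of 0 P n] Dpred_not[of P] by simp

declare Sg.simps [simp del]

section \<open>A universal function\<close>

text \<open>Tag 0 gives no decrease, as \<open>pr 0 0 = 0\<close>; hence \<open>dec\<close> reads
  subcodes only under positive tags.\<close>

lemma p2_less: "0 < p1 e \<Longrightarrow> p2 e < e"
proof -
  assume *: "0 < p1 e"
  have t: "m \<le> triangle m" for m by (induction m) auto
  have "pr (p1 e) (p2 e) = triangle (p1 e + p2 e) + p1 e" by (simp only: prod_encode_def split)
  then have "e = triangle (p1 e + p2 e) + p1 e" by simp
  with t[of "p1 e + p2 e"] * show ?thesis by linarith
qed

lemma p1_le: "p1 e \<le> e" and p2_le: "p2 e \<le> e"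
  using le_prod_encode_1[of "p1 e" "p2 e"] le_prod_encode_2[of "p2 e" "p1 e"] by auto

function dec :: "nat \<Rightarrow> ix" where
  "dec e = (if p1 e = 1 then ISucc else if p1 e = 2 then IFst else if p1 e = 3 then ISnd
    else if p1 e = 4 then IOrc
    else if p1 e = 5 then IPair (dec (p1 (p2 e))) (dec (p2 (p2 e)))
    else if p1 e = 6 then IComp (dec (p1 (p2 e))) (dec (p2 (p2 e)))
    else if p1 e = 7 then IIter (dec (p2 e))
    else if p1 e = 8 then IMu (dec (p2 e)) else IZero)"
  by auto
termination
proof (relation "measure id")
  fix e :: nat
  have "p1 (p2 e) \<le> p2 e" "p2 (p2 e) \<le> p2 e" by (rule p1_le, rule p2_le)
  moreover have "0 < p1 e \<Longrightarrow> p2 e < e" by (rule p2_less)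
  ultimately have *: "0 < p1 e \<Longrightarrow> p1 (p2 e) < e \<and> p2 (p2 e) < e \<and> p2 e < e" by linarith
  show "p1 e = 5 \<Longrightarrow> (p1 (p2 e), e) \<in> measure id" "p1 e = 5 \<Longrightarrow> (p2 (p2 e), e) \<in> measure id"
    "p1 e = 6 \<Longrightarrow> (p1 (p2 e), e) \<in> measure id" "p1 e = 6 \<Longrightarrow> (p2 (p2 e), e) \<in> measure id"
    "p1 e = 7 \<Longrightarrow> (p2 e, e) \<in> measure id" "p1 e = 8 \<Longrightarrow> (p2 e, e) \<in> measure id"
    using * by auto
qed auto

declare dec.simps [simp del]

lemma dec_pr [simp]:
  "dec (pr 0 a) = IZero" "dec (pr 1 a) = ISucc" "dec (pr (Suc 0) a) = ISucc"
  "dec (pr 2 a) = IFst" "dec (pr 3 a) = ISnd" "dec (pr 4 a) = IOrc"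
  "dec (pr 5 a) = IPair (dec (p1 a)) (dec (p2 a))"
  "dec (pr 6 a) = IComp (dec (p1 a)) (dec (p2 a))"
  "dec (pr 7 a) = IIter (dec a)" "dec (pr 8 a) = IMu (dec a)" "dec (pr (k + 9) a) = IZero"
  by (subst dec.simps, simp)+

lemma dec_surj: "\<exists>e. dec e = c"
proof (induction c)
  case IZero
  show ?case by (rule exI[of _ "pr 0 0"]) simp
next
  case ISucc
  show ?case by (rule exI[of _ "pr 1 0"]) simp
next
  case IFst
  show ?case by (rule exI[of _ "pr 2 0"]) simp
next
  case ISnd
  show ?case by (rule exI[of _ "pr 3 0"]) simp
next
  case IOrc
  show ?case by (rule exI[of _ "pr 4 0"]) simp
next
  case (IPair c d)
  then obtain e f where "dec e = c" "dec f = d" by blast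
  then show ?case by (intro exI[of _ "pr 5 (pr e f)"]) simp
next
  case (IComp c d)
  then obtain e f where "dec e = c" "dec f = d" by blast
  then show ?case by (intro exI[of _ "pr 6 (pr e f)"]) simp
next
  case (IIter c)
  then obtain e where "dec e = c" by blast
  then show ?case by (intro exI[of _ "pr 7 e"]) simp
next
  case (IMu c)
  then obtain e where "dec e = c" by blast
  then show ?case by (intro exI[of _ "pr 8 e"]) simp
qed

text \<open>A function \<open>\<gamma>\<close> codes an oracle \<open>om \<gamma>\<close>, a truth function \<open>tr \<gamma>\<close>, intended to map \<open>pr e x\<close> to
  \<open>den (om \<gamma>) (dec e) x\<close>, and a halving function \<open>hf \<gamma>\<close>, which turns the pairing function into a term of
  the language of second-order arithmetic.\<close>

definition om :: "(nat \<Rightarrow> nat) \<Rightarrow> nat \<Rightarrow> nat" where "om \<gamma> = lft \<gamma>"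
definition tr :: "(nat \<Rightarrow> nat) \<Rightarrow> nat \<Rightarrow> nat" where "tr \<gamma> = lft (rgt \<gamma>)"
definition hf :: "(nat \<Rightarrow> nat) \<Rightarrow> nat \<Rightarrow> nat" where "hf \<gamma> = rgt (rgt \<gamma>)"
definition ppr :: "(nat \<Rightarrow> nat) \<Rightarrow> nat \<Rightarrow> nat \<Rightarrow> nat" where
  "ppr \<gamma> a b = hf \<gamma> ((a + b) * Suc (a + b)) + a"

definition clause :: "(nat \<Rightarrow> nat) \<Rightarrow> nat \<Rightarrow> nat \<Rightarrow> nat \<Rightarrow> nat \<Rightarrow> nat \<Rightarrow> bool" where
  "clause \<gamma> a b x y k \<longleftrightarrow>
    hf \<gamma> (x + x) = x \<and>
    tr \<gamma> (ppr \<gamma> (ppr \<gamma> 0 a) x) = 0 \<and>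
    tr \<gamma> (ppr \<gamma> (ppr \<gamma> 1 a) x) = Suc x \<and>
    tr \<gamma> (ppr \<gamma> (ppr \<gamma> 2 a) (ppr \<gamma> x y)) = x \<and>
    tr \<gamma> (ppr \<gamma> (ppr \<gamma> 3 a) (ppr \<gamma> x y)) = y \<and>
    tr \<gamma> (ppr \<gamma> (ppr \<gamma> 4 a) x) = om \<gamma> x \<and>
    tr \<gamma> (ppr \<gamma> (ppr \<gamma> 5 (ppr \<gamma> a b)) x) = ppr \<gamma> (tr \<gamma> (ppr \<gamma> a x)) (tr \<gamma> (ppr \<gamma> b x)) \<and>
    tr \<gamma> (ppr \<gamma> (ppr \<gamma> 6 (ppr \<gamma> a b)) x) = tr \<gamma> (ppr \<gamma> a (tr \<gamma> (ppr \<gamma> b x))) \<and>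
    tr \<gamma> (ppr \<gamma> (ppr \<gamma> 7 a) (ppr \<gamma> 0 x)) = x \<and>
    tr \<gamma> (ppr \<gamma> (ppr \<gamma> 7 a) (ppr \<gamma> (Suc k) x)) =
      tr \<gamma> (ppr \<gamma> a (tr \<gamma> (ppr \<gamma> (ppr \<gamma> 7 a) (ppr \<gamma> k x)))) \<and>
    (tr \<gamma> (ppr \<gamma> (ppr \<gamma> 8 a) x) = 0 \<longrightarrow> \<not> tr \<gamma> (ppr \<gamma> a (ppr \<gamma> k x)) = 0) \<and>
    (tr \<gamma> (ppr \<gamma> (ppr \<gamma> 8 a) x) = Suc y \<longrightarrow> tr \<gamma> (ppr \<gamma> a (ppr \<gamma> y x)) = 0) \<and>
    (tr \<gamma> (ppr \<gamma> (ppr \<gamma> 8 a) x) = Suc (Suc (k + y)) \<longrightarrow> \<not> tr \<gamma> (ppr \<gamma> a (ppr \<gamma> k x)) = 0) \<and>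
    tr \<gamma> (ppr \<gamma> (ppr \<gamma> (k + 9) a) x) = 0"

definition Cl :: "(nat \<Rightarrow> nat) \<Rightarrow> bool" where
  "Cl \<gamma> \<longleftrightarrow> (\<forall>a b x y k. clause \<gamma> a b x y k)"

lemma ppr_eq:
  assumes "\<And>x. hf \<gamma> (x + x) = x"
  shows "ppr \<gamma> a b = pr a b"
proof -
  have "even ((a + b) * Suc (a + b))" by simp
  then have "(a + b) * Suc (a + b) = triangle (a + b) + triangle (a + b)"
    unfolding triangle_def by presburger
  then have "hf \<gamma> ((a + b) * Suc (a + b)) = triangle (a + b)" using assms by metis
  then show ?thesis by (simp add: ppr_def prod_encode_def)
qed

text \<open>The clauses determine the truth function by strong induction on the code, since subcodes
  are smaller numbers. At tag 7 an inner induction counts the iterations; at tag 8 the three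
  implications leave a single possible value.\<close>

lemma tr_Cl:
  assumes "Cl \<gamma>"
  shows "tr \<gamma> (pr e x) = den (om \<gamma>) (dec e) x"
proof -
  have "hf \<gamma> (x + x) = x" for x using assms unfolding Cl_def clause_def by blast
  note p = ppr_eq[OF this]
  have c: "clause \<gamma> a b x y k" for a b x y k using assms unfolding Cl_def by blast
  note c = c[unfolded clause_def p]
  show ?thesis
  proof (induction e arbitrary: x rule: less_induct)
    case (less e)
    define t a where "t = p1 e" and "a = p2 e"
    then have e: "e = pr t a" by simp
    have lt: "a < e" "p1 a < e" "p2 a < e" if "t \<noteq> 0"
      using that p2_less[of e] p1_le[of a] p2_le[of a] unfolding t_def a_def by auto
    consider "t = 0" | "t = 1" | "t = 2" | "t = 3" | "t = 4" | "t = 5" | "t = 6" | "t = 7" | "t = 8"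
      | k where "t = k + 9"
      by (cases "t < 9") (fastforce, metis add.commute le_Suc_ex not_less)
    then show ?case
    proof cases
      case 1
      then show ?thesis unfolding e using c[where a=a and x=x] by simp
    next
      case 2
      then show ?thesis unfolding e using c[where a=a and x=x] by simp
    next
      case 3
      have "tr \<gamma> (pr (pr 2 a) (pr (p1 x) (p2 x))) = p1 x" using c by blast
      then show ?thesis unfolding e using 3 by simp
    next
      case 4
      have "tr \<gamma> (pr (pr 3 a) (pr (p1 x) (p2 x))) = p2 x" using c by blast
      then show ?thesis unfolding e using 4 by simp
    next
      case 5
      then show ?thesis unfolding e using c[where a=a and x=x] by simp
    next
      case 6
      have "tr \<gamma> (pr (pr 5 (pr (p1 a) (p2 a))) x) = pr (tr \<gamma> (pr (p1 a) x)) (tr \<gamma> (pr (p2 a) x))" using c by blast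
      then show ?thesis using 6 less.IH[OF lt(2)] less.IH[OF lt(3)] unfolding e by simp
    next
      case 7
      have "tr \<gamma> (pr (pr 6 (pr (p1 a) (p2 a))) x) = tr \<gamma> (pr (p1 a) (tr \<gamma> (pr (p2 a) x)))" using c by blast
      then show ?thesis using 7 less.IH[OF lt(2)] less.IH[OF lt(3)] unfolding e by simp
    next
      case 8
      have IH: "tr \<gamma> (pr a z) = den (om \<gamma>) (dec a) z" for z using 8 less.IH[OF lt(1)] by simp
      have "tr \<gamma> (pr (pr 7 a) (pr k z)) = (den (om \<gamma>) (dec a) ^^ k) z" for k z
      proof (induction k)
        case 0
        show ?case using c by simp
      next
        case (Suc k)
        have "tr \<gamma> (pr (pr 7 a) (pr (Suc k) z)) = tr \<gamma> (pr a (tr \<gamma> (pr (pr 7 a) (pr k z))))" using c by blast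
        then show ?case using Suc IH by simp
      qed
      then have "tr \<gamma> (pr (pr 7 a) (pr (p1 x) (p2 x))) = (den (om \<gamma>) (dec a) ^^ p1 x) (p2 x)" .
      then show ?thesis unfolding e using 8 by simp
    next
      case 9
      have IH: "tr \<gamma> (pr a z) = den (om \<gamma>) (dec a) z" for z using 9 less.IH[OF lt(1)] by simp
      let ?m = "tr \<gamma> (pr (pr 8 a) x)"
      have 1: "?m = 0 \<Longrightarrow> \<not> den (om \<gamma>) (dec a) (pr k x) = 0" for k
        using c[where a=a and x=x and k=k] by (simp add: IH)
      have 2: "?m = Suc y \<Longrightarrow> den (om \<gamma>) (dec a) (pr y x) = 0" for y
        using c[where a=a and x=x and y=y] by (simp add: IH)
      have 3: "?m = Suc y \<Longrightarrow> k < y \<Longrightarrow> \<not> den (om \<gamma>) (dec a) (pr k x) = 0" for y k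
        using c[where a=a and x=x and y="y - Suc k" and k=k] by (simp add: IH)
      have "?m = den (om \<gamma>) (IMu (dec a)) x"
      proof (cases ?m)
        case 0
        then show ?thesis using 1 by simp
      next
        case (Suc y)
        then have "(LEAST k. den (om \<gamma>) (dec a) (pr k x) = 0) = y"
          by (intro Least_equality) (use 2 3[OF Suc] in \<open>simp, meson not_less\<close>)
        then show ?thesis using 2[OF Suc] Suc by auto
      qed
      then show ?thesis unfolding e using 9 by simp
    next
      case (10 k)
      have "tr \<gamma> (pr (pr (k + 9) a) x) = 0" using c by blast
      then show ?thesis unfolding e using 10 by simp
    qed
  qed
qed

lemma ex_Cl: "\<exists>\<gamma>. om \<gamma> = \<alpha> \<and> Cl \<gamma>"
proof -
  define \<gamma> where "\<gamma> = jn \<alpha> (jn (\<lambda>z. den \<alpha> (dec (p1 z)) (p2 z)) (\<lambda>z. z div 2))"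
  have o: "om \<gamma> = \<alpha>" and t: "tr \<gamma> = (\<lambda>z. den \<alpha> (dec (p1 z)) (p2 z))" and h: "hf \<gamma> = (\<lambda>z. z div 2)"
    by (simp_all add: \<gamma>_def om_def tr_def hf_def)
  have p: "ppr \<gamma> a b = pr a b" for a b by (rule ppr_eq) (simp add: h)
  have L: "Q k \<noteq> 0" if "(LEAST k. Q k = 0) = Suc (k + y)" for Q :: "nat \<Rightarrow> nat" and k y
    using not_less_Least[of k "\<lambda>k. Q k = 0"] that by simp
  have "clause \<gamma> a b x y k" for a b x y k
    unfolding clause_def p o t h
    by (auto dest: L intro: LeastI split: if_split_asm)
  then show ?thesis using o unfolding Cl_def by blast
qed

text \<open>A suitable \<open>\<gamma>\<close> exists and all of them agree on \<open>tr\<close>, so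
  a statement about a value of \<open>den\<close> is existential over
  \<open>\<gamma>\<close>.\<close>

lemma Cl_iff: "(\<exists>\<gamma>. om \<gamma> = \<alpha> \<and> Cl \<gamma> \<and> R (tr \<gamma> (pr e x))) \<longleftrightarrow> R (den \<alpha> (dec e) x)"
  using tr_Cl ex_Cl by metis

lemma Dfun_om: "Dfun f \<Longrightarrow> Dfun (\<lambda>x \<gamma>. om \<gamma> (f x \<gamma>))"
  and Dfun_tr: "Dfun f \<Longrightarrow> Dfun (\<lambda>x \<gamma>. tr \<gamma> (f x \<gamma>))"
  and Dfun_hf: "Dfun f \<Longrightarrow> Dfun (\<lambda>x \<gamma>. hf \<gamma> (f x \<gamma>))"
  unfolding om_def tr_def hf_def lft_def rgt_def by (intro D_intros; assumption)+

lemma Dfun_ppr: "Dfun f \<Longrightarrow> Dfun g \<Longrightarrow> Dfun (\<lambda>x \<gamma>. ppr \<gamma> (f x \<gamma>) (g x \<gamma>))"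
  unfolding ppr_def by (intro D_intros Dfun_hf)

lemma Dpred_clause:
  assumes "Dfun a" "Dfun b" "Dfun x" "Dfun y" "Dfun k"
  shows "Dpred (\<lambda>z \<gamma>. clause \<gamma> (a z \<gamma>) (b z \<gamma>) (x z \<gamma>) (y z \<gamma>) (k z \<gamma>))"
  unfolding clause_def by (intro Dpred_conj Dpred_imp Dpred_not Dpred_eq Dfun_ppr Dfun_hf Dfun_tr Dfun_om
    Dfun_plus Dfun_Suc Dfun_const assms)

definition clause_code :: "(nat \<Rightarrow> nat) \<Rightarrow> nat \<Rightarrow> bool" where
  "clause_code \<gamma> j = clause \<gamma> (p1 j) (p1 (p2 j)) (p1 (p2 (p2 j))) (p1 (p2 (p2 (p2 j)))) (p2 (p2 (p2 (p2 j))))"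

lemma Cl_code: "Cl \<gamma> \<longleftrightarrow> (\<forall>j. clause_code \<gamma> j)"
proof
  assume *: "\<forall>j. clause_code \<gamma> j"
  have "clause \<gamma> a b x y k" for a b x y k
    using *[rule_format, of "pr a (pr b (pr x (pr y k)))"] by (simp add: clause_code_def)
  then show "Cl \<gamma>" by (simp add: Cl_def)
qed (simp add: Cl_def clause_code_def)

lemma Dpred_clause_code: "Dfun j \<Longrightarrow> Dpred (\<lambda>z \<gamma>. clause_code \<gamma> (j z \<gamma>))"
  unfolding clause_code_def by (intro Dpred_clause D_intros)

lemma Dpred_Cl: "Dpred (\<lambda>z \<gamma>. Cl \<gamma>)"
  unfolding Cl_code by (intro Dpred_all Dpred_clause_code D_intros)

lemma Dpred_fun_eq: assumes "Dop G" "Dop H" shows "Dpred (\<lambda>x \<alpha>. G x \<alpha> = H x \<alpha>)"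
  unfolding fun_eq_iff by (intro Dpred_all Dpred_eq Dfun_app[OF assms(1)] Dfun_app[OF assms(2)] D_intros)

text \<open>Here the code is an argument, so the relation can leave the base level. One function
  quantifier guesses the table; using \<open>\<not> R\<close> in place of \<open>R\<close> gives the
  dual form. The number \<open>z\<close> packs code, input and a parameter of
  \<open>R\<close>.\<close>

lemma den_graph_Delta:
  assumes R: "Dpred (\<lambda>w \<alpha>. R (p1 w) (p2 w))"
  shows "Sg 1 (\<lambda>z \<alpha>. R (p2 z) (den \<alpha> (dec (p1 (p1 z))) (p2 (p1 z))))" (is ?A)
    and "Pg 1 (\<lambda>z \<alpha>. R (p2 z) (den \<alpha> (dec (p1 (p1 z))) (p2 (p1 z))))" (is ?B)
proof -
  have *: "Sg 1 (\<lambda>z \<alpha>. R (p2 z) (den \<alpha> (dec (p1 (p1 z))) (p2 (p1 z))))"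
    if R: "Dpred (\<lambda>w \<alpha>. R (p1 w) (p2 w))" for R
  proof -
    have D: "Dfun (\<lambda>z \<delta>. pr (p2 z) (tr (rgt \<delta>) (pr (p1 (p1 z)) (p2 (p1 z)))))"
      unfolding tr_def lft_def rgt_def by (intro D_intros)
    have "Dpred (\<lambda>z \<delta>. R (p2 z) (tr (rgt \<delta>) (pr (p1 (p1 z)) (p2 (p1 z)))))"
      using Dpred_comp[OF R D] by simp
    then have "Dpred (\<lambda>z \<delta>. om (rgt \<delta>) = lft \<delta> \<and> Cl (rgt \<delta>) \<and> R (p2 z) (tr (rgt \<delta>) (pr (p1 (p1 z)) (p2 (p1 z)))))"
      unfolding om_def by (intro Dpred_conj Dpred_fun_eq Dop_intros Dpred_subst[OF Dpred_Cl Dfun_id])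
    then have "Pg 0 (\<lambda>z \<delta>. om (rgt \<delta>) = lft \<delta> \<and> Cl (rgt \<delta>) \<and> R (p2 z) (tr (rgt \<delta>) (pr (p1 (p1 z)) (p2 (p1 z)))))"
      using Dpred_Delta by blast
    from Sg_SucI[OF this] show ?thesis
      unfolding lft_jn rgt_jn Cl_iff by simp
  qed
  from *[OF R] *[of "\<lambda>a b. \<not> R a b", OF Dpred_not[OF R]] show ?A ?B .
qed

lemma Dpred_index:
  assumes "Dpred P" shows "\<exists>e. \<forall>x \<alpha>. P x \<alpha> \<longleftrightarrow> den \<alpha> (dec e) x = 0"
proof -
  obtain c where c: "\<And>x \<alpha>. (if P x \<alpha> then 0 else 1) = den \<alpha> c x"
    using assms unfolding Dpred_def Dfun_def by metis
  obtain e where e: "dec e = c" using dec_surj by blast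
  have "P x \<alpha> \<longleftrightarrow> den \<alpha> (dec e) x = 0" for x \<alpha> using c[of x \<alpha>] e by (auto split: if_splits)
  then show ?thesis by blast
qed

section \<open>Comparison with the formulas of second-order arithmetic\<close>

definition asg :: "nat \<Rightarrow> nat \<Rightarrow> nat" where "asg x i = p1 ((p2 ^^ i) x)"

primrec upd :: "nat \<Rightarrow> nat \<Rightarrow> nat \<Rightarrow> nat" where
  "upd 0 a x = pr a (p2 x)"
| "upd (Suc i) a x = pr (p1 x) (upd i a (p2 x))"

lemma asg_upd: "asg (upd i a x) = (asg x)(i := a)"
proof -
  have "asg (upd i a x) j = ((asg x)(i := a)) j" for j
  proof (induction i arbitrary: x j)
    case 0
    then show ?case by (cases j) (simp_all add: asg_def funpow_Suc_right del: funpow.simps(2))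
  next
    case (Suc i)
    then show ?case by (cases j) (simp_all add: asg_def funpow_Suc_right del: funpow.simps(2))
  qed
  then show ?thesis by blast
qed

lemma Dfun_upd: "Dfun a \<Longrightarrow> Dfun f \<Longrightarrow> Dfun (\<lambda>x \<alpha>. upd i (a x \<alpha>) (f x \<alpha>))"
  by (induction i arbitrary: f) (auto intro!: D_intros)

lemma Dfun_asg: "Dfun f \<Longrightarrow> Dfun (\<lambda>x \<alpha>. asg (f x \<alpha>) i)"
  unfolding asg_def
proof (rule Dfun_p1)
  show "Dfun f \<Longrightarrow> Dfun (\<lambda>x \<alpha>. (p2 ^^ i) (f x \<alpha>))"
    by (induction i) (auto intro!: D_intros)
qed

lemma Dfun_tval:
  assumes "\<And>i. Dfun (\<lambda>k \<alpha>. G \<alpha> i k)"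
  shows "Dfun (\<lambda>x \<alpha>. tval (asg x) (G \<alpha>) t)"
proof (induction t)
  case (FApp i t)
  from Dfun_comp[OF assms FApp, of i] show ?case by simp
qed (simp_all add: Dfun_asg Dfun_id Dfun_const Dfun_Suc Dfun_plus Dfun_times)

lemma Dpred_arithmetical:
  assumes "\<And>i. Dfun (\<lambda>k \<alpha>. G \<alpha> i k)"
  shows "arithmetical \<phi> \<Longrightarrow> Dpred (\<lambda>x \<alpha>. sat (asg x) (G \<alpha>) \<phi>)"
proof (induction \<phi>)
  case (ExN i \<phi>)
  have "Dpred (\<lambda>z \<alpha>. sat (asg (upd i (p1 z) (p2 z))) (G \<alpha>) \<phi>)"
    by (rule Dpred_comp[of "\<lambda>x \<alpha>. sat (asg x) (G \<alpha>) \<phi>"]) (use ExN in simp, intro Dfun_upd D_intros)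
  from Dpred_ex[of "\<lambda>a x \<alpha>. sat (asg (upd i a x)) (G \<alpha>) \<phi>", OF this] show ?case by (simp add: asg_upd)
next
  case (AllN i \<phi>)
  have "Dpred (\<lambda>z \<alpha>. sat (asg (upd i (p1 z) (p2 z))) (G \<alpha>) \<phi>)"
    by (rule Dpred_comp[of "\<lambda>x \<alpha>. sat (asg x) (G \<alpha>) \<phi>"]) (use AllN in simp, intro Dfun_upd D_intros)
  from Dpred_all[of "\<lambda>a x \<alpha>. sat (asg (upd i a x)) (G \<alpha>) \<phi>", OF this] show ?case by (simp add: asg_upd)
qed (simp_all add: Dpred_eq Dpred_not Dpred_conj Dfun_tval[OF assms])

lemma Dfun_upd_fun:
  assumes "\<And>i. Dfun (\<lambda>k \<alpha>. G \<alpha> i k)"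
  shows "Dfun (\<lambda>k \<gamma>. ((G (lft \<gamma>))(j := rgt \<gamma>)) i k)"
proof (cases "i = j")
  case True
  then show ?thesis unfolding rgt_def by (auto intro!: D_intros)
next
  case False
  then show ?thesis using Dfun_subst[OF assms Dfun_id Dop_lft[OF Dop_orc], of i] by simp
qed

text \<open>Function variables are read through an arbitrary \<open>G\<close> definable from the
  oracle, because a quantifier over variable \<open>j\<close> lengthens the oracle: afterwards
  \<open>j\<close> denotes the right half, and the other variables are read from the left
  half.\<close>

lemma Sg_sat:
  "(\<forall>\<phi> G. \<phi> \<in> Sigma_fm n \<longrightarrow> (\<forall>i. Dfun (\<lambda>k \<alpha>. G \<alpha> i k)) \<longrightarrow> Sg n (\<lambda>x \<alpha>. sat (asg x) (G \<alpha>) \<phi>)) \<and>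
   (\<forall>\<phi> G. \<phi> \<in> Pi_fm n \<longrightarrow> (\<forall>i. Dfun (\<lambda>k \<alpha>. G \<alpha> i k)) \<longrightarrow> Pg n (\<lambda>x \<alpha>. sat (asg x) (G \<alpha>) \<phi>))"
proof (induction n)
  case 0
  then show ?case using Dpred_arithmetical Dpred_Delta[of _ 0] by (auto simp: Sg.simps)
next
  case (Suc n)
  show ?case
  proof (intro conjI allI impI)
    fix \<phi> and G :: "(nat \<Rightarrow> nat) \<Rightarrow> nat \<Rightarrow> nat \<Rightarrow> nat" assume "\<phi> \<in> Sigma_fm (Suc n)" and G: "\<forall>i. Dfun (\<lambda>k \<alpha>. G \<alpha> i k)"
    then obtain j \<psi> where \<psi>: "\<phi> = ExF j \<psi>" "\<psi> \<in> Pi_fm n" by auto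
    have "Pg n (\<lambda>x \<gamma>. sat (asg x) ((G (lft \<gamma>))(j := rgt \<gamma>)) \<psi>)"
      by (rule Suc.IH[THEN conjunct2, rule_format, OF \<psi>(2)]) (rule Dfun_upd_fun, use G in blast)
    from Sg_SucI[OF this] show "Sg (Suc n) (\<lambda>x \<alpha>. sat (asg x) (G \<alpha>) \<phi>)"
      by (simp add: \<psi>)
  next
    fix \<phi> and G :: "(nat \<Rightarrow> nat) \<Rightarrow> nat \<Rightarrow> nat \<Rightarrow> nat" assume "\<phi> \<in> Pi_fm (Suc n)" and G: "\<forall>i. Dfun (\<lambda>k \<alpha>. G \<alpha> i k)"
    then obtain j \<psi> where \<psi>: "\<phi> = AllF j \<psi>" "\<psi> \<in> Sigma_fm n" by auto
    have "Sg n (\<lambda>x \<gamma>. sat (asg x) ((G (lft \<gamma>))(j := rgt \<gamma>)) \<psi>)"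
      by (rule Suc.IH[THEN conjunct1, rule_format, OF \<psi>(2)]) (rule Dfun_upd_fun, use G in blast)
    from Pg_SucI[OF this] show "Pg (Suc n) (\<lambda>x \<alpha>. sat (asg x) (G \<alpha>) \<phi>)"
      by (simp add: \<psi>)
  qed
qed

lemma asg_pr0: "asg (pr x 0) = (\<lambda>_. 0)(0 := x)"
proof -
  have z: "prod_decode 0 = (0, 0)"
    using prod_encode_inverse[of "(0, 0)"] by (simp add: prod_encode_def)
  have "(p2 ^^ i) 0 = 0" for i by (induction i) (auto simp: z)
  then have "asg (pr x 0) i = ((\<lambda>_. 0)(0 := x)) i" for i
    by (cases i) (simp_all add: asg_def funpow_Suc_right z del: funpow.simps(2))
  then show ?thesis by blast
qed

lemma Sigma11_imp_Sg: "A \<in> Sigma11 n \<Longrightarrow> Sg n (\<lambda>x \<alpha>. x \<in> A)"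
  and Pi11_imp_Pg: "A \<in> Pi11 n \<Longrightarrow> Pg n (\<lambda>x \<alpha>. x \<in> A)"
proof -
  let ?z = "\<lambda>\<alpha>::nat \<Rightarrow> nat. \<lambda>i::nat. \<lambda>k::nat. 0::nat"
  have z: "\<forall>i. Dfun (\<lambda>k \<alpha>. ?z \<alpha> i k)" by (intro allI D_intros)
  {
    assume "A \<in> Sigma11 n"
    then obtain \<phi> where \<phi>: "\<phi> \<in> Sigma_fm n" "A = defined_set \<phi>" by (auto simp: Sigma11_def)
    have "Sg n (\<lambda>x \<alpha>. sat (asg x) (?z \<alpha>) \<phi>)"
      by (rule Sg_sat[THEN conjunct1, rule_format, OF \<phi>(1)]) (use z in blast)
    from Sg_subst[OF this Dfun_pr[OF Dfun_id Dfun_zero] Dop_orc]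
    show "Sg n (\<lambda>x \<alpha>. x \<in> A)" by (simp add: \<phi> defined_set_def asg_pr0)
  next
    assume "A \<in> Pi11 n"
    then obtain \<phi> where \<phi>: "\<phi> \<in> Pi_fm n" "A = defined_set \<phi>" by (auto simp: Pi11_def)
    have "Pg n (\<lambda>x \<alpha>. sat (asg x) (?z \<alpha>) \<phi>)"
      by (rule Sg_sat[THEN conjunct2, rule_format, OF \<phi>(1)]) (use z in blast)
    from Pg_subst[OF this Dfun_pr[OF Dfun_id Dfun_zero] Dop_orc]
    show "Pg n (\<lambda>x \<alpha>. x \<in> A)" by (simp add: \<phi> defined_set_def asg_pr0)
  }
qed

section \<open>From the semantic classes to formulas\<close>

definition tnum :: "nat \<Rightarrow> trm" where "tnum k = (TSucc ^^ k) TZero"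
text \<open>The three components of \<open>\<gamma>\<close> sit at the places 2t, 4t+1 and 4t+3,
  which explains this term and the next two.\<close>

definition omT :: "nat \<Rightarrow> trm \<Rightarrow> trm" where "omT d t = FApp d (TPlus t t)"
definition trT :: "nat \<Rightarrow> trm \<Rightarrow> trm" where
  "trT d t = FApp d (TSucc (TPlus (TPlus t t) (TPlus t t)))"
definition hfT :: "nat \<Rightarrow> trm \<Rightarrow> trm" where
  "hfT d t = FApp d (TSucc (TPlus (TSucc (TPlus t t)) (TSucc (TPlus t t))))"
definition pprT :: "nat \<Rightarrow> trm \<Rightarrow> trm \<Rightarrow> trm" where
  "pprT d a b = TPlus (hfT d (TTimes (TPlus a b) (TSucc (TPlus a b)))) a"
definition Imp :: "fm \<Rightarrow> fm \<Rightarrow> fm" where "Imp \<phi> \<psi> = Neg (Conj \<phi> (Neg \<psi>))"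

lemma tval_abbrevs [simp]:
  "tval s F (tnum k) = k"
  "tval s F (omT d t) = om (F d) (tval s F t)"
  "tval s F (trT d t) = tr (F d) (tval s F t)"
  "tval s F (hfT d t) = hf (F d) (tval s F t)"
  "tval s F (pprT d t u) = ppr (F d) (tval s F t) (tval s F u)"
  "sat s F (Imp \<phi> \<psi>) \<longleftrightarrow> (sat s F \<phi> \<longrightarrow> sat s F \<psi>)"
  "arithmetical (Imp \<phi> \<psi>) \<longleftrightarrow> arithmetical \<phi> \<and> arithmetical \<psi>"
proof -
  show "tval s F (tnum k) = k" unfolding tnum_def by (induction k) auto
  show h: "tval s F (hfT d t) = hf (F d) (tval s F t)" for t
    by (simp add: hfT_def hf_def rgt_def mult_2)
  show "tval s F (pprT d t u) = ppr (F d) (tval s F t) (tval s F u)"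
    by (simp add: pprT_def ppr_def h)
qed (simp_all add: omT_def om_def lft_def trT_def tr_def rgt_def mult_2 Imp_def)

definition clauseF :: "nat \<Rightarrow> fm" where
  "clauseF d = (let a = NVar 1; b = NVar 2; x = NVar 3; y = NVar 4; k = NVar 5; T = trT d; P = pprT d in
    Conj (Eq (hfT d (TPlus x x)) x)
   (Conj (Eq (T (P (P (tnum 0) a) x)) (tnum 0))
   (Conj (Eq (T (P (P (tnum 1) a) x)) (TSucc x))
   (Conj (Eq (T (P (P (tnum 2) a) (P x y))) x)
   (Conj (Eq (T (P (P (tnum 3) a) (P x y))) y)
   (Conj (Eq (T (P (P (tnum 4) a) x)) (omT d x))
   (Conj (Eq (T (P (P (tnum 5) (P a b)) x)) (P (T (P a x)) (T (P b x))))
   (Conj (Eq (T (P (P (tnum 6) (P a b)) x)) (T (P a (T (P b x)))))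
   (Conj (Eq (T (P (P (tnum 7) a) (P (tnum 0) x))) x)
   (Conj (Eq (T (P (P (tnum 7) a) (P (TSucc k) x))) (T (P a (T (P (P (tnum 7) a) (P k x))))))
   (Conj (Imp (Eq (T (P (P (tnum 8) a) x)) (tnum 0)) (Neg (Eq (T (P a (P k x))) (tnum 0))))
   (Conj (Imp (Eq (T (P (P (tnum 8) a) x)) (TSucc y)) (Eq (T (P a (P y x))) (tnum 0)))
   (Conj (Imp (Eq (T (P (P (tnum 8) a) x)) (TSucc (TSucc (TPlus k y)))) (Neg (Eq (T (P a (P k x))) (tnum 0))))
         (Eq (T (P (P (TPlus k (tnum 9)) a) x)) (tnum 0)))))))))))))))"

lemma sat_clauseF: "sat s F (clauseF d) \<longleftrightarrow> clause (F d) (s 1) (s 2) (s 3) (s 4) (s 5)"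
  unfolding clauseF_def clause_def Let_def by simp

definition ClF :: "nat \<Rightarrow> fm" where
  "ClF d = AllN 1 (AllN 2 (AllN 3 (AllN 4 (AllN 5 (clauseF d)))))"

lemma sat_ClF: "sat s F (ClF d) \<longleftrightarrow> Cl (F d)"
  by (simp add: ClF_def sat_clauseF Cl_def)

lemma arithmetical_ClF: "arithmetical (ClF d)"
  by (simp add: ClF_def clauseF_def Let_def)

primrec orc :: "nat \<Rightarrow> (nat \<Rightarrow> nat \<Rightarrow> nat) \<Rightarrow> nat \<Rightarrow> nat" where
  "orc 0 F = (\<lambda>_. 0)"
| "orc (Suc d) F = jn (orc d F) (F d)"

lemma orc_upd: "d \<le> i \<Longrightarrow> orc d (F(i := \<beta>)) = orc d F"
  by (induction d) auto

text \<open>There is no term for a function, so \<open>w\<close> accumulates the address in the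
  joined oracle; entering a left half doubles the address.\<close>

primrec orcF :: "nat \<Rightarrow> (trm \<Rightarrow> trm) \<Rightarrow> fm" where
  "orcF 0 w = AllN 1 (Eq (w (NVar 1)) TZero)"
| "orcF (Suc d) w = Conj (orcF d (\<lambda>t. w (TPlus t t)))
     (AllN 1 (Eq (w (TSucc (TPlus (NVar 1) (NVar 1)))) (FApp d (NVar 1))))"

lemma arithmetical_orcF: "arithmetical (orcF d w)"
  by (induction d arbitrary: w) auto

lemma eq_jn_iff: "\<gamma> = jn \<alpha> \<beta> \<longleftrightarrow> lft \<gamma> = \<alpha> \<and> rgt \<gamma> = \<beta>"
  by auto

lemma sat_orcF:
  assumes "\<And>s t. tval s F (w t) = W (tval s F t)"
  shows "sat s F (orcF d w) \<longleftrightarrow> W = orc d F"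
  using assms
proof (induction d arbitrary: w W)
  case 0
  then show ?case by auto
next
  case (Suc d)
  have "sat s F (orcF d (\<lambda>t. w (TPlus t t))) \<longleftrightarrow> lft W = orc d F"
    by (rule Suc.IH) (simp add: Suc.prems lft_def mult_2)
  moreover have "sat s F (AllN 1 (Eq (w (TSucc (TPlus (NVar 1) (NVar 1)))) (FApp d (NVar 1)))) \<longleftrightarrow> rgt W = F d"
    by (auto simp: Suc.prems rgt_def mult_2 fun_eq_iff)
  ultimately show ?case
    by (simp add: eq_jn_iff)
qed

text \<open>Oracle, witness and evaluation table merge into one \<open>\<gamma>\<close>, which
  leaves a matrix that is closed in \<open>\<gamma>\<close> and expressible by a formula.\<close>

lemma Sg_1_normal:
  assumes "Sg 1 P"
  shows "\<exists>e. \<forall>x \<alpha>. P x \<alpha> \<longleftrightarrow> (\<exists>\<gamma>. lft (om \<gamma>) = \<alpha> \<and> Cl \<gamma> \<and> tr \<gamma> (pr e x) = 0)"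
proof -
  obtain Q where Q: "Pg 0 Q" "P = (\<lambda>x \<alpha>. \<exists>\<beta>. Q x (jn \<alpha> \<beta>))"
    using assms by (auto simp: Sg.simps)
  then have "Dpred Q" using Dpred_not[of "\<lambda>x \<alpha>. \<not> Q x \<alpha>"] by (simp add: Sg.simps)
  then obtain e where "\<And>x \<alpha>. Q x \<alpha> \<longleftrightarrow> den \<alpha> (dec e) x = 0" using Dpred_index by blast
  then have "P x \<alpha> \<longleftrightarrow> (\<exists>\<gamma>. lft (om \<gamma>) = \<alpha> \<and> Cl \<gamma> \<and> tr \<gamma> (pr e x) = 0)" for x \<alpha>
    unfolding Q using Cl_iff[of "jn \<alpha> \<beta>" "\<lambda>v. v = 0" e x for \<beta>] by (metis lft_jn jn_lft_rgt)
  then show ?thesis by blast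
qed

lemma Sg_1_sat:
  assumes "Sg 1 P"
  shows "\<exists>\<phi>\<in>Sigma_fm 1. \<forall>s F. sat s F \<phi> \<longleftrightarrow> P (s 0) (orc d F)"
proof -
  obtain e where P: "\<And>x \<alpha>. P x \<alpha> \<longleftrightarrow> (\<exists>\<gamma>. lft (om \<gamma>) = \<alpha> \<and> Cl \<gamma> \<and> tr \<gamma> (pr e x) = 0)"
    using Sg_1_normal[OF assms] by blast
  let ?\<psi> = "Conj (orcF d (\<lambda>t. omT d (TPlus t t)))
    (Conj (ClF d) (Eq (trT d (pprT d (tnum e) (NVar 0))) TZero))"
  have "sat s F (ExF d ?\<psi>) \<longleftrightarrow> P (s 0) (orc d F)" for s F
  proof -
    have "sat s (F(d := \<gamma>)) (orcF d (\<lambda>t. omT d (TPlus t t))) \<longleftrightarrow> lft (om \<gamma>) = orc d (F(d := \<gamma>))" for \<gamma>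
      by (rule sat_orcF) (simp add: lft_def mult_2)
    moreover have "Cl \<gamma> \<Longrightarrow> ppr \<gamma> e x = pr e x" for \<gamma> x
      by (rule ppr_eq) (auto simp: Cl_def clause_def)
    ultimately show ?thesis unfolding P by (auto simp: sat_ClF orc_upd)
  qed
  moreover have "ExF d ?\<psi> \<in> Sigma_fm 1" by (simp add: arithmetical_orcF arithmetical_ClF)
  ultimately show ?thesis by blast
qed

lemma Sigma_Pi_fm_neg:
  "(\<forall>\<phi>\<in>Sigma_fm n. \<exists>\<psi>\<in>Pi_fm n. \<forall>s F. sat s F \<psi> \<longleftrightarrow> \<not> sat s F \<phi>) \<and>
   (\<forall>\<phi>\<in>Pi_fm n. \<exists>\<psi>\<in>Sigma_fm n. \<forall>s F. sat s F \<psi> \<longleftrightarrow> \<not> sat s F \<phi>)"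
proof (induction n)
  case 0
  have "arithmetical \<phi> \<Longrightarrow> arithmetical (Neg \<phi>) \<and> (\<forall>s F. sat s F (Neg \<phi>) \<longleftrightarrow> \<not> sat s F \<phi>)" for \<phi> by simp
  then show ?case by (metis Sigma_fm.simps(1) Pi_fm.simps(1) mem_Collect_eq)
next
  case (Suc n)
  show ?case
  proof (intro conjI ballI)
    fix \<phi> assume "\<phi> \<in> Sigma_fm (Suc n)"
    then obtain i \<theta> where 1: "\<phi> = ExF i \<theta>" "\<theta> \<in> Pi_fm n" by auto
    with Suc.IH obtain \<psi> where "\<psi> \<in> Sigma_fm n" "\<forall>s F. sat s F \<psi> \<longleftrightarrow> \<not> sat s F \<theta>" by blast
    with 1 show "\<exists>\<psi>\<in>Pi_fm (Suc n). \<forall>s F. sat s F \<psi> \<longleftrightarrow> \<not> sat s F \<phi>"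
      by (intro bexI[of _ "AllF i \<psi>"]) auto
  next
    fix \<phi> assume "\<phi> \<in> Pi_fm (Suc n)"
    then obtain i \<theta> where 1: "\<phi> = AllF i \<theta>" "\<theta> \<in> Sigma_fm n" by auto
    with Suc.IH obtain \<psi> where "\<psi> \<in> Pi_fm n" "\<forall>s F. sat s F \<psi> \<longleftrightarrow> \<not> sat s F \<theta>" by blast
    with 1 show "\<exists>\<psi>\<in>Sigma_fm (Suc n). \<forall>s F. sat s F \<psi> \<longleftrightarrow> \<not> sat s F \<phi>"
      by (intro bexI[of _ "ExF i \<psi>"]) auto
  qed
qed

text \<open>The depth \<open>d\<close> is generalized: each quantifier binds variable
  \<open>d\<close>, fresh for the oracle so far, and the induction hypothesis is used at
  \<open>Suc d\<close>. The induction starts at level one, where the quantifier absorbs the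
  evaluation table of the matrix.\<close>

lemma Sg_Suc_sat:
  assumes "Sg (Suc n) P"
  shows "\<exists>\<phi>\<in>Sigma_fm (Suc n). \<forall>s F. sat s F \<phi> \<longleftrightarrow> P (s 0) (orc d F)"
  using assms
proof (induction n arbitrary: P d)
  case 0
  then show ?case using Sg_1_sat by (metis One_nat_def)
next
  case (Suc n)
  obtain Q where Q: "Pg (Suc n) Q" "P = (\<lambda>x \<alpha>. \<exists>\<beta>. Q x (jn \<alpha> \<beta>))"
    using Suc.prems Sg.simps(2)[of "Suc n" P] by blast
  obtain \<phi> where \<phi>: "\<phi> \<in> Sigma_fm (Suc n)" "\<And>s F. sat s F \<phi> \<longleftrightarrow> \<not> Q (s 0) (orc (Suc d) F)"
    using Suc.IH[OF Q(1), of "Suc d"] by blast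
  obtain \<psi> where \<psi>: "\<psi> \<in> Pi_fm (Suc n)" "\<And>s F. sat s F \<psi> \<longleftrightarrow> \<not> sat s F \<phi>"
    using Sigma_Pi_fm_neg \<phi>(1) by blast
  have "sat s F (ExF d \<psi>) \<longleftrightarrow> P (s 0) (orc d F)" for s F
    by (simp add: \<psi> \<phi> Q orc_upd)
  moreover have "ExF d \<psi> \<in> Sigma_fm (Suc (Suc n))" using \<psi>(1) by simp
  ultimately show ?case by blast
qed

lemma Sg_imp_Sigma11:
  assumes "Sg n (\<lambda>x \<alpha>. x \<in> A)" "n \<ge> 1" shows "A \<in> Sigma11 n"
proof -
  obtain m where m: "n = Suc m" using assms(2) by (cases n) auto
  obtain \<phi> where "\<phi> \<in> Sigma_fm n" "\<And>s F. sat s F \<phi> \<longleftrightarrow> s 0 \<in> A"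
    using Sg_Suc_sat assms(1) unfolding m by blast
  then show ?thesis unfolding Sigma11_def defined_set_def by (intro image_eqI[of _ _ \<phi>]) auto
qed

lemma Pg_imp_Pi11:
  assumes "Pg n (\<lambda>x \<alpha>. x \<in> A)" "n \<ge> 1" shows "A \<in> Pi11 n"
proof -
  obtain m where m: "n = Suc m" using assms(2) by (cases n) auto
  obtain \<phi> where \<phi>: "\<phi> \<in> Sigma_fm n" "\<And>s F. sat s F \<phi> \<longleftrightarrow> s 0 \<notin> A"
    using Sg_Suc_sat assms(1) unfolding m by blast
  obtain \<psi> where "\<psi> \<in> Pi_fm n" "\<And>s F. sat s F \<psi> \<longleftrightarrow> \<not> sat s F \<phi>"
    using Sigma_Pi_fm_neg \<phi>(1) by blast
  then show ?thesis using \<phi> unfolding Pi11_def defined_set_def by (intro image_eqI[of _ _ \<psi>]) auto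
qed

definition Eg :: "nat \<Rightarrow> (nat \<Rightarrow> (nat \<Rightarrow> nat) \<Rightarrow> bool) \<Rightarrow> bool" where
  "Eg n P \<longleftrightarrow> (if odd n then Pg n P else Sg n P)"

lemma E11_iff: "n \<ge> 1 \<Longrightarrow> A \<in> E11 n \<longleftrightarrow> Eg n (\<lambda>x \<alpha>. x \<in> A)"
  unfolding E11_def Eg_def
  using Pg_imp_Pi11[of n A] Pi11_imp_Pg[of A n] Sg_imp_Sigma11[of n A] Sigma11_imp_Sg[of A n]
  by (cases "odd n") auto

section \<open>Computable functions\<close>

primrec lcode :: "nat list \<Rightarrow> nat" where
  "lcode [] = 0"
| "lcode (x # xs) = pr x (lcode xs)"

lemma rec_eval_PrimRec_values:
  assumes "rec_eval (PrimRec f g) (n # xs) y"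
  shows "\<exists>r. r n = y \<and> rec_eval f xs (r 0) \<and> (\<forall>i<n. rec_eval g (i # r i # xs) (r (Suc i)))"
  using assms
proof (induction n arbitrary: y)
  case 0
  from 0 have "rec_eval f xs y" by cases auto
  then show ?case by auto
next
  case (Suc n)
  from Suc.prems obtain r' where r': "rec_eval (PrimRec f g) (n # xs) r'" "rec_eval g (n # r' # xs) y"
    by cases auto
  from Suc.IH[OF r'(1)] obtain r where
    "r n = r'" "rec_eval f xs (r 0)" "\<forall>i<n. rec_eval g (i # r i # xs) (r (Suc i))" by blast
  then show ?case using r'(2)
    by (intro exI[of _ "r(Suc n := y)"]) (auto simp: less_Suc_eq)
qed

text \<open>An implication suffices: where the program diverges, the total function may take any
  value. Hence \<open>Mu\<close> can be rendered by the total search.\<close>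

lemma rec_eval_den:
  "\<exists>c. \<forall>xs y. rec_eval p xs y \<longrightarrow> den (\<lambda>_. 0) c (lcode xs) = y"
proof (induction p)
  case Zero
  have "y = 0" if "rec_eval Zero xs y" for xs y using that by cases auto
  then show ?case by (intro exI[of _ IZero]) auto
next
  case Succ
  have "\<exists>x. xs = [x] \<and> y = Suc x" if "rec_eval Succ xs y" for xs y using that by cases auto
  then show ?case by (intro exI[of _ "IComp ISucc IFst"]) fastforce
next
  case (Proj i)
  let ?c = "\<lambda>i. IComp IFst (((\<lambda>c. IComp c ISnd) ^^ i) (IPair IFst ISnd))"
  have *: "den (\<lambda>_. 0) (?c i) (lcode xs) = xs ! i"
    if "i < length xs" for xs
    using that
  proof (induction xs arbitrary: i)
    case (Cons x xs)
    then show ?case by (cases i) auto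
  qed simp
  have "i < length xs \<and> y = xs ! i" if "rec_eval (Proj i) xs y" for xs y
    using that by cases auto
  then show ?case using * by (intro exI[of _ "?c i"]) blast
next
  case (Comp f gs)
  from Comp(1) obtain c where c: "\<And>xs y. rec_eval f xs y \<Longrightarrow> den (\<lambda>_. 0) c (lcode xs) = y" by blast
  have "\<forall>g\<in>set gs. \<exists>d. \<forall>xs y. rec_eval g xs y \<longrightarrow> den (\<lambda>_. 0) d (lcode xs) = y" using Comp(2) by blast
  then have "\<exists>d. \<forall>xs ys. length ys = length gs \<longrightarrow> (\<forall>i<length gs. rec_eval (gs ! i) xs (ys ! i))
     \<longrightarrow> den (\<lambda>_. 0) d (lcode xs) = lcode ys"
  proof (induction gs)
    case Nil
    show ?case by (rule exI[of _ IZero]) auto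
  next
    case (Cons g gs)
    then obtain d e where d: "\<And>xs ys. length ys = length gs \<Longrightarrow> (\<forall>i<length gs. rec_eval (gs ! i) xs (ys ! i))
       \<Longrightarrow> den (\<lambda>_. 0) d (lcode xs) = lcode ys" and
       e: "\<And>xs y. rec_eval g xs y \<Longrightarrow> den (\<lambda>_. 0) e (lcode xs) = y" by auto
    show ?case
    proof (intro exI[of _ "IPair e d"] allI impI)
      fix xs ys assume "length ys = length (g # gs)"
        and *: "\<forall>i<length (g # gs). rec_eval ((g # gs) ! i) xs (ys ! i)"
      then obtain z zs where ys: "ys = z # zs" "length zs = length gs" by (cases ys) auto
      have "rec_eval g xs z" using *[rule_format, of 0] ys by simp
      moreover have "\<forall>i<length gs. rec_eval (gs ! i) xs (zs ! i)"
        using * ys by (auto dest: spec[of _ "Suc i" for i])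
      ultimately show "den (\<lambda>_. 0) (IPair e d) (lcode xs) = lcode ys" using d e ys by simp
    qed
  qed
  then obtain d where d: "\<And>xs ys. length ys = length gs \<Longrightarrow> (\<forall>i<length gs. rec_eval (gs ! i) xs (ys ! i))
     \<Longrightarrow> den (\<lambda>_. 0) d (lcode xs) = lcode ys" by blast
  have "den (\<lambda>_. 0) (IComp c d) (lcode xs) = y" if "rec_eval (Comp f gs) xs y" for xs y
    using that by cases (simp add: c d)
  then show ?case by blast
next
  case (PrimRec f g)
  then obtain c d where c: "\<And>xs y. rec_eval f xs y \<Longrightarrow> den (\<lambda>_. 0) c (lcode xs) = y"
    and d: "\<And>xs y. rec_eval g xs y \<Longrightarrow> den (\<lambda>_. 0) d (lcode xs) = y" by blast
  \<comment> \<open>The state has the form \<open>lcode (i # r i # xs)\<close>, so the code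
    \<open>d\<close> of the step program applies to it directly.\<close>
  define h where "h = (\<lambda>s. pr (Suc (p1 s)) (pr (den (\<lambda>_. 0) d s) (p2 (p2 s))))"
  have "Dfun (\<lambda>x \<alpha>. den (\<lambda>_. 0) k x)" for k
    using Dfun_subst[OF Dfun_den Dfun_id Dop_const] .
  note D = Dfun_comp[OF this]
  have "Dfun (\<lambda>z \<alpha>. p1 (p2 (((\<lambda>s. h s) ^^ p1 z) (pr 0 (pr (den (\<lambda>_. 0) c (p2 z)) (p2 z))))))"
    unfolding h_def by (intro D_intros Dfun_iter_param D)
  then obtain e where e: "\<And>z. den (\<lambda>_. 0) e z = p1 (p2 ((h ^^ p1 z) (pr 0 (pr (den (\<lambda>_. 0) c (p2 z)) (p2 z)))))"
    unfolding Dfun_def by metis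
  have "den (\<lambda>_. 0) e (lcode (n # xs)) = y" if y: "rec_eval (PrimRec f g) (n # xs) y" for n xs y
  proof -
    obtain r where r: "r n = y" "rec_eval f xs (r 0)" "\<forall>i<n. rec_eval g (i # r i # xs) (r (Suc i))"
      using rec_eval_PrimRec_values[OF y] by blast
    have "(h ^^ i) (pr 0 (pr (r 0) (lcode xs))) = pr i (pr (r i) (lcode xs))" if "i \<le> n" for i
      using that
    proof (induction i)
      case (Suc i)
      then have "den (\<lambda>_. 0) d (lcode (i # r i # xs)) = r (Suc i)" using r(3) d[of "i # r i # xs"] by auto
      then show ?case using Suc by (simp add: h_def)
    qed simp
    then show ?thesis using r c by (simp add: e)
  qed
  moreover have "\<exists>n zs. xs = n # zs" if "rec_eval (PrimRec f g) xs y" for xs y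
    using that by cases auto
  ultimately have "den (\<lambda>_. 0) e (lcode xs) = y" if "rec_eval (PrimRec f g) xs y" for xs y
    using that by blast
  then show ?case by blast
next
  case (Mu f)
  then obtain c where c: "\<And>xs y. rec_eval f xs y \<Longrightarrow> den (\<lambda>_. 0) c (lcode xs) = y" by blast
  have "Dfun (\<lambda>z \<alpha>. den \<alpha> (IMu c) z - 1)" by (intro Dfun_pred Dfun_den)
  then obtain e where e: "\<And>z \<alpha>. den \<alpha> e z = den \<alpha> (IMu c) z - 1" unfolding Dfun_def by metis
  have "den (\<lambda>_. 0) e (lcode xs) = n" if n: "rec_eval (Mu f) xs n" for xs n
  proof -
    have 1: "rec_eval f (n # xs) 0" and 2: "\<forall>i<n. \<exists>v. rec_eval f (i # xs) (Suc v)"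
      using n by (cases; simp)+
    have z: "den (\<lambda>_. 0) c (pr n (lcode xs)) = 0" using c[OF 1] by simp
    have "den (\<lambda>_. 0) c (pr i (lcode xs)) \<noteq> 0" if i: "i < n" for i
    proof -
      obtain v where "rec_eval f (i # xs) (Suc v)" using 2 i by blast
      from c[OF this] show ?thesis by simp
    qed
    then have "(LEAST a. den (\<lambda>_. 0) c (pr a (lcode xs)) = 0) = n"
      using z by (intro Least_equality) (simp, meson not_less)
    moreover have "\<exists>a. den (\<lambda>_. 0) c (pr a (lcode xs)) = 0" using z by blast
    ultimately show ?thesis by (simp add: e)
  qed
  then show ?case by blast
qed

lemma computable_den:
  assumes "computable f" shows "\<exists>c. \<forall>x. f x = den (\<lambda>_. 0) c x"
proof -
  obtain p where p: "\<And>x. rec_eval p [x] (f x)" using assms unfolding computable_def by blast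
  obtain c where c: "\<And>xs y. rec_eval p xs y \<Longrightarrow> den (\<lambda>_. 0) c (lcode xs) = y"
    using rec_eval_den by blast
  have "f x = den (\<lambda>_. 0) (IComp c (IPair (IPair IFst ISnd) IZero)) x" for x
    using c[OF p, of x] by simp
  then show ?thesis by blast
qed

section \<open>Continuity and projective sets\<close>

text \<open>Continuity with respect to the discrete topology on the range.\<close>

definition fd :: "((nat \<Rightarrow> nat) \<Rightarrow> 'b) \<Rightarrow> bool" where
  "fd \<Phi> \<longleftrightarrow> (\<forall>\<beta>. \<exists>k. \<forall>\<beta>'. (\<forall>i<k. \<beta>' i = \<beta> i) \<longrightarrow> \<Phi> \<beta>' = \<Phi> \<beta>)"

lemma fd_const: "fd (\<lambda>\<beta>. c)"
  by (simp add: fd_def)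

lemma fd_app: "fd \<Phi> \<Longrightarrow> fd (\<lambda>\<beta>. \<beta> (\<Phi> \<beta>))"
  unfolding fd_def
proof
  fix \<beta> assume "\<forall>\<beta>. \<exists>k. \<forall>\<beta>'. (\<forall>i<k. \<beta>' i = \<beta> i) \<longrightarrow> \<Phi> \<beta>' = \<Phi> \<beta>"
  then obtain k where k: "\<And>\<beta>'. (\<forall>i<k. \<beta>' i = \<beta> i) \<Longrightarrow> \<Phi> \<beta>' = \<Phi> \<beta>" by blast
  show "\<exists>k. \<forall>\<beta>'. (\<forall>i<k. \<beta>' i = \<beta> i) \<longrightarrow> \<beta>' (\<Phi> \<beta>') = \<beta> (\<Phi> \<beta>)"
  proof (intro exI[of _ "max k (Suc (\<Phi> \<beta>))"] allI impI)
    fix \<beta>' assume "\<forall>i<max k (Suc (\<Phi> \<beta>)). \<beta>' i = \<beta> i"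
    then show "\<beta>' (\<Phi> \<beta>') = \<beta> (\<Phi> \<beta>)" using k[of \<beta>'] by simp
  qed
qed

lemma fd_comp2: "fd \<Phi> \<Longrightarrow> fd \<Psi> \<Longrightarrow> fd (\<lambda>\<beta>. f (\<Phi> \<beta>) (\<Psi> \<beta>))"
  unfolding fd_def
proof
  fix \<beta> assume 1: "\<forall>\<beta>. \<exists>k. \<forall>\<beta>'. (\<forall>i<k. \<beta>' i = \<beta> i) \<longrightarrow> \<Phi> \<beta>' = \<Phi> \<beta>"
    and 2: "\<forall>\<beta>. \<exists>k. \<forall>\<beta>'. (\<forall>i<k. \<beta>' i = \<beta> i) \<longrightarrow> \<Psi> \<beta>' = \<Psi> \<beta>"
  obtain k where k: "\<And>\<beta>'. (\<forall>i<k. \<beta>' i = \<beta> i) \<Longrightarrow> \<Phi> \<beta>' = \<Phi> \<beta>" using 1 by blast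
  obtain l where l: "\<And>\<beta>'. (\<forall>i<l. \<beta>' i = \<beta> i) \<Longrightarrow> \<Psi> \<beta>' = \<Psi> \<beta>" using 2 by blast
  show "\<exists>k. \<forall>\<beta>'. (\<forall>i<k. \<beta>' i = \<beta> i) \<longrightarrow> f (\<Phi> \<beta>') (\<Psi> \<beta>') = f (\<Phi> \<beta>) (\<Psi> \<beta>)"
  proof (intro exI[of _ "max k l"] allI impI)
    fix \<beta>' assume "\<forall>i<max k l. \<beta>' i = \<beta> i"
    then show "f (\<Phi> \<beta>') (\<Psi> \<beta>') = f (\<Phi> \<beta>) (\<Psi> \<beta>)" using k[of \<beta>'] l[of \<beta>'] by simp
  qed
qed

lemmas fd_Suc = fd_comp2[of _ _ "\<lambda>a b. Suc a", OF _ fd_const]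
lemmas fd_not = fd_comp2[of _ _ "\<lambda>a b. \<not> a", OF _ fd_const]
lemmas fd_plus = fd_comp2[of _ _ "(+) :: nat \<Rightarrow> nat \<Rightarrow> nat"]
lemmas fd_times = fd_comp2[of _ _ "(*) :: nat \<Rightarrow> nat \<Rightarrow> nat"]
lemmas fd_eq = fd_comp2[of _ _ "(=) :: nat \<Rightarrow> nat \<Rightarrow> bool"]
lemmas fd_conj = fd_comp2[of _ _ "(\<and>)"]
lemmas fd_disj = fd_comp2[of _ _ "(\<or>)"]
lemmas fd_imp = fd_comp2[of _ _ "(\<longrightarrow>)"]

lemma fd_om: "fd \<Phi> \<Longrightarrow> fd (\<lambda>\<gamma>. om \<gamma> (\<Phi> \<gamma>))"
  and fd_tr: "fd \<Phi> \<Longrightarrow> fd (\<lambda>\<gamma>. tr \<gamma> (\<Phi> \<gamma>))"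
  and fd_hf: "fd \<Phi> \<Longrightarrow> fd (\<lambda>\<gamma>. hf \<gamma> (\<Phi> \<gamma>))"
  unfolding om_def tr_def hf_def lft_def rgt_def
  by (intro fd_app fd_Suc fd_times fd_const; assumption)+

lemma fd_ppr: "fd \<Phi> \<Longrightarrow> fd \<Psi> \<Longrightarrow> fd (\<lambda>\<gamma>. ppr \<gamma> (\<Phi> \<gamma>) (\<Psi> \<gamma>))"
  unfolding ppr_def by (intro fd_plus fd_hf fd_times fd_Suc)

lemmas fd_intros = fd_conj fd_disj fd_imp fd_not fd_eq fd_ppr fd_om fd_tr fd_hf fd_const

lemma fd_clause: "fd (\<lambda>\<gamma>. clause \<gamma> a b x y k)"
  unfolding clause_def by (intro fd_intros)

lemma open_fd: assumes "fd \<Phi>" shows "open {\<beta>. \<Phi> \<beta>}"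
proof (rule openI)
  fix \<beta> assume "\<beta> \<in> {\<beta>. \<Phi> \<beta>}"
  then have \<beta>: "\<Phi> \<beta>" by simp
  obtain k where k: "\<And>\<beta>'. (\<forall>i<k. \<beta>' i = \<beta> i) \<Longrightarrow> \<Phi> \<beta>' = \<Phi> \<beta>"
    using assms unfolding fd_def by blast
  have "open {f. \<forall>i\<in>{..<k}. f (id i) \<in> {\<beta> i}}"
    by (rule product_topology_basis') (auto intro: open_discrete)
  moreover have "{f. \<forall>i\<in>{..<k}. f (id i) \<in> {\<beta> i}} \<subseteq> {\<beta>. \<Phi> \<beta>}"
    using k \<beta> by (intro subsetI) (metis (mono_tags, lifting) id_apply lessThan_iff mem_Collect_eq singletonD)
  ultimately show "\<exists>T. open T \<and> \<beta> \<in> T \<and> T \<subseteq> {\<beta>. \<Phi> \<beta>}" by (intro exI) auto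
qed

lemma closed_fd: "fd \<Phi> \<Longrightarrow> closed {\<beta>. \<Phi> \<beta>}"
  using open_fd[OF fd_not, of \<Phi>] by (simp add: closed_def Collect_neg_eq)

lemma closed_Cl: "closed {\<gamma>. Cl \<gamma> \<and> tr \<gamma> z = 0}"
  unfolding Cl_def by (intro closed_Collect_conj closed_Collect_all closed_fd fd_clause fd_intros)

lemma continuous_lft: "continuous_on UNIV lft" and continuous_rgt: "continuous_on UNIV rgt"
  unfolding lft_def[abs_def] rgt_def[abs_def]
  by (intro continuous_on_coordinatewise_then_product continuous_on_product_coordinates)+

lemma continuous_jn:
  assumes "continuous_on UNIV f" "continuous_on UNIV g"
  shows "continuous_on UNIV (\<lambda>r. jn (f r) (g r))"
proof (rule continuous_on_coordinatewise_then_product)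
  fix i
  show "continuous_on UNIV (\<lambda>r. jn (f r) (g r) i)"
    using continuous_on_product_then_coordinatewise[OF assms(1)]
      continuous_on_product_then_coordinatewise[OF assms(2)] by (cases "even i") (simp_all add: jn_def)
qed

text \<open>The preimage of an image is a projection: \<open>u\<close> belongs to it if some
  \<open>v\<close> in \<open>A\<close> satisfies \<open>g v = f u\<close>, and the pair is coded as
  \<open>jn u v\<close>.\<close>

lemma projective_vimage:
  assumes "A \<in> projective"
  shows "continuous_on UNIV f \<Longrightarrow> f -` A \<in> projective"
  using assms
proof (induction A arbitrary: f rule: projective.induct)
  case (closed A)
  then show ?case by (intro projective.closed closed_vimage)
next
  case (Compl A)
  then show ?case using projective.Compl by (simp add: vimage_Compl)
next
  case (Int A B)
  then show ?case using projective.Int by (simp add: vimage_Int)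
next
  case (image A g)
  have c: "continuous_on UNIV (\<lambda>z. g (rgt z))" "continuous_on UNIV (\<lambda>z. f (lft z))"
    using continuous_on_compose2[OF image.hyps(2) continuous_rgt]
      continuous_on_compose2[OF image.prems continuous_lft] by auto
  have "{z. g (rgt z) = f (lft z)} \<in> projective"
    unfolding fun_eq_iff
    by (intro projective.closed closed_Collect_all closed_Collect_eq
        continuous_on_product_then_coordinatewise[OF c(1)] continuous_on_product_then_coordinatewise[OF c(2)])
  moreover have "rgt -` A \<in> projective" using image.IH[OF continuous_rgt] .
  ultimately have "lft ` ({z. g (rgt z) = f (lft z)} \<inter> rgt -` A) \<in> projective"
    by (intro projective.image projective.Int continuous_lft)
  moreover have "lft ` ({z. g (rgt z) = f (lft z)} \<inter> rgt -` A) = f -` (g ` A)"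
  proof (intro Set.set_eqI iffI)
    fix u assume "u \<in> f -` (g ` A)"
    then obtain v where "v \<in> A" "f u = g v" by auto
    then show "u \<in> lft ` ({z. g (rgt z) = f (lft z)} \<inter> rgt -` A)"
      by (intro image_eqI[of _ _ "jn u v"]) auto
  qed (force simp: image_iff)
  ultimately show ?case by simp
qed

text \<open>Already level 0 is treated as a projection, of the closed set of evaluation tables that
  give the value 0. Each further quantifier is an image under \<open>lft\<close>.\<close>

lemma projective_Sg: "Sg n P \<Longrightarrow> {\<alpha>. P x \<alpha>} \<in> projective"
proof (induction n arbitrary: P)
  case 0
  then obtain e where P: "\<And>x \<alpha>. P x \<alpha> \<longleftrightarrow> den \<alpha> (dec e) x = 0"
    unfolding Sg.simps using Dpred_index by blast
  have "{\<alpha>. P x \<alpha>} = lft ` {\<gamma>. Cl \<gamma> \<and> tr \<gamma> (pr e x) = 0}"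
  proof (rule Set.set_eqI)
    fix \<alpha>
    show "\<alpha> \<in> {\<alpha>. P x \<alpha>} \<longleftrightarrow> \<alpha> \<in> lft ` {\<gamma>. Cl \<gamma> \<and> tr \<gamma> (pr e x) = 0}"
      using Cl_iff[of \<alpha> "\<lambda>v. v = 0" e x] unfolding om_def by (auto simp: P image_iff)
  qed
  then show ?case using projective.image[OF projective.closed[OF closed_Cl] continuous_lft] by simp
next
  case (Suc n)
  then obtain Q where Q: "Pg n Q" "P = (\<lambda>x \<alpha>. \<exists>\<beta>. Q x (jn \<alpha> \<beta>))" unfolding Sg.simps by blast
  have "{\<gamma>. Q x \<gamma>} \<in> projective"
    using projective.Compl[OF Suc.IH[OF Q(1)]] by (simp add: Collect_neg_eq)
  moreover have "{\<alpha>. P x \<alpha>} = lft ` {\<gamma>. Q x \<gamma>}"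
  proof (rule Set.set_eqI)
    fix \<alpha>
    have "(\<exists>\<beta>. Q x (jn \<alpha> \<beta>)) \<longleftrightarrow> (\<exists>\<gamma>. Q x \<gamma> \<and> \<alpha> = lft \<gamma>)" by (metis lft_jn jn_lft_rgt)
    then show "\<alpha> \<in> {\<alpha>. P x \<alpha>} \<longleftrightarrow> \<alpha> \<in> lft ` {\<gamma>. Q x \<gamma>}" by (auto simp: Q image_iff)
  qed
  ultimately show ?case using projective.image[OF _ continuous_lft] by simp
qed

section \<open>Strategies as Lipschitz functionals\<close>

text \<open>A strategy is viewed as a map from the opponent's whole play to the player's own. Before
  move number \<open>i\<close>, player I has seen \<open>i\<close> moves of II, and II has seen
  \<open>i + 1\<close> moves of I.\<close>

definition lipI :: "((nat \<Rightarrow> nat) \<Rightarrow> nat \<Rightarrow> nat) \<Rightarrow> bool" where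
  "lipI G \<longleftrightarrow> (\<forall>i \<beta> \<beta>'. (\<forall>j<i. \<beta> j = \<beta>' j) \<longrightarrow> G \<beta> i = G \<beta>' i)"

definition lipII :: "((nat \<Rightarrow> nat) \<Rightarrow> nat \<Rightarrow> nat) \<Rightarrow> bool" where
  "lipII G \<longleftrightarrow> (\<forall>i \<beta> \<beta>'. (\<forall>j\<le>i. \<beta> j = \<beta>' j) \<longrightarrow> G \<beta> i = G \<beta>' i)"

lemma lipI_imp_lipII: "lipI G \<Longrightarrow> lipII G"
  unfolding lipI_def lipII_def using less_imp_le by blast

lemma lipII_comp: "lipII G \<Longrightarrow> lipII H \<Longrightarrow> lipII (\<lambda>\<alpha>. G (H \<alpha>))"
  unfolding lipII_def[of "\<lambda>\<alpha>. G (H \<alpha>)"]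
proof (intro allI impI)
  fix i and \<beta> \<beta>' :: "nat \<Rightarrow> nat" assume GH: "lipII G" "lipII H" and *: "\<forall>j\<le>i. \<beta> j = \<beta>' j"
  have "\<forall>j\<le>i. H \<beta> j = H \<beta>' j" using GH(2) * unfolding lipII_def by simp
  then show "G (H \<beta>) i = G (H \<beta>') i" using GH(1) unfolding lipII_def by blast
qed

lemma lipI_comp: "lipI G \<Longrightarrow> lipII H \<Longrightarrow> lipI (\<lambda>\<alpha>. G (H \<alpha>))"
  unfolding lipI_def[of "\<lambda>\<alpha>. G (H \<alpha>)"]
proof (intro allI impI)
  fix i and \<beta> \<beta>' :: "nat \<Rightarrow> nat" assume GH: "lipI G" "lipII H" and *: "\<forall>j<i. \<beta> j = \<beta>' j"
  have "\<forall>j<i. H \<beta> j = H \<beta>' j" using GH(2) * unfolding lipII_def by simp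
  then show "G (H \<beta>) i = G (H \<beta>') i" using GH(1) unfolding lipI_def by blast
qed

lemma lip_const: "lipI (\<lambda>_. \<beta>)" "lipII (\<lambda>_. \<beta>)" "lipII (\<lambda>\<alpha>. \<alpha>)"
  unfolding lipI_def lipII_def by blast+

text \<open>Infinitely many boards are played at once, board \<open>n\<close> answering board
  \<open>n + 1\<close>. Replacing remote boards by zero gives approximations \<open>B k\<close>;
  since every \<open>G n\<close> gains one coordinate, coordinate \<open>i\<close> no longer changes
  once \<open>k > i\<close>.\<close>

lemma lipI_chain:
  assumes "\<And>n. lipI (G n)"
  shows "\<exists>A. \<forall>n. A n = G n (A (Suc n))"
proof -
  define B where "B = rec_nat (\<lambda>n. \<lambda>_. 0) (\<lambda>k b n. G n (b (Suc n)))"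
  have B: "B (Suc k) n = G n (B k (Suc n))" for k n by (simp add: B_def)
  have st: "i < k \<Longrightarrow> B (Suc k) n i = B k n i" for i k n
  proof (induction k arbitrary: i n)
    case (Suc k)
    have "\<forall>j<i. B (Suc k) (Suc n) j = B k (Suc n) j" using Suc by simp
    then show ?case using assms[of n] unfolding B[of "Suc k"] B[of k] lipI_def by blast
  qed simp
  have st': "i < k \<Longrightarrow> B k n i = B (Suc i) n i" for i k n
  proof (induction k)
    case (Suc k)
    then show ?case using st[of i k n] by (cases "i = k") auto
  qed simp
  define A where "A n i = B (Suc i) n i" for n i
  have "A n i = G n (A (Suc n)) i" for n i
  proof -
    have "\<forall>j<i. B i (Suc n) j = A (Suc n) j" unfolding A_def using st' by blast
    then show ?thesis using assms[of n] unfolding A_def[of n] B lipI_def by blast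
  qed
  then show ?thesis by blast
qed

text \<open>In the chain for a constant sequence, coordinate \<open>i\<close> of \<open>A n\<close>
  depends only on smaller coordinates of \<open>A (Suc n)\<close>, so all boards coincide. Such
  fixed points are the plays in which two strategies meet.\<close>

lemma lipI_fixpoint:
  assumes "lipI G" shows "\<exists>\<alpha>. \<alpha> = G \<alpha>"
proof -
  obtain A where A: "\<And>n. A n = G (A (Suc n))" using lipI_chain[of "\<lambda>_. G"] assms by blast
  have "A n i = A m i" for n m i
  proof (induction i arbitrary: n m rule: less_induct)
    case (less i)
    then have "G (A (Suc n)) i = G (A (Suc m)) i" using assms unfolding lipI_def by blast
    then show ?case using A by metis
  qed
  then have "A 0 = A (Suc 0)" by blast
  then show ?thesis using A[of 0] by metis
qed

primrec pc :: "(nat \<Rightarrow> nat) \<Rightarrow> nat \<Rightarrow> nat" where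
  "pc \<beta> 0 = 0"
| "pc \<beta> (Suc i) = pr (\<beta> i) (pc \<beta> i)"

lemma pc_eq: "pc \<beta> i = pc \<beta>' i \<longleftrightarrow> (\<forall>j<i. \<beta> j = \<beta>' j)"
  by (induction i) (auto simp: less_Suc_eq)

text \<open>Strategies become points of Baire space, so that quantifying over them is a function
  quantifier. The length \<open>i\<close> is stored as well, because \<open>pc\<close> does not
  determine it.\<close>

definition strI :: "(nat \<Rightarrow> nat) \<Rightarrow> (nat \<Rightarrow> nat) \<Rightarrow> nat \<Rightarrow> nat" where
  "strI \<sigma> \<beta> i = \<sigma> (pr i (pc \<beta> i))"

definition strII :: "(nat \<Rightarrow> nat) \<Rightarrow> (nat \<Rightarrow> nat) \<Rightarrow> nat \<Rightarrow> nat" where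
  "strII \<tau> \<alpha> i = \<tau> (pr i (pc \<alpha> (Suc i)))"

lemma lipI_strI: "lipI (strI \<sigma>)"
  unfolding lipI_def strI_def by (metis pc_eq)

lemma lipII_strII: "lipII (strII \<tau>)"
  unfolding lipII_def strII_def by (metis pc_eq less_Suc_eq_le)

lemma lipI_ex_strI: assumes "lipI G" shows "\<exists>\<sigma>. G = strI \<sigma>"
proof -
  define \<sigma> where "\<sigma> z = G (SOME \<beta>. pc \<beta> (p1 z) = p2 z) (p1 z)" for z
  have "strI \<sigma> \<beta> i = G \<beta> i" for \<beta> i
  proof -
    have "pc (SOME \<beta>'. pc \<beta>' i = pc \<beta> i) i = pc \<beta> i" by (rule someI[of _ \<beta>]) simp
    then show ?thesis using assms
      unfolding lipI_def strI_def \<sigma>_def pc_eq prod_encode_inverse fst_conv snd_conv by blast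
  qed
  then show ?thesis by (intro exI[of _ \<sigma>]) (auto simp: fun_eq_iff)
qed

lemma lipII_ex_strII: assumes "lipII G" shows "\<exists>\<tau>. G = strII \<tau>"
proof -
  define \<tau> where "\<tau> z = G (SOME \<beta>. pc \<beta> (Suc (p1 z)) = p2 z) (p1 z)" for z
  have "strII \<tau> \<beta> i = G \<beta> i" for \<beta> i
  proof -
    have "pc (SOME \<beta>'. pc \<beta>' (Suc i) = pc \<beta> (Suc i)) (Suc i) = pc \<beta> (Suc i)" by (rule someI[of _ \<beta>]) simp
    then show ?thesis using assms
      unfolding lipII_def strII_def \<tau>_def pc_eq less_Suc_eq_le prod_encode_inverse fst_conv snd_conv by blast
  qed
  then show ?thesis by (intro exI[of _ \<tau>]) (auto simp: fun_eq_iff)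
qed

lemma Dop_pc: assumes "Dop H" "Dfun f" shows "Dfun (\<lambda>x \<alpha>. pc (H x \<alpha>) (f x \<alpha>))"
proof -
  have *: "((\<lambda>s. pr (Suc (p1 s)) (pr (\<beta> (p1 s)) (p2 s))) ^^ m) (pr 0 0) = pr m (pc \<beta> m)" for m \<beta>
    by (induction m) auto
  have "Dfun (\<lambda>z \<alpha>. pr (Suc (p1 (p1 z))) (pr (H (p2 z) \<alpha> (p1 (p1 z))) (p2 (p1 z))))"
    by (intro D_intros Dfun_app[OF assms(1)])
  from Dfun_p2[OF Dfun_iter_param[OF this assms(2) Dfun_pr[OF Dfun_zero Dfun_zero]]] show ?thesis
    by (simp add: *)
qed

lemma Dop_p1: "Dop H \<Longrightarrow> Dop (\<lambda>z \<alpha>. H (p1 z) \<alpha>)"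
  unfolding Dop_def[of "\<lambda>z \<alpha>. H (p1 z) \<alpha>"] by (intro Dfun_app[of H] D_intros)

lemma Dop_strI: "Dop H \<Longrightarrow> Dop K \<Longrightarrow> Dop (\<lambda>x \<alpha>. strI (H x \<alpha>) (K x \<alpha>))"
  unfolding Dop_def[of "\<lambda>x \<alpha>. strI (H x \<alpha>) (K x \<alpha>)"] strI_def
  by (intro Dfun_app[of H] D_intros Dop_pc Dop_p1[of K])

lemma Dop_strII: "Dop H \<Longrightarrow> Dop K \<Longrightarrow> Dop (\<lambda>x \<alpha>. strII (H x \<alpha>) (K x \<alpha>))"
  unfolding Dop_def[of "\<lambda>x \<alpha>. strII (H x \<alpha>) (K x \<alpha>)"] strII_def
  by (intro Dfun_app[of H] D_intros Dop_pc Dop_p1[of K])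

text \<open>The player who follows \<open>\<sigma>\<close> is I if \<open>b\<close> is true, and II otherwise.\<close>

function run :: "bool \<Rightarrow> (nat list \<Rightarrow> nat) \<Rightarrow> (nat \<Rightarrow> nat) \<Rightarrow> nat \<Rightarrow> nat" where
  "run b \<sigma> \<beta> i = (if even i = b then \<sigma> (map (run b \<sigma> \<beta>) [0..<i]) else \<beta> (i div 2))"
  by auto
termination by (relation "measure (\<lambda>(b, \<sigma>, \<beta>, i). i)") auto

declare run.simps [simp del]

lemma run_same: "even i = b \<Longrightarrow> run b \<sigma> \<beta> i = \<sigma> (map (run b \<sigma> \<beta>) [0..<i])"
  by (subst run.simps) (simp only: if_True simp_thms)

lemma run_other: "even i \<noteq> b \<Longrightarrow> run b \<sigma> \<beta> i = \<beta> (i div 2)"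
  by (subst run.simps) (simp only: if_False simp_thms)

lemma run_cong:
  assumes "\<And>j. j < i \<Longrightarrow> even j \<noteq> b \<Longrightarrow> \<beta> (j div 2) = \<beta>' (j div 2)" "even i = b"
  shows "run b \<sigma> \<beta> i = run b \<sigma> \<beta>' i"
proof -
  have *: "k < i \<Longrightarrow> run b \<sigma> \<beta> k = run b \<sigma> \<beta>' k" for k
  proof (induction k rule: less_induct)
    case (less k)
    then have "map (run b \<sigma> \<beta>) [0..<k] = map (run b \<sigma> \<beta>') [0..<k]" by simp
    then show ?case using assms(1)[of k] less.prems
      unfolding run.simps[of b \<sigma> \<beta> k] run.simps[of b \<sigma> \<beta>' k] by (cases "even k = b") (simp_all only: simp_thms if_True if_False)
  qed
  then have "map (run b \<sigma> \<beta>) [0..<i] = map (run b \<sigma> \<beta>') [0..<i]" by simp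
  then show ?thesis using assms(2)
    unfolding run.simps[of b \<sigma> \<beta> i] run.simps[of b \<sigma> \<beta>' i] by (simp only: if_True simp_thms)
qed

text \<open>The functional is read off the run in which the winning strategy meets a given play:
  move \<open>i\<close> of I is at place \<open>2 * i\<close>, just before move \<open>i\<close> of
  II.\<close>

lemma determined_lip:
  assumes "determined {r. \<Phi> (lft r) (rgt r)}"
  shows "(\<exists>G. lipI G \<and> (\<forall>\<beta>. \<Phi> (G \<beta>) \<beta>)) \<or> (\<exists>G. lipII G \<and> (\<forall>\<alpha>. \<not> \<Phi> \<alpha> (G \<alpha>)))"
  using assms unfolding determined_def
proof (elim disjE exE)
  fix \<sigma> assume \<sigma>: "\<forall>x. (\<forall>i. even i \<longrightarrow> x i = \<sigma> (map x [0..<i])) \<longrightarrow> x \<in> {r. \<Phi> (lft r) (rgt r)}"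
  have "\<Phi> (lft (run True \<sigma> \<beta>)) \<beta>" for \<beta>
  proof -
    have "rgt (run True \<sigma> \<beta>) = \<beta>" unfolding rgt_def by (auto simp: run_other)
    moreover have "run True \<sigma> \<beta> \<in> {r. \<Phi> (lft r) (rgt r)}"
      by (rule \<sigma>[rule_format]) (rule run_same, simp)
    ultimately show ?thesis by simp
  qed
  moreover have "lipI (\<lambda>\<beta>. lft (run True \<sigma> \<beta>))"
    unfolding lipI_def lft_def by (intro allI impI run_cong) auto
  ultimately show ?thesis by blast
next
  fix \<tau> assume \<tau>: "\<forall>x. (\<forall>i. odd i \<longrightarrow> x i = \<tau> (map x [0..<i])) \<longrightarrow> x \<notin> {r. \<Phi> (lft r) (rgt r)}"
  have "\<not> \<Phi> \<alpha> (rgt (run False \<tau> \<alpha>))" for \<alpha>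
  proof -
    have "lft (run False \<tau> \<alpha>) = \<alpha>" unfolding lft_def by (auto simp: run_other)
    moreover have "run False \<tau> \<alpha> \<notin> {r. \<Phi> (lft r) (rgt r)}"
      by (rule \<tau>[rule_format]) (rule run_same, simp)
    ultimately show ?thesis by simp
  qed
  moreover have "lipII (\<lambda>\<beta>. rgt (run False \<tau> \<beta>))"
    unfolding lipII_def rgt_def by (intro allI impI run_cong) auto
  ultimately show ?thesis by blast
qed

section \<open>Norms\<close>

text \<open>A norm on \<open>P\<close> with values in the ordinals is given by the prewellordering that it induces, where
  all points outside \<open>P\<close> receive the value \<open>\<infinity>\<close>.\<close>

definition pnorm :: "('a \<Rightarrow> bool) \<Rightarrow> ('a \<Rightarrow> 'a \<Rightarrow> bool) \<Rightarrow> bool" where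
  "pnorm P lq \<longleftrightarrow> (\<forall>x y. lq x y \<or> lq y x) \<and> (\<forall>x y z. lq x y \<longrightarrow> lq y z \<longrightarrow> lq x z) \<and>
     wf {(x, y). \<not> lq y x} \<and> (\<forall>x y. \<not> P y \<longrightarrow> lq x y) \<and> (\<forall>x y. P x \<longrightarrow> \<not> P y \<longrightarrow> \<not> lq y x)"

lemma pnorm_total: "pnorm P lq \<Longrightarrow> lq x y \<or> lq y x"
  and pnorm_trans: "pnorm P lq \<Longrightarrow> lq x y \<Longrightarrow> lq y z \<Longrightarrow> lq x z"
  and pnorm_wf: "pnorm P lq \<Longrightarrow> wf {(x, y). \<not> lq y x}"
  and pnorm_top: "pnorm P lq \<Longrightarrow> \<not> P y \<Longrightarrow> lq x y"
  and pnorm_less: "pnorm P lq \<Longrightarrow> P x \<Longrightarrow> \<not> P y \<Longrightarrow> \<not> lq y x"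
  unfolding pnorm_def by metis+

lemma pnorm_pullback:
  assumes "pnorm P lq" shows "pnorm (\<lambda>x. P (f x)) (\<lambda>x y. lq (f x) (f y))"
proof -
  have "wf (inv_image {(x, y). \<not> lq y x} f)" using pnorm_wf[OF assms] by (rule wf_inv_image)
  then have "wf {(x, y). \<not> lq (f y) (f x)}" by (simp add: inv_image_def)
  then show ?thesis
    using pnorm_total[OF assms] pnorm_trans[OF assms] pnorm_top[OF assms] pnorm_less[OF assms]
    unfolding pnorm_def by blast
qed

text \<open>\<open>lq'\<close> compares least norms of witnesses, attained at \<open>m x\<close> by
  well-foundedness. The equivalences bring both comparisons to the prefix \<exists>\<forall>, whose
  inner quantifier is absorbed by a \<Pi> class.\<close>

lemma pnorm_ex:
  fixes P :: "'q \<times> 'b \<Rightarrow> bool"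
  assumes n: "pnorm P lq"
  defines "lq' \<equiv> \<lambda>x y. \<exists>\<beta>. \<forall>\<beta>'. lq (x, \<beta>) (y, \<beta>')"
  shows "pnorm (\<lambda>x. \<exists>\<beta>. P (x, \<beta>)) lq'"
    "(\<exists>\<beta>. P (x, \<beta>)) \<and> lq' x y \<longleftrightarrow> (\<exists>\<beta>. \<forall>\<beta>'. P (x, \<beta>) \<and> lq (x, \<beta>) (y, \<beta>'))"
    "\<not> lq' y x \<longleftrightarrow> (\<exists>\<beta>. \<forall>\<beta>'. \<not> lq (y, \<beta>') (x, \<beta>))"
proof -
  have "\<exists>m. \<forall>\<beta>. lq (x, m) (x, \<beta>)" for x
  proof -
    obtain z where "z \<in> range (Pair x)" "\<And>y. (y, z) \<in> {(x, y). \<not> lq y x} \<Longrightarrow> y \<notin> range (Pair x)"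
      using wfE_min[OF pnorm_wf[OF n], of _ "range (Pair x)"] by blast
    then show ?thesis by blast
  qed
  then obtain m where m: "\<And>x \<beta>. lq (x, m x) (x, \<beta>)" by metis
  have lq': "lq' x y \<longleftrightarrow> lq (x, m x) (y, m y)" for x y
    unfolding lq'_def using m pnorm_trans[OF n] by meson
  have P: "(\<exists>\<beta>. P (x, \<beta>)) \<longleftrightarrow> P (x, m x)" for x
    using m pnorm_less[OF n] by blast
  show "pnorm (\<lambda>x. \<exists>\<beta>. P (x, \<beta>)) lq'"
    using pnorm_pullback[OF n, of "\<lambda>x. (x, m x)"] unfolding P lq'[abs_def] .
  show "(\<exists>\<beta>. P (x, \<beta>)) \<and> lq' x y \<longleftrightarrow> (\<exists>\<beta>. \<forall>\<beta>'. P (x, \<beta>) \<and> lq (x, \<beta>) (y, \<beta>'))"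
  proof
    assume "(\<exists>\<beta>. P (x, \<beta>)) \<and> lq' x y"
    then have "P (x, m x)" "lq (x, m x) (y, m y)" by (simp_all add: P lq')
    then show "\<exists>\<beta>. \<forall>\<beta>'. P (x, \<beta>) \<and> lq (x, \<beta>) (y, \<beta>')" using m pnorm_trans[OF n] by blast
  qed (auto simp: lq'_def)
  show "\<not> lq' y x \<longleftrightarrow> (\<exists>\<beta>. \<forall>\<beta>'. \<not> lq (y, \<beta>') (x, \<beta>))"
    unfolding lq' using m pnorm_trans[OF n] by meson
qed

text \<open>The first periodicity theorem of Martin and Moschovakis: player I plays \<open>\<alpha>\<close> for \<open>x\<close>, player II
  plays \<open>\<beta>\<close> for \<open>y\<close>, and II has to achieve that the norm of \<open>(x, \<alpha>)\<close> is at most that of \<open>(y, \<beta>)\<close>.\<close>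

definition game_le :: "('q \<times> (nat \<Rightarrow> nat) \<Rightarrow> 'q \<times> (nat \<Rightarrow> nat) \<Rightarrow> bool) \<Rightarrow> 'q \<Rightarrow> 'q \<Rightarrow> bool" where
  "game_le lq x y \<longleftrightarrow> (\<exists>G. lipII G \<and> (\<forall>\<alpha>. lq (x, \<alpha>) (y, G \<alpha>)))"

text \<open>If I wins the game for \<open>(x, y)\<close>, the same moves win for II in the game for
  \<open>(y, x)\<close>; this gives totality. Strategies of II compose, which gives transitivity. On
  an infinite descent the winning strategies of I, played against each other on all boards, would
  produce a descent in \<open>lq\<close>. The equivalences express both comparisons as the failure
  of all strategies, of I in the first case, where determinacy enters, and of II in the second; the
  quantifier over strategies is then universal.\<close>

lemma pnorm_game:
  fixes P :: "'q \<times> (nat \<Rightarrow> nat) \<Rightarrow> bool"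
  assumes n: "pnorm P lq"
    and det: "\<And>x y. (\<exists>G. lipI G \<and> (\<forall>\<beta>. \<not> lq (x, G \<beta>) (y, \<beta>))) \<or> game_le lq x y"
  shows "pnorm (\<lambda>x. \<forall>\<beta>. P (x, \<beta>)) (game_le lq)"
    "(\<forall>\<beta>. P (x, \<beta>)) \<and> game_le lq x y \<longleftrightarrow> (\<forall>\<sigma>. \<exists>\<beta>. P (x, strI \<sigma> \<beta>) \<and> lq (x, strI \<sigma> \<beta>) (y, \<beta>))"
    "\<not> game_le lq y x \<longleftrightarrow> (\<forall>\<tau>. \<exists>\<alpha>. \<not> lq (y, \<alpha>) (x, strII \<tau> \<alpha>))"
proof -
  have total: "game_le lq x y \<or> game_le lq y x" for x y
  proof (rule disjCI)
    assume "\<not> game_le lq y x"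
    then obtain G where G: "lipI G" "\<And>\<beta>. \<not> lq (y, G \<beta>) (x, \<beta>)" using det by blast
    then have "\<forall>\<beta>. lq (x, \<beta>) (y, G \<beta>)" using pnorm_total[OF n] by blast
    then show "game_le lq x y" using lipI_imp_lipII[OF G(1)] unfolding game_le_def by blast
  qed
  have trans: "game_le lq x z" if xy: "game_le lq x y" and yz: "game_le lq y z" for x y z
  proof -
    obtain G where G: "lipII G" "\<And>\<alpha>. lq (x, \<alpha>) (y, G \<alpha>)" using xy unfolding game_le_def by blast
    obtain H where H: "lipII H" "\<And>\<alpha>. lq (y, \<alpha>) (z, H \<alpha>)" using yz unfolding game_le_def by blast
    have "\<forall>\<alpha>. lq (x, \<alpha>) (z, H (G \<alpha>))" using G(2) H(2) pnorm_trans[OF n] by blast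
    then show ?thesis using lipII_comp[OF H(1) G(1)] unfolding game_le_def by blast
  qed
  have "wf {(x, y). \<not> game_le lq y x}"
    unfolding wf_iff_no_infinite_down_chain
  proof
    assume "\<exists>f. \<forall>i. (f (Suc i), f i) \<in> {(x, y). \<not> game_le lq y x}"
    then obtain f where "\<And>i. \<not> game_le lq (f i) (f (Suc i))" by blast
    then have "\<forall>i. \<exists>G. lipI G \<and> (\<forall>\<beta>. \<not> lq (f i, G \<beta>) (f (Suc i), \<beta>))" using det by blast
    then obtain G where G: "\<And>i. lipI (G i)" "\<And>i \<beta>. \<not> lq (f i, G i \<beta>) (f (Suc i), \<beta>)" by metis
    obtain A where A: "\<And>i. A i = G i (A (Suc i))" using lipI_chain[of G] G(1) by blast
    have "\<not> lq (f i, A i) (f (Suc i), A (Suc i))" for i using G(2)[of i "A (Suc i)"] A[of i] by simp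
    then have "\<exists>g. \<forall>i. (g (Suc i), g i) \<in> {(x, y). \<not> lq y x}"
      by (intro exI[of _ "\<lambda>i. (f i, A i)"]) simp
    then show False using pnorm_wf[OF n] unfolding wf_iff_no_infinite_down_chain by blast
  qed
  moreover have "game_le lq x y" if y: "\<not> (\<forall>\<beta>. P (y, \<beta>))" for x y
  proof -
    obtain \<beta> where "\<not> P (y, \<beta>)" using y by blast
    then have "\<forall>\<alpha>. lq (x, \<alpha>) (y, \<beta>)" using pnorm_top[OF n] by blast
    then show ?thesis unfolding game_le_def using lip_const(2) by blast
  qed
  moreover have "\<not> game_le lq y x" if x: "\<forall>\<beta>. P (x, \<beta>)" and y: "\<not> (\<forall>\<beta>. P (y, \<beta>))" for x y
  proof -
    obtain \<beta> where "\<not> P (y, \<beta>)" using y by blast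
    then have "\<not> lq (y, \<beta>) (x, \<alpha>)" for \<alpha> using pnorm_less[OF n] x by blast
    then show ?thesis unfolding game_le_def by blast
  qed
  ultimately show "pnorm (\<lambda>x. \<forall>\<beta>. P (x, \<beta>)) (game_le lq)"
    unfolding pnorm_def using total trans by blast
  show "\<not> game_le lq y x \<longleftrightarrow> (\<forall>\<tau>. \<exists>\<alpha>. \<not> lq (y, \<alpha>) (x, strII \<tau> \<alpha>))"
    unfolding game_le_def using lipII_strII lipII_ex_strII by metis
  show "(\<forall>\<beta>. P (x, \<beta>)) \<and> game_le lq x y \<longleftrightarrow> (\<forall>\<sigma>. \<exists>\<beta>. P (x, strI \<sigma> \<beta>) \<and> lq (x, strI \<sigma> \<beta>) (y, \<beta>))"
  proof (intro iffI conjI allI)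
    fix \<sigma> assume *: "(\<forall>\<beta>. P (x, \<beta>)) \<and> game_le lq x y"
    then obtain G where G: "lipII G" "\<And>\<alpha>. lq (x, \<alpha>) (y, G \<alpha>)" unfolding game_le_def by blast
    obtain \<alpha> where "\<alpha> = strI \<sigma> (G \<alpha>)" using lipI_fixpoint[OF lipI_comp[OF lipI_strI G(1)]] by blast
    then have "lq (x, strI \<sigma> (G \<alpha>)) (y, G \<alpha>)" using G(2) by metis
    then show "\<exists>\<beta>. P (x, strI \<sigma> \<beta>) \<and> lq (x, strI \<sigma> \<beta>) (y, \<beta>)" using * by blast
  next
    fix \<beta> assume *: "\<forall>\<sigma>. \<exists>\<beta>. P (x, strI \<sigma> \<beta>) \<and> lq (x, strI \<sigma> \<beta>) (y, \<beta>)"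
    \<comment> \<open>Player I plays \<open>\<beta>\<close> without looking at the opponent, so the
      quantifier over strategies covers all \<open>\<beta>\<close>.\<close>
    obtain \<sigma> where "(\<lambda>_. \<beta>) = strI \<sigma>" using lipI_ex_strI[OF lip_const(1)] by blast
    then show "P (x, \<beta>)" using * by metis
  next
    assume *: "\<forall>\<sigma>. \<exists>\<beta>. P (x, strI \<sigma> \<beta>) \<and> lq (x, strI \<sigma> \<beta>) (y, \<beta>)"
    show "game_le lq x y"
    proof (rule ccontr)
      assume "\<not> game_le lq x y"
      then obtain G where G: "lipI G" "\<forall>\<beta>. \<not> lq (x, G \<beta>) (y, \<beta>)" using det by blast
      then show False using * lipI_ex_strI[OF G(1)] by blast
    qed
  qed
qed

section \<open>The prewellordering property along the hierarchy\<close>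

text \<open>The two relations are the usual weak and strict comparison attached to a norm. The
  strict one entails membership of its first point, since points outside \<open>P\<close> have value
  \<infinity>. Both points share the arguments: their numbers are packed in \<open>z\<close>, their
  functions in \<open>\<gamma>\<close>.\<close>

definition PWO :: "((nat \<Rightarrow> (nat \<Rightarrow> nat) \<Rightarrow> bool) \<Rightarrow> bool) \<Rightarrow> bool" where
  "PWO \<Gamma> \<longleftrightarrow> (\<forall>P. \<Gamma> P \<longrightarrow> (\<exists>lq. pnorm (\<lambda>(x, \<alpha>). P x \<alpha>) lq \<and>
     \<Gamma> (\<lambda>z \<gamma>. P (p1 z) (lft \<gamma>) \<and> lq (p1 z, lft \<gamma>) (p2 z, rgt \<gamma>)) \<and>
     \<Gamma> (\<lambda>z \<gamma>. \<not> lq (p2 z, rgt \<gamma>) (p1 z, lft \<gamma>))))"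

lemma PWO_Sg:
  assumes "PWO (Pg (Suc n))"
  shows "PWO (Sg (Suc (Suc n)))"
  unfolding PWO_def
proof (intro allI impI)
  fix Q assume "Sg (Suc (Suc n)) Q"
  then obtain P where P: "Pg (Suc n) P" "Q = (\<lambda>x \<alpha>. \<exists>\<beta>. P x (jn \<alpha> \<beta>))"
    unfolding Sg.simps(2)[of "Suc n"] by blast
  obtain lq where n: "pnorm (\<lambda>(x, \<alpha>). P x \<alpha>) lq"
    and 1: "Pg (Suc n) (\<lambda>z \<gamma>. P (p1 z) (lft \<gamma>) \<and> lq (p1 z, lft \<gamma>) (p2 z, rgt \<gamma>))"
    and 2: "Pg (Suc n) (\<lambda>z \<gamma>. \<not> lq (p2 z, rgt \<gamma>) (p1 z, lft \<gamma>))"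
    using assms[unfolded PWO_def, rule_format, OF P(1)] by blast
  define f :: "(nat \<times> (nat \<Rightarrow> nat)) \<times> (nat \<Rightarrow> nat) \<Rightarrow> nat \<times> (nat \<Rightarrow> nat)"
    where "f = (\<lambda>((x, \<alpha>), \<beta>). (x, jn \<alpha> \<beta>))"
  define P' where "P' p = (case f p of (x, \<alpha>) \<Rightarrow> P x \<alpha>)" for p
  have f: "f ((x, \<alpha>), \<beta>) = (x, jn \<alpha> \<beta>)" "P' ((x, \<alpha>), \<beta>) = P x (jn \<alpha> \<beta>)" for x \<alpha> \<beta>
    by (simp_all add: f_def P'_def)
  define lq' where "lq' = (\<lambda>x y. \<exists>\<beta>. \<forall>\<beta>'. lq (f (x, \<beta>)) (f (y, \<beta>')))"
  have n': "pnorm P' (\<lambda>x y. lq (f x) (f y))"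
    using pnorm_pullback[OF n, of f] by (simp add: P'_def[abs_def])
  note ex = pnorm_ex[OF n', folded lq'_def]
  \<comment> \<open>With \<open>\<delta>\<close> equal to
    \<open>jn (jn \<gamma> \<beta>) \<beta>'\<close>, this regroups the four functions into the two
    points with their witnesses attached.\<close>
  let ?H = "\<lambda>\<delta>. jn (jn (lft (lft (lft \<delta>))) (rgt (lft \<delta>))) (jn (rgt (lft (lft \<delta>))) (rgt \<delta>))"
  have H: "Dop (\<lambda>z \<delta>. ?H \<delta>)" by (intro Dop_intros)
  show "\<exists>lq. pnorm (\<lambda>(x, \<alpha>). Q x \<alpha>) lq \<and>
     Sg (Suc (Suc n)) (\<lambda>z \<gamma>. Q (p1 z) (lft \<gamma>) \<and> lq (p1 z, lft \<gamma>) (p2 z, rgt \<gamma>)) \<and>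
     Sg (Suc (Suc n)) (\<lambda>z \<gamma>. \<not> lq (p2 z, rgt \<gamma>) (p1 z, lft \<gamma>))"
  proof (intro exI[of _ lq'] conjI)
    have "(\<lambda>(x, \<alpha>). Q x \<alpha>) = (\<lambda>x. \<exists>\<beta>. P' (x, \<beta>))" by (auto simp: fun_eq_iff P f)
    then show "pnorm (\<lambda>(x, \<alpha>). Q x \<alpha>) lq'" using ex(1) by simp
    have "Pg (Suc n) (\<lambda>z \<delta>. P (p1 z) (lft (?H \<delta>)) \<and> lq (p1 z, lft (?H \<delta>)) (p2 z, rgt (?H \<delta>)))"
      by (rule Pg_subst[OF 1 Dfun_id H])
    from Sg_SucI[OF Pg_AllF[OF this]]
    have "Sg (Suc (Suc n)) (\<lambda>z \<gamma>. \<exists>\<beta>. \<forall>\<beta>'. P (p1 z) (jn (lft \<gamma>) \<beta>) \<and>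
        lq (p1 z, jn (lft \<gamma>) \<beta>) (p2 z, jn (rgt \<gamma>) \<beta>'))" by simp
    moreover have "(\<exists>\<beta>. \<forall>\<beta>'. P x (jn \<alpha> \<beta>) \<and> lq (x, jn \<alpha> \<beta>) (y, jn \<alpha>' \<beta>')) \<longleftrightarrow>
       Q x \<alpha> \<and> lq' (x, \<alpha>) (y, \<alpha>')" for x y \<alpha> \<alpha>'
      using ex(2)[of "(x, \<alpha>)" "(y, \<alpha>')"] unfolding f P(2) lq'_def by blast
    ultimately show "Sg (Suc (Suc n)) (\<lambda>z \<gamma>. Q (p1 z) (lft \<gamma>) \<and> lq' (p1 z, lft \<gamma>) (p2 z, rgt \<gamma>))"
      by simp
    have "Pg (Suc n) (\<lambda>z \<delta>. \<not> lq (p2 z, rgt (?H \<delta>)) (p1 z, lft (?H \<delta>)))"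
      by (rule Pg_subst[OF 2 Dfun_id H])
    from Sg_SucI[OF Pg_AllF[OF this]]
    have "Sg (Suc (Suc n)) (\<lambda>z \<gamma>. \<exists>\<beta>. \<forall>\<beta>'. \<not> lq (p2 z, jn (rgt \<gamma>) \<beta>') (p1 z, jn (lft \<gamma>) \<beta>))" by simp
    moreover have "\<not> lq' (y, \<alpha>') (x, \<alpha>) \<longleftrightarrow> (\<exists>\<beta>. \<forall>\<beta>'. \<not> lq (y, jn \<alpha>' \<beta>') (x, jn \<alpha> \<beta>))" for x y \<alpha> \<alpha>'
      using ex(3)[of "(y, \<alpha>')" "(x, \<alpha>)"] unfolding f lq'_def by blast
    ultimately show "Sg (Suc (Suc n)) (\<lambda>z \<gamma>. \<not> lq' (p2 z, rgt \<gamma>) (p1 z, lft \<gamma>))" by simp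
  qed
qed

text \<open>Function parameters enter the payoff set only through \<open>F\<close> and
  \<open>G\<close>. The set is therefore a continuous preimage of a lightface set, hence
  projective.\<close>

lemma PD_det:
  assumes "PD" "Sg n (\<lambda>z \<gamma>. \<not> lq (p2 z, rgt \<gamma>) (p1 z, lft \<gamma>))"
    "continuous_on UNIV f" "continuous_on UNIV g"
    "\<And>r. f r = F (lft r)" "\<And>r. g r = G (rgt r)"
  shows "(\<exists>S. lipI S \<and> (\<forall>\<beta>. \<not> lq (x, F (S \<beta>)) (y, G \<beta>))) \<or> (\<exists>S. lipII S \<and> (\<forall>\<alpha>. lq (x, F \<alpha>) (y, G (S \<alpha>))))"
proof -
  have "{\<gamma>. \<not> lq (p2 (pr y x), rgt \<gamma>) (p1 (pr y x), lft \<gamma>)} \<in> projective"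
    using projective_Sg[OF assms(2)] .
  from projective_vimage[OF this continuous_jn[OF assms(4,3)]]
  have "{r. \<not> lq (x, F (lft r)) (y, G (rgt r))} \<in> projective"
    by (simp add: vimage_def assms(5,6))
  then have "determined {r. \<not> lq (x, F (lft r)) (y, G (rgt r))}" using assms(1) unfolding PD_def by blast
  from determined_lip[OF this] show ?thesis by simp
qed

text \<open>\<open>\<Gamma>\<close> stays abstract because the hypotheses \<open>1\<close> and
  \<open>2\<close> on the games are obtained differently: above level one the quantifier over plays
  is absorbed by a \<Sigma> class, at level one it is reduced to a number quantifier.\<close>

lemma PWO_game_step:
  assumes "PD" and Q: "\<And>x \<alpha>. Q x \<alpha> \<longleftrightarrow> (\<forall>\<beta>. P x (jn \<alpha> \<beta>))"
    and n: "pnorm (\<lambda>(x, \<alpha>). P x \<alpha>) lq"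
    and lt: "Sg n (\<lambda>z \<gamma>. \<not> lq (p2 z, rgt \<gamma>) (p1 z, lft \<gamma>))"
    and 1: "\<Gamma> (\<lambda>z \<gamma>. \<forall>\<sigma>. \<exists>\<beta>. P (p1 z) (jn (lft \<gamma>) (strI \<sigma> \<beta>)) \<and>
      lq (p1 z, jn (lft \<gamma>) (strI \<sigma> \<beta>)) (p2 z, jn (rgt \<gamma>) \<beta>))"
    and 2: "\<Gamma> (\<lambda>z \<gamma>. \<forall>\<tau>. \<exists>\<alpha>. \<not> lq (p2 z, jn (rgt \<gamma>) \<alpha>) (p1 z, jn (lft \<gamma>) (strII \<tau> \<alpha>)))"
  shows "\<exists>lq. pnorm (\<lambda>(x, \<alpha>). Q x \<alpha>) lq \<and>
     \<Gamma> (\<lambda>z \<gamma>. Q (p1 z) (lft \<gamma>) \<and> lq (p1 z, lft \<gamma>) (p2 z, rgt \<gamma>)) \<and>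
     \<Gamma> (\<lambda>z \<gamma>. \<not> lq (p2 z, rgt \<gamma>) (p1 z, lft \<gamma>))"
proof -
  define f :: "(nat \<times> (nat \<Rightarrow> nat)) \<times> (nat \<Rightarrow> nat) \<Rightarrow> nat \<times> (nat \<Rightarrow> nat)"
    where "f = (\<lambda>((x, \<alpha>), \<beta>). (x, jn \<alpha> \<beta>))"
  define P' where "P' p = (case f p of (x, \<alpha>) \<Rightarrow> P x \<alpha>)" for p
  have f: "f ((x, \<alpha>), \<beta>) = (x, jn \<alpha> \<beta>)" "P' ((x, \<alpha>), \<beta>) = P x (jn \<alpha> \<beta>)" for x \<alpha> \<beta>
    by (simp_all add: f_def P'_def)
  define lf where "lf = (\<lambda>x y. lq (f x) (f y))"
  have lf: "lf ((x, \<alpha>), \<beta>) ((y, \<alpha>'), \<beta>') = lq (x, jn \<alpha> \<beta>) (y, jn \<alpha>' \<beta>')" for x y \<alpha> \<beta> \<alpha>' \<beta>'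
    by (simp add: lf_def f)
  have n': "pnorm P' lf"
    using pnorm_pullback[OF n, of f] by (simp add: P'_def[abs_def] lf_def)
  have det: "(\<exists>G. lipI G \<and> (\<forall>\<beta>. \<not> lf (p, G \<beta>) (q, \<beta>))) \<or> game_le lf p q" for p q
  proof -
    obtain x \<alpha> where p: "p = (x, \<alpha>)" by fastforce
    obtain y \<alpha>' where q: "q = (y, \<alpha>')" by fastforce
    have c: "continuous_on UNIV (\<lambda>r. jn \<alpha> (lft r))" "continuous_on UNIV (\<lambda>r. jn \<alpha>' (rgt r))"
      by (intro continuous_jn continuous_on_const continuous_lft continuous_rgt)+
    show ?thesis
      using PD_det[OF assms(1) lt c, of "jn \<alpha>" "jn \<alpha>'" x y] unfolding p q lf game_le_def by simp
  qed
  note ga = pnorm_game[OF n' det]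
  show ?thesis
  proof (intro exI[of _ "game_le lf"] conjI)
    have "(\<lambda>(x, \<alpha>). Q x \<alpha>) = (\<lambda>x. \<forall>\<beta>. P' (x, \<beta>))" by (auto simp: fun_eq_iff Q f)
    then show "pnorm (\<lambda>(x, \<alpha>). Q x \<alpha>) (game_le lf)" using ga(1) by simp
    have "(\<forall>\<sigma>. \<exists>\<beta>. P x (jn \<alpha> (strI \<sigma> \<beta>)) \<and> lq (x, jn \<alpha> (strI \<sigma> \<beta>)) (y, jn \<alpha>' \<beta>)) \<longleftrightarrow>
       Q x \<alpha> \<and> game_le lf (x, \<alpha>) (y, \<alpha>')" for x y \<alpha> \<alpha>'
      using ga(2)[of "(x, \<alpha>)" "(y, \<alpha>')"] unfolding Q f lf by blast
    then show "\<Gamma> (\<lambda>z \<gamma>. Q (p1 z) (lft \<gamma>) \<and> game_le lf (p1 z, lft \<gamma>) (p2 z, rgt \<gamma>))"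
      using 1 by simp
    have "\<not> game_le lf (y, \<alpha>') (x, \<alpha>) \<longleftrightarrow>
        (\<forall>\<tau>. \<exists>\<beta>. \<not> lq (y, jn \<alpha>' \<beta>) (x, jn \<alpha> (strII \<tau> \<beta>)))" for x y \<alpha> \<alpha>'
      using ga(3)[of "(y, \<alpha>')" "(x, \<alpha>)"] unfolding lf .
    then show "\<Gamma> (\<lambda>z \<gamma>. \<not> game_le lf (p2 z, rgt \<gamma>) (p1 z, lft \<gamma>))" using 2 by simp
  qed
qed

lemma PWO_Pg:
  assumes "PD" "PWO (Sg (Suc n))"
  shows "PWO (Pg (Suc (Suc n)))"
  unfolding PWO_def
proof (intro allI impI)
  fix Q assume "Pg (Suc (Suc n)) Q"
  then obtain R where R: "Pg (Suc n) R" "(\<lambda>x \<alpha>. \<not> Q x \<alpha>) = (\<lambda>x \<alpha>. \<exists>\<beta>. R x (jn \<alpha> \<beta>))"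
    unfolding Sg.simps(2)[of "Suc n"] by blast
  define P where "P x \<alpha> = (\<not> R x \<alpha>)" for x \<alpha>
  have P: "Sg (Suc n) P" using R(1) unfolding P_def .
  have Q: "Q x \<alpha> \<longleftrightarrow> (\<forall>\<beta>. P x (jn \<alpha> \<beta>))" for x \<alpha>
    using fun_cong[OF fun_cong[OF R(2)], of x \<alpha>] unfolding P_def by blast
  obtain lq where n: "pnorm (\<lambda>(x, \<alpha>). P x \<alpha>) lq"
    and 1: "Sg (Suc n) (\<lambda>z \<gamma>. P (p1 z) (lft \<gamma>) \<and> lq (p1 z, lft \<gamma>) (p2 z, rgt \<gamma>))"
    and 2: "Sg (Suc n) (\<lambda>z \<gamma>. \<not> lq (p2 z, rgt \<gamma>) (p1 z, lft \<gamma>))"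
    using assms(2)[unfolded PWO_def, rule_format, OF P] by blast
  \<comment> \<open>\<open>\<delta>\<close> holds \<open>\<gamma>\<close>, the strategy
    \<open>\<sigma>\<close> and the play \<open>\<beta>\<close>; the first point is extended by the
    answer of \<open>\<sigma>\<close> to \<open>\<beta>\<close>, the second by
    \<open>\<beta>\<close>.\<close>
  let ?H = "\<lambda>\<delta>. jn (jn (lft (lft (lft \<delta>))) (strI (rgt (lft \<delta>)) (rgt \<delta>))) (jn (rgt (lft (lft \<delta>))) (rgt \<delta>))"
  have "Dop (\<lambda>z \<delta>. ?H \<delta>)" by (intro Dop_intros Dop_strI)
  then have "Sg (Suc n) (\<lambda>z \<delta>. P (p1 z) (lft (?H \<delta>)) \<and> lq (p1 z, lft (?H \<delta>)) (p2 z, rgt (?H \<delta>)))"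
    by (rule Sg_subst[OF 1 Dfun_id])
  from Pg_SucI[OF Sg_ExF[OF this]]
  have 3: "Pg (Suc (Suc n)) (\<lambda>z \<gamma>. \<forall>\<sigma>. \<exists>\<beta>. P (p1 z) (jn (lft \<gamma>) (strI \<sigma> \<beta>)) \<and>
      lq (p1 z, jn (lft \<gamma>) (strI \<sigma> \<beta>)) (p2 z, jn (rgt \<gamma>) \<beta>))" by simp
  let ?K = "\<lambda>\<delta>. jn (jn (lft (lft (lft \<delta>))) (strII (rgt (lft \<delta>)) (rgt \<delta>))) (jn (rgt (lft (lft \<delta>))) (rgt \<delta>))"
  have "Dop (\<lambda>z \<delta>. ?K \<delta>)" by (intro Dop_intros Dop_strII)
  then have "Sg (Suc n) (\<lambda>z \<delta>. \<not> lq (p2 z, rgt (?K \<delta>)) (p1 z, lft (?K \<delta>)))"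
    by (rule Sg_subst[OF 2 Dfun_id])
  from Pg_SucI[OF Sg_ExF[OF this]]
  have 4: "Pg (Suc (Suc n)) (\<lambda>z \<gamma>. \<forall>\<tau>. \<exists>\<alpha>. \<not> lq (p2 z, jn (rgt \<gamma>) \<alpha>) (p1 z, jn (lft \<gamma>) (strII \<tau> \<alpha>)))" by simp
  show "\<exists>lq. pnorm (\<lambda>(x, \<alpha>). Q x \<alpha>) lq \<and>
     Pg (Suc (Suc n)) (\<lambda>z \<gamma>. Q (p1 z) (lft \<gamma>) \<and> lq (p1 z, lft \<gamma>) (p2 z, rgt \<gamma>)) \<and>
     Pg (Suc (Suc n)) (\<lambda>z \<gamma>. \<not> lq (p2 z, rgt \<gamma>) (p1 z, lft \<gamma>))"
    by (rule PWO_game_step[OF assms(1) Q n 2 3 4])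
qed

section \<open>The prewellordering property at level one\<close>

lemma Dfun_asg_uniform:
  assumes "Dfun f" "Dfun g" shows "Dfun (\<lambda>x \<alpha>. asg (f x \<alpha>) (g x \<alpha>))"
  unfolding asg_def
  by (rule Dfun_p1, rule Dfun_iter_param[where g="\<lambda>s x \<alpha>. p2 s", OF _ assms(2,1)]) (intro D_intros)

lemma asg_ex: "\<exists>c. \<forall>i<k. asg c i = \<beta> i"
proof (induction k)
  case (Suc k)
  then obtain c where "\<forall>i<k. asg c i = \<beta> i" by blast
  then show ?case by (intro exI[of _ "upd k (\<beta> k) c"]) (auto simp: asg_upd less_Suc_eq)
qed simp

text \<open>Continuations of an initial segment are named by numbers \<open>c\<close>; this keeps
  quantification over continuations at the base level.\<close>

definition pfx :: "nat \<Rightarrow> (nat \<Rightarrow> nat) \<Rightarrow> nat \<Rightarrow> nat \<Rightarrow> nat" where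
  "pfx k \<gamma> c i = (if i < k then \<gamma> i else asg c i)"

definition first :: "(nat \<Rightarrow> bool) \<Rightarrow> enat" where
  "first A = (if \<exists>k. A k then enat (LEAST k. A k) else \<infinity>)"

lemma first_finite: "first A \<noteq> \<infinity> \<longleftrightarrow> (\<exists>k. A k)"
  by (simp add: first_def)

lemma first_le: "(\<exists>k. A k) \<and> first A \<le> first B \<longleftrightarrow> (\<exists>k. A k \<and> (\<forall>j<k. \<not> B j))"
proof
  assume *: "(\<exists>k. A k) \<and> first A \<le> first B"
  then have "A (LEAST k. A k)" by (auto intro: LeastI)
  moreover have "\<not> B j" if "j < (LEAST k. A k)" for j
  proof
    assume "B j"
    then have "first B \<le> enat j" by (auto simp: first_def Least_le)
    then have "first A \<le> enat j" using * by (meson order_trans)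
    then show False using * that by (simp add: first_def)
  qed
  ultimately show "\<exists>k. A k \<and> (\<forall>j<k. \<not> B j)" by blast
next
  assume "\<exists>k. A k \<and> (\<forall>j<k. \<not> B j)"
  then obtain k where k: "A k" "\<forall>j<k. \<not> B j" by blast
  have "first A \<le> enat k" using k by (auto simp: first_def Least_le)
  also have "enat k \<le> first B"
    using k by (auto simp: first_def) (metis LeastI not_less)
  finally show "(\<exists>k. A k) \<and> first A \<le> first B" using k by blast
qed

lemma first_less: "\<not> first B \<le> first A \<longleftrightarrow> (\<exists>k. A k \<and> (\<forall>j\<le>k. \<not> B j))"
proof
  assume *: "\<not> first B \<le> first A"
  then have "first A \<noteq> \<infinity>" using enat_ord_simps(3) by metis
  then have A: "\<exists>k. A k" by (simp only: first_finite)
  then have "A (LEAST k. A k)" by (auto intro: LeastI)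
  moreover have "\<not> B j" if "j \<le> (LEAST k. A k)" for j
  proof
    assume "B j"
    then have "first B \<le> enat j" by (auto simp: first_def Least_le)
    also have "enat j \<le> first A" using that A by (simp add: first_def)
    finally show False using * by blast
  qed
  ultimately show "\<exists>k. A k \<and> (\<forall>j\<le>k. \<not> B j)" by blast
next
  assume "\<exists>k. A k \<and> (\<forall>j\<le>k. \<not> B j)"
  then obtain k where k: "A k" "\<forall>j\<le>k. \<not> B j" by blast
  have "first A \<le> enat k" using k by (auto simp: first_def Least_le)
  also have "enat k < first B"
    using k by (auto simp: first_def) (metis LeastI not_less)
  finally show "\<not> first B \<le> first A" by simp
qed

lemma pnorm_first: "pnorm (\<lambda>x. \<exists>k. A x k) (\<lambda>x y. first (A x) \<le> first (A y))"
proof -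
  have "{(x, y). \<not> (y::enat) \<le> x} = {(x, y). x < y}" by auto
  then have "pnorm (\<lambda>e::enat. e \<noteq> \<infinity>) (\<le>)" unfolding pnorm_def using wf[where 'a=enat] by auto
  from pnorm_pullback[OF this, of "\<lambda>x. first (A x)"] show ?thesis by (simp only: first_finite)
qed

text \<open>In the base case the norm is the length of the shortest initial segment of \<open>\<gamma>\<close> that settles
  membership; hence existential quantifiers over runs of the game can be bounded to runs of finite
  support, which are coded by numbers.\<close>

lemma PWO_Pg_1:
  assumes "PD" shows "PWO (Pg 1)"
  unfolding PWO_def
proof (intro allI impI)
  fix Q assume Q: "Pg 1 Q"
  obtain e where e: "\<And>x \<alpha>. \<not> Q x \<alpha> \<longleftrightarrow> (\<exists>\<gamma>. lft (om \<gamma>) = \<alpha> \<and> Cl \<gamma> \<and> tr \<gamma> (pr e x) = 0)"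
    using Sg_1_normal[OF Q] by blast
  \<comment> \<open>\<open>V j\<close> refutes \<open>\<gamma>\<close> at place \<open>j\<close> as
    a witness for the complement of \<open>Q\<close>, reading only finitely many values of
    \<open>\<gamma>\<close>.\<close>
  define V where "V j x \<alpha> \<gamma> = (\<not> (lft (om \<gamma>) j = \<alpha> j \<and> clause_code \<gamma> j \<and> tr \<gamma> (pr e x) = 0))" for j x \<alpha> \<gamma>
  have QV: "Q x \<alpha> \<longleftrightarrow> (\<forall>\<gamma>. \<exists>j. V j x \<alpha> \<gamma>)" for x \<alpha>
    using e[of x \<alpha>] unfolding V_def Cl_code fun_eq_iff by blast
  have fdV: "fd (\<lambda>\<gamma>. V j x \<alpha> \<gamma>)" for j x \<alpha>
    unfolding V_def lft_def clause_code_def by (intro fd_intros fd_clause)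
  \<comment> \<open>The first \<open>k\<close> values already refute \<open>\<gamma>\<close>: all
    coded continuations are refuted at one common place \<open>j\<close>.\<close>
  define M where "M k x \<alpha> \<gamma> = (\<exists>j\<le>k. \<forall>c. V j x \<alpha> (pfx k \<gamma> c))" for k x \<alpha> \<gamma>
  have M_cong: "M k x \<alpha> \<gamma> = M k x \<alpha> \<gamma>'" if "\<forall>i<k. \<gamma> i = \<gamma>' i" for k x \<alpha> \<gamma> \<gamma>'
  proof -
    have "pfx k \<gamma> = pfx k \<gamma>'" using that by (auto simp: fun_eq_iff pfx_def)
    then show ?thesis by (simp add: M_def)
  qed
  have VM: "(\<exists>j. V j x \<alpha> \<gamma>) \<longleftrightarrow> (\<exists>k. M k x \<alpha> \<gamma>)" for x \<alpha> \<gamma>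
  proof
    assume "\<exists>j. V j x \<alpha> \<gamma>"
    then obtain j where j: "V j x \<alpha> \<gamma>" by blast
    obtain k where k: "\<And>\<gamma>'. (\<forall>i<k. \<gamma>' i = \<gamma> i) \<Longrightarrow> V j x \<alpha> \<gamma>' = V j x \<alpha> \<gamma>"
      using fdV[of j x \<alpha>] unfolding fd_def by blast
    have "V j x \<alpha> (pfx (max j k) \<gamma> c)" for c
    proof -
      have "\<forall>i<k. pfx (max j k) \<gamma> c i = \<gamma> i" by (auto simp: pfx_def less_max_iff_disj)
      from k[OF this] show ?thesis using j by blast
    qed
    then have "M (max j k) x \<alpha> \<gamma>" unfolding M_def using max.cobounded1 by blast
    then show "\<exists>k. M k x \<alpha> \<gamma>" by blast
  next
    assume "\<exists>k. M k x \<alpha> \<gamma>"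
    then obtain k j where kj: "\<And>c. V j x \<alpha> (pfx k \<gamma> c)" unfolding M_def by blast
    obtain l where l: "\<And>\<gamma>'. (\<forall>i<l. \<gamma>' i = \<gamma> i) \<Longrightarrow> V j x \<alpha> \<gamma>' = V j x \<alpha> \<gamma>"
      using fdV[of j x \<alpha>] unfolding fd_def by blast
    obtain c where "\<forall>i<l. asg c i = \<gamma> i" using asg_ex by blast
    then have "\<forall>i<l. pfx k \<gamma> c i = \<gamma> i" by (simp add: pfx_def)
    from l[OF this] show "\<exists>j. V j x \<alpha> \<gamma>" using kj by blast
  qed
  have "Dfun (\<lambda>z \<delta>. lft (om (rgt \<delta>)) (p1 z))" "Dfun (\<lambda>z \<delta>. lft \<delta> (p1 z))"
    "Dfun (\<lambda>z \<delta>. tr (rgt \<delta>) (pr e (p2 z)))"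
    unfolding om_def tr_def lft_def rgt_def by (intro D_intros)+
  moreover have "Dpred (\<lambda>z \<delta>. clause_code (rgt \<delta>) (p1 z))"
    by (rule Dpred_subst[OF Dpred_clause_code[OF Dfun_id] Dfun_p1[OF Dfun_id] Dop_rgt[OF Dop_orc]])
  ultimately have "Dpred (\<lambda>z \<delta>. V (p1 z) (p2 z) (lft \<delta>) (rgt \<delta>))"
    unfolding V_def by (intro Dpred_not Dpred_conj Dpred_eq Dfun_const)
  note DV = Dpred_subst[OF this Dfun_pr Dop_jn, simplified]
  have "Dop (\<lambda>z \<delta>. pfx (p1 (p2 (p2 z))) (rgt \<delta>) (p1 z))"
    unfolding Dop_def pfx_def rgt_def by (intro D_intros Dfun_asg_uniform)
  then have "Dpred (\<lambda>z \<delta>. V (p1 (p2 z)) (p2 (p2 (p2 z))) (lft \<delta>) (pfx (p1 (p2 (p2 z))) (rgt \<delta>) (p1 z)))"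
    by (intro DV D_intros Dop_intros)
  from Dpred_all[of "\<lambda>c z \<delta>. V (p1 z) (p2 (p2 z)) (lft \<delta>) (pfx (p1 (p2 z)) (rgt \<delta>) c)", OF this]
  have "Dpred (\<lambda>z \<delta>. p1 z \<le> p1 (p2 z) \<and> (\<forall>c. V (p1 z) (p2 (p2 z)) (lft \<delta>) (pfx (p1 (p2 z)) (rgt \<delta>) c)))"
    by (intro D_intros)
  from Dpred_ex[of "\<lambda>j z \<delta>. j \<le> p1 z \<and> (\<forall>c. V j (p2 z) (lft \<delta>) (pfx (p1 z) (rgt \<delta>) c))", OF this]
  have "Dpred (\<lambda>z \<delta>. M (p1 z) (p2 z) (lft \<delta>) (rgt \<delta>))" unfolding M_def .
  note DM = Dpred_subst[OF this Dfun_pr Dop_jn, simplified]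
  define lq where "lq = (\<lambda>p q. first (\<lambda>k. M k (fst p) (lft (snd p)) (rgt (snd p))) \<le>
    first (\<lambda>k. M k (fst q) (lft (snd q)) (rgt (snd q))))"
  define P where "P x \<delta> = (\<exists>k. M k x (lft \<delta>) (rgt \<delta>))" for x \<delta>
  have n: "pnorm (\<lambda>(x, \<delta>). P x \<delta>) lq"
    using pnorm_first[of "\<lambda>p k. M k (fst p) (lft (snd p)) (rgt (snd p))"]
    unfolding lq_def P_def case_prod_unfold .
  have QP: "Q x \<alpha> \<longleftrightarrow> (\<forall>\<beta>. P x (jn \<alpha> \<beta>))" for x \<alpha>
    by (simp add: QV VM P_def)
  have le: "P x \<delta> \<and> lq (x, \<delta>) (y, \<delta>') \<longleftrightarrow>
     (\<exists>k. M k x (lft \<delta>) (rgt \<delta>) \<and> (\<forall>j. j < k \<longrightarrow> \<not> M j y (lft \<delta>') (rgt \<delta>')))" for x y \<delta> \<delta>'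
    using first_le[of "\<lambda>k. M k x (lft \<delta>) (rgt \<delta>)"] by (simp add: P_def lq_def)
  have lt: "\<not> lq (y, \<delta>') (x, \<delta>) \<longleftrightarrow>
     (\<exists>k. M k x (lft \<delta>) (rgt \<delta>) \<and> (\<forall>j. j \<le> k \<longrightarrow> \<not> M j y (lft \<delta>') (rgt \<delta>')))" for x y \<delta> \<delta>'
    using first_less[of _ "\<lambda>k. M k x (lft \<delta>) (rgt \<delta>)"] by (simp add: lq_def)
  have 0: "Sg 0 (\<lambda>z \<gamma>. \<not> lq (p2 z, rgt \<gamma>) (p1 z, lft \<gamma>))"
    unfolding lt Sg.simps by (intro Dpred_ex Dpred_all D_intros DM Dop_intros)
  \<comment> \<open>Functions of finite support are dense, so they meet every nonempty open
    condition.\<close>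
  have fin: "(\<exists>\<beta>. \<Phi> \<beta>) \<longleftrightarrow> (\<exists>c. \<Phi> (asg c))"
    if op: "\<And>\<beta>. \<Phi> \<beta> \<Longrightarrow> \<exists>k. \<forall>\<beta>'. (\<forall>i<k. \<beta> i = \<beta>' i) \<longrightarrow> \<Phi> \<beta>'" for \<Phi> :: "(nat \<Rightarrow> nat) \<Rightarrow> bool"
  proof
    assume "\<exists>\<beta>. \<Phi> \<beta>"
    then obtain \<beta> where "\<Phi> \<beta>" by blast
    then obtain k where k: "\<And>\<beta>'. (\<forall>i<k. \<beta> i = \<beta>' i) \<Longrightarrow> \<Phi> \<beta>'" using op[of \<beta>] by blast
    obtain c where "\<forall>i<k. asg c i = \<beta> i" using asg_ex by blast
    then show "\<exists>c. \<Phi> (asg c)" using k[of "asg c"] by metis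
  qed blast
  have asg: "Dop (\<lambda>z \<delta>. asg (f z \<delta>))" if "Dfun f" for f
    unfolding Dop_def by (intro Dfun_asg_uniform Dfun_comp[OF that] D_intros)
  have game1: "(\<exists>\<beta>. P x (jn \<alpha> (strI \<sigma> \<beta>)) \<and> lq (x, jn \<alpha> (strI \<sigma> \<beta>)) (y, jn \<alpha>' \<beta>)) \<longleftrightarrow>
    (\<exists>c k. M k x \<alpha> (strI \<sigma> (asg c)) \<and> (\<forall>j. j < k \<longrightarrow> \<not> M j y \<alpha>' (asg c)))" for x y \<alpha> \<alpha>' \<sigma>
    unfolding le lft_jn rgt_jn
  proof (rule fin, elim exE, intro exI allI impI)
    fix \<beta> k \<beta>' assume *: "M k x \<alpha> (strI \<sigma> \<beta>) \<and> (\<forall>j. j < k \<longrightarrow> \<not> M j y \<alpha>' \<beta>)" "\<forall>i<k. \<beta> i = \<beta>' i"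
    have "\<forall>i<k. strI \<sigma> \<beta> i = strI \<sigma> \<beta>' i" using *(2) lipI_strI[of \<sigma>] unfolding lipI_def by simp
    then have "M k x \<alpha> (strI \<sigma> \<beta>')" using M_cong * by blast
    moreover have "\<forall>j. j < k \<longrightarrow> \<not> M j y \<alpha>' \<beta>'" using M_cong * by (meson less_trans)
    ultimately show "M k x \<alpha> (strI \<sigma> \<beta>') \<and> (\<forall>j. j < k \<longrightarrow> \<not> M j y \<alpha>' \<beta>')" by blast
  qed
  have game2: "(\<exists>\<beta>. \<not> lq (y, jn \<alpha>' \<beta>) (x, jn \<alpha> (strII \<tau> \<beta>))) \<longleftrightarrow>
    (\<exists>c k. M k x \<alpha> (strII \<tau> (asg c)) \<and> (\<forall>j. j \<le> k \<longrightarrow> \<not> M j y \<alpha>' (asg c)))" for x y \<alpha> \<alpha>' \<tau>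
    unfolding lt lft_jn rgt_jn
  proof (rule fin, elim exE, intro exI allI impI)
    fix \<beta> k \<beta>' assume *: "M k x \<alpha> (strII \<tau> \<beta>) \<and> (\<forall>j. j \<le> k \<longrightarrow> \<not> M j y \<alpha>' \<beta>)" "\<forall>i<k. \<beta> i = \<beta>' i"
    have "\<forall>i<k. strII \<tau> \<beta> i = strII \<tau> \<beta>' i" using *(2) lipII_strII[of \<tau>] unfolding lipII_def by simp
    then have "M k x \<alpha> (strII \<tau> \<beta>')" using M_cong * by blast
    moreover have "\<forall>j. j \<le> k \<longrightarrow> \<not> M j y \<alpha>' \<beta>'" using M_cong * by (meson less_le_trans)
    ultimately show "M k x \<alpha> (strII \<tau> \<beta>') \<and> (\<forall>j. j \<le> k \<longrightarrow> \<not> M j y \<alpha>' \<beta>')" by blast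
  qed
  have "Sg 0 (\<lambda>z \<delta>. \<exists>c k. M k (p1 z) (lft (lft \<delta>)) (strI (rgt \<delta>) (asg c)) \<and>
      (\<forall>j. j < k \<longrightarrow> \<not> M j (p2 z) (rgt (lft \<delta>)) (asg c)))"
    unfolding Sg.simps by (intro Dpred_ex Dpred_all D_intros DM Dop_intros Dop_strI asg)
  from Pg_SucI[OF this] have 1: "Pg 1 (\<lambda>z \<gamma>. \<forall>\<sigma>. \<exists>\<beta>. P (p1 z) (jn (lft \<gamma>) (strI \<sigma> \<beta>)) \<and>
      lq (p1 z, jn (lft \<gamma>) (strI \<sigma> \<beta>)) (p2 z, jn (rgt \<gamma>) \<beta>))" unfolding game1 by simp
  have "Sg 0 (\<lambda>z \<delta>. \<exists>c k. M k (p1 z) (lft (lft \<delta>)) (strII (rgt \<delta>) (asg c)) \<and>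
      (\<forall>j. j \<le> k \<longrightarrow> \<not> M j (p2 z) (rgt (lft \<delta>)) (asg c)))"
    unfolding Sg.simps by (intro Dpred_ex Dpred_all D_intros DM Dop_intros Dop_strII asg)
  from Pg_SucI[OF this]
  have 2: "Pg 1 (\<lambda>z \<gamma>. \<forall>\<tau>. \<exists>\<alpha>. \<not> lq (p2 z, jn (rgt \<gamma>) \<alpha>) (p1 z, jn (lft \<gamma>) (strII \<tau> \<alpha>)))"
    unfolding game2 by simp
  show "\<exists>lq. pnorm (\<lambda>(x, \<alpha>). Q x \<alpha>) lq \<and>
     Pg 1 (\<lambda>z \<gamma>. Q (p1 z) (lft \<gamma>) \<and> lq (p1 z, lft \<gamma>) (p2 z, rgt \<gamma>)) \<and>
     Pg 1 (\<lambda>z \<gamma>. \<not> lq (p2 z, rgt \<gamma>) (p1 z, lft \<gamma>))"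
    by (rule PWO_game_step[OF assms QP n 0 1 2])
qed

lemma PWO_Eg:
  assumes "PD" shows "PWO (Eg (Suc n))"
proof (induction n)
  case 0
  then show ?case using PWO_Pg_1[OF assms] by (simp add: Eg_def[abs_def])
next
  case (Suc n)
  then show ?case
    using PWO_Sg[of n] PWO_Pg[OF assms, of n] by (cases "odd n") (simp_all add: Eg_def[abs_def])
qed

section \<open>Universal sets and closure properties\<close>

text \<open>At level one the code of the matrix is evaluated under the function quantifier, which
  absorbs the quantifier over tables. Higher levels negate and quantify, keeping the index
  \<open>e\<close>.\<close>

lemma Sg_universal:
  "\<exists>U. Sg (Suc n) U \<and> (\<forall>P. Sg (Suc n) P \<longrightarrow> (\<exists>e. \<forall>x \<alpha>. P x \<alpha> \<longleftrightarrow> U (pr e x) \<alpha>))"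
proof (induction n)
  case 0
  have "Sg 1 (\<lambda>z \<alpha>. den \<alpha> (dec (p1 (p1 z))) (p2 (p1 z)) = 0)"
    using den_graph_Delta(1)[of "\<lambda>a b. b = 0"] by (simp add: Dpred_eq0 Dfun_p2 Dfun_id)
  from Sg_subst[OF this Dfun_pr[OF Dfun_id Dfun_zero] Dop_orc]
  have "Sg (Suc 0) (\<lambda>z \<alpha>. den \<alpha> (dec (p1 z)) (p2 z) = 0)" by simp
  from Sg_ExF[OF this] have U: "Sg (Suc 0) (\<lambda>z \<alpha>. \<exists>\<beta>. den (jn \<alpha> \<beta>) (dec (p1 z)) (p2 z) = 0)" .
  have "\<exists>e. \<forall>x \<alpha>. P x \<alpha> \<longleftrightarrow> (\<exists>\<beta>. den (jn \<alpha> \<beta>) (dec (p1 (pr e x))) (p2 (pr e x)) = 0)"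
    if "Sg (Suc 0) P" for P
  proof -
    obtain Q where Q: "Pg 0 Q" "P = (\<lambda>x \<alpha>. \<exists>\<beta>. Q x (jn \<alpha> \<beta>))"
      using \<open>Sg (Suc 0) P\<close> unfolding Sg.simps(2) by blast
    then have "Dpred Q" using Dpred_not[of "\<lambda>x \<alpha>. \<not> Q x \<alpha>"] by (simp add: Sg.simps)
    then obtain e where "\<And>x \<alpha>. Q x \<alpha> \<longleftrightarrow> den \<alpha> (dec e) x = 0" using Dpred_index by blast
    then show ?thesis by (intro exI[of _ e]) (simp add: Q)
  qed
  with U show ?case by blast
next
  case (Suc n)
  then obtain U where U: "Sg (Suc n) U" "\<And>P. Sg (Suc n) P \<Longrightarrow> \<exists>e. \<forall>x \<alpha>. P x \<alpha> \<longleftrightarrow> U (pr e x) \<alpha>" by blast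
  have "Sg (Suc (Suc n)) (\<lambda>z \<alpha>. \<exists>\<beta>. \<not> U z (jn \<alpha> \<beta>))" by (rule Sg_SucI) (simp add: U(1))
  moreover have "\<exists>e. \<forall>x \<alpha>. P x \<alpha> \<longleftrightarrow> (\<exists>\<beta>. \<not> U (pr e x) (jn \<alpha> \<beta>))" if "Sg (Suc (Suc n)) P" for P
  proof -
    obtain Q where Q: "Pg (Suc n) Q" "P = (\<lambda>x \<alpha>. \<exists>\<beta>. Q x (jn \<alpha> \<beta>))"
      using \<open>Sg (Suc (Suc n)) P\<close> unfolding Sg.simps(2)[of "Suc n"] by blast
    obtain e where "\<And>x \<alpha>. \<not> Q x \<alpha> \<longleftrightarrow> U (pr e x) \<alpha>" using U(2)[OF Q(1)] by blast
    then have "P x \<alpha> \<longleftrightarrow> (\<exists>\<beta>. \<not> U (pr e x) (jn \<alpha> \<beta>))" for x \<alpha> unfolding Q(2) by blast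
    then show ?thesis by blast
  qed
  ultimately show ?case by blast
qed

lemma Eg_universal:
  assumes "n \<ge> 1"
  shows "\<exists>U. Eg n U \<and> (\<forall>P. Eg n P \<longrightarrow> (\<exists>e. \<forall>x \<alpha>. P x \<alpha> \<longleftrightarrow> U (pr e x) \<alpha>))"
proof -
  obtain m where m: "n = Suc m" using assms by (cases n) auto
  obtain U where U: "Sg n U" "\<And>P. Sg n P \<Longrightarrow> \<exists>e. \<forall>x \<alpha>. P x \<alpha> \<longleftrightarrow> U (pr e x) \<alpha>"
    using Sg_universal[of m] unfolding m by blast
  show ?thesis
  proof (cases "odd n")
    case False
    then show ?thesis unfolding Eg_def using U by auto
  next
    case True
    have "\<exists>e. \<forall>x \<alpha>. P x \<alpha> \<longleftrightarrow> \<not> U (pr e x) \<alpha>" if "Pg n P" for P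
      using U(2)[OF that] by blast
    then show ?thesis unfolding Eg_def using U(1) True by (intro exI[of _ "\<lambda>z \<alpha>. \<not> U z \<alpha>"]) simp
  qed
qed

lemma Eg_subst: "Eg n P \<Longrightarrow> Dfun f \<Longrightarrow> Dop H \<Longrightarrow> Eg n (\<lambda>x \<alpha>. P (f x \<alpha>) (H x \<alpha>))"
  unfolding Eg_def using Sg_subst[of n P f H] Pg_subst[of n P f H] by (auto split: if_splits)

lemma Eg_comp: "Eg n (\<lambda>x \<alpha>. P x) \<Longrightarrow> Dfun f \<Longrightarrow> Eg n (\<lambda>x \<alpha>. P (f x \<alpha>))"
  using Eg_subst[OF _ _ Dop_orc] by blast

lemma Eg_conj: "Eg n P \<Longrightarrow> Eg n Q \<Longrightarrow> Eg n (\<lambda>x \<alpha>. P x \<alpha> \<and> Q x \<alpha>)"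
  unfolding Eg_def using Sg_conj[of n P Q] Pg_conj[of n P Q] by (auto split: if_splits)

lemma Eg_disj: "Eg n P \<Longrightarrow> Eg n Q \<Longrightarrow> Eg n (\<lambda>x \<alpha>. P x \<alpha> \<or> Q x \<alpha>)"
  unfolding Eg_def using Sg_disj[of n P Q] Pg_disj[of n P Q] by (auto split: if_splits)

lemma Eg_exN: "Eg n (\<lambda>z \<alpha>. P (p1 z) (p2 z) \<alpha>) \<Longrightarrow> Eg n (\<lambda>x \<alpha>. \<exists>a. P a x \<alpha>)"
  unfolding Eg_def using Sg_exN[of n P] Pg_exN[of n P] by (auto split: if_splits)

lemma Eg_Dpred: "Dpred P \<Longrightarrow> Eg n P"
  unfolding Eg_def using Dpred_Delta[of P n] by auto

lemma Eg_Delta: "n \<ge> 1 \<Longrightarrow> Sg 1 P \<Longrightarrow> Pg 1 P \<Longrightarrow> Eg n P"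
  unfolding Eg_def using Delta_mono[of 1 P n] by auto

lemma Dpred_const: "Dpred (\<lambda>x \<alpha>. b)"
  unfolding Dpred_def by (rule Dfun_const)

lemma Eg_Ball: "finite I \<Longrightarrow> (\<And>i. i \<in> I \<Longrightarrow> Eg n (P i)) \<Longrightarrow> Eg n (\<lambda>x \<alpha>. \<forall>i\<in>I. P i x \<alpha>)"
proof (induction I rule: finite_induct)
  case empty
  then show ?case using Eg_Dpred[OF Dpred_const[of True]] by simp
next
  case (insert i I)
  then show ?case using Eg_conj[of n "P i"] by simp
qed

lemma Eg_Bex: "finite I \<Longrightarrow> (\<And>i. i \<in> I \<Longrightarrow> Eg n (P i)) \<Longrightarrow> Eg n (\<lambda>x \<alpha>. \<exists>i\<in>I. P i x \<alpha>)"
proof (induction I rule: finite_induct)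
  case empty
  then show ?case using Eg_Dpred[OF Dpred_const[of False]] by simp
next
  case (insert i I)
  then show ?case using Eg_disj[of n "P i"] by simp
qed

lemma Eg_norm:
  assumes "PD" "n \<ge> 1" "Eg n (\<lambda>x \<alpha>. W x)"
  shows "\<exists>lq. pnorm W lq \<and> Eg n (\<lambda>z \<alpha>. W (p1 z) \<and> lq (p1 z) (p2 z)) \<and> Eg n (\<lambda>z \<alpha>. \<not> lq (p2 z) (p1 z))"
proof -
  obtain m where m: "n = Suc m" using assms(2) by (cases n) auto
  obtain lq where lq: "pnorm (\<lambda>(x, \<alpha>). W x) lq"
     "Eg n (\<lambda>z \<gamma>. W (p1 z) \<and> lq (p1 z, lft \<gamma>) (p2 z, rgt \<gamma>))"
     "Eg n (\<lambda>z \<gamma>. \<not> lq (p2 z, rgt \<gamma>) (p1 z, lft \<gamma>))"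
    using PWO_Eg[OF assms(1), of m] assms(3) unfolding m PWO_def by blast
  let ?o = "\<lambda>k::nat. 0::nat"
  have o: "lft ?o = ?o" "rgt ?o = ?o" by (auto simp: lft_def rgt_def)
  show ?thesis
  proof (intro exI[of _ "\<lambda>a b. lq (a, ?o) (b, ?o)"] conjI)
    show "pnorm W (\<lambda>a b. lq (a, ?o) (b, ?o))"
      using pnorm_pullback[OF lq(1), of "\<lambda>a. (a, ?o)"] by simp
    show "Eg n (\<lambda>z \<alpha>. W (p1 z) \<and> lq (p1 z, ?o) (p2 z, ?o))"
      using Eg_subst[OF lq(2) Dfun_id Dop_const[of 0]] unfolding o .
    show "Eg n (\<lambda>z \<alpha>. \<not> lq (p2 z, ?o) (p1 z, ?o))"
      using Eg_subst[OF lq(3) Dfun_id Dop_const[of 0]] unfolding o .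
  qed
qed

section \<open>Greatest elements\<close>

lemma greatest_Rogers_iff:
  "(\<exists>g. greatest (Rogers n S) g (carrier (Rogers n S))) \<longleftrightarrow>
   (\<exists>\<mu>\<in>E11_numberings n S. \<forall>\<nu>\<in>E11_numberings n S. reducible \<nu> \<mu>)"
proof -
  have car: "carrier (Rogers n S) = (\<lambda>\<nu>. numbering_equiv n S `` {\<nu>}) ` E11_numberings n S"
    by (auto simp: Rogers_def quotient_def)
  have "greatest (Rogers n S) (numbering_equiv n S `` {\<mu>}) (carrier (Rogers n S)) \<longleftrightarrow>
      (\<forall>\<nu>\<in>E11_numberings n S. reducible \<nu> \<mu>)" if "\<mu> \<in> E11_numberings n S" for \<mu>
    using that Rogers_le_iff[OF _ that] unfolding greatest_def car by auto
  moreover have "g \<in> carrier (Rogers n S)" if "greatest (Rogers n S) g (carrier (Rogers n S))" for g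
    using that unfolding greatest_def by blast
  ultimately show ?thesis unfolding car by blast
qed

lemma numbering_iff:
  assumes "n \<ge> 1"
  shows "\<nu> \<in> E11_numberings n S \<longleftrightarrow> range \<nu> = S \<and> Eg n (\<lambda>z \<alpha>. p2 z \<in> \<nu> (p1 z))"
proof -
  have "z \<in> {pr k x | k x. x \<in> \<nu> k} \<longleftrightarrow> p2 z \<in> \<nu> (p1 z)" for z
    by (auto, metis prod.collapse prod_decode_inverse)
  then show ?thesis unfolding E11_numberings_def using E11_iff[OF assms] by simp
qed

text \<open>The reductions to the greatest numbering have this form, with \<open>e\<close> the index
  of a section. In the Cantor pairing \<open>pr e (Suc k)\<close> exceeds \<open>pr e k\<close> by
  \<open>k + e + 1\<close>, which gives a primitive recursion.\<close>

lemma computable_pr: "computable (pr e)"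
proof -
  define c where "c k = ((\<lambda>p. Comp Succ [p]) ^^ k) Zero" for k
  have c: "rec_eval (c k) xs k" for k xs
  proof (induction k)
    case 0
    show ?case unfolding c_def by (simp add: rec_eval.Zero)
  next
    case (Suc k)
    have "rec_eval (Comp Succ [c k]) xs (Suc k)"
      by (rule rec_eval.Comp[of "[k]"]) (use Suc in \<open>auto intro: rec_eval.Succ\<close>)
    then show ?case by (simp add: c_def)
  qed
  define add where "add = PrimRec (Proj 0) (Comp Succ [Proj 1])"
  have P1: "rec_eval (Proj 1) (a # b # xs) b" and P0: "rec_eval (Proj 0) (a # xs) a" for a b xs
    using rec_eval.Proj[of 1 "a # b # xs"] rec_eval.Proj[of 0 "a # xs"] by simp_all
  have add: "rec_eval add [a, b] (a + b)" for a b
  proof (induction a)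
    case 0
    show ?case unfolding add_def using rec_eval.PrimRec_0[OF P0[of b "[]"]] by simp
  next
    case (Suc a)
    have "rec_eval (Comp Succ [Proj 1]) [a, a + b, b] (Suc (a + b))"
      by (rule rec_eval.Comp[of "[a + b]"]) (use P1 in \<open>auto intro: rec_eval.Succ\<close>)
    then show ?case unfolding add_def
      using rec_eval.PrimRec_Suc[OF Suc[unfolded add_def]] by simp
  qed
  define g where "g = Comp add [Comp add [Proj 1, Proj 0], c (Suc e)]"
  have g: "rec_eval g [k, r] (r + k + Suc e)" for k r
  proof -
    have "rec_eval (Comp add [Proj 1, Proj 0]) [k, r] (r + k)"
      by (rule rec_eval.Comp[of "[r, k]"]) (use add P0 P1 in \<open>auto simp: less_Suc_eq\<close>)
    then show ?thesis unfolding g_def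
      by (intro rec_eval.Comp[of "[r + k, Suc e]"]) (use add[of "r + k" "Suc e"] c in \<open>auto simp: less_Suc_eq\<close>)
  qed
  have "rec_eval (PrimRec (c (pr e 0)) g) [k] (pr e k)" for k
  proof (induction k)
    case 0
    show ?case using rec_eval.PrimRec_0[OF c] .
  next
    case (Suc k)
    have "pr e (Suc k) = pr e k + k + Suc e" by (simp add: prod_encode_def)
    then show ?case using rec_eval.PrimRec_Suc[OF Suc] g by metis
  qed
  then show ?thesis unfolding computable_def by blast
qed

section \<open>A greatest numbering from a least member\<close>

lemma greatest_numbering_if_least:
  assumes PD: "PD" and n: "n \<ge> 1" and fin: "finite S" and S: "S \<subseteq> E11 n"
    and A0: "A0 \<in> S" "\<And>B. B \<in> S \<Longrightarrow> A0 \<subseteq> B"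
  shows "\<exists>\<mu>\<in>E11_numberings n S. \<forall>\<nu>\<in>E11_numberings n S. reducible \<nu> \<mu>"
proof -
  obtain U where U: "Eg n U" "\<And>P. Eg n P \<Longrightarrow> \<exists>e. \<forall>x \<alpha>. P x \<alpha> \<longleftrightarrow> U (pr e x) \<alpha>"
    using Eg_universal[OF n] by blast
  define W where "W z = U z (\<lambda>_. 0)" for z
  have W: "Eg n (\<lambda>z \<alpha>. W z)" unfolding W_def by (rule Eg_subst[OF U(1) Dfun_id Dop_const])
  have WU: "\<exists>e. \<forall>x. P x \<longleftrightarrow> W (pr e x)" if "Eg n (\<lambda>x \<alpha>. P x)" for P
    using U(2)[OF that] unfolding W_def by blast
  obtain lq where lq: "pnorm W lq" "Eg n (\<lambda>z \<alpha>. \<not> lq (p2 z) (p1 z))"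
    using Eg_norm[OF PD n W] by blast
  define pick where "pick A B = (SOME a. a \<in> A - B)" for A B :: "nat set"
  \<comment> \<open>One element of \<open>A - B\<close> for every pair with \<open>A\<close> not
    contained in \<open>B\<close>; the remaining pairs contribute arbitrary elements, which do no
    harm.\<close>
  define F where "F = (\<lambda>(A, B). pick A B) ` (S \<times> S)"
  have finF: "finite F" unfolding F_def using fin by simp
  have F: "A \<subseteq> B" if "A \<in> S" "B \<in> S" "A \<inter> F \<subseteq> B" for A B
  proof (rule ccontr)
    assume "\<not> A \<subseteq> B"
    then have "A - B \<noteq> {}" by blast
    then have "pick A B \<in> A - B" unfolding pick_def some_in_eq .
    moreover have "pick A B \<in> F" unfolding F_def using that(1,2) by (intro image_eqI[of _ _ "(A, B)"]) auto
    ultimately show False using that(3) by blast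
  qed
  \<comment> \<open>\<open>w\<close> codes a pair (e, k), and the points \<open>pt w y\<close> run
    through row \<open>k\<close> of section \<open>e\<close> of \<open>W\<close>.\<close>
  define pt where "pt w y = pr (p1 w) (pr (p2 w) y)" for w y
  \<comment> \<open>at some stage of the enumeration exactly the elements \<open>A \<inter> F\<close> of \<open>F\<close> have appeared\<close>
  define ok where "ok A w \<longleftrightarrow> (\<forall>z\<in>A \<inter> F. W (pt w z) \<and> (\<forall>y\<in>F - A. \<not> lq (pt w y) (pt w z)))" for A w
  define G where "G w = A0 \<union> \<Union>{A \<in> S. ok A w}" for w
  \<comment> \<open>If neither set contains the other, \<open>F\<close> has points \<open>z\<close>
    in \<open>A - B\<close> and \<open>y\<close> in \<open>B - A\<close>, and \<open>ok\<close> for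
    both sets would put each strictly before the other.\<close>
  have chain: "A \<subseteq> B \<or> B \<subseteq> A" if AB: "A \<in> S" "B \<in> S" "ok A w" "ok B w" for A B w
  proof (rule ccontr)
    assume "\<not> (A \<subseteq> B \<or> B \<subseteq> A)"
    then have "\<not> A \<inter> F \<subseteq> B" "\<not> B \<inter> F \<subseteq> A" using F[OF AB(1,2)] F[OF AB(2,1)] by blast+
    then obtain z y where zy: "z \<in> A \<inter> F" "z \<notin> B" "y \<in> B \<inter> F" "y \<notin> A" by blast
    then have "\<not> lq (pt w y) (pt w z)" "\<not> lq (pt w z) (pt w y)" using AB(3,4) unfolding ok_def by blast+
    then show False using pnorm_total[OF lq(1)] by blast
  qed
  have GS: "G w \<in> S" for w
  proof -
    let ?C = "insert A0 {A \<in> S. ok A w}"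
    have "\<Union>?C \<in> ?C"
    proof (rule Union_in_chain)
      show "finite ?C" using fin by simp
      show "?C \<noteq> {}" by simp
      show "subset.chain UNIV ?C" unfolding subset_chain_def using chain A0 by blast
    qed
    then show ?thesis unfolding G_def using A0(1) by auto
  qed
  \<comment> \<open>If row \<open>w\<close> enumerates \<open>V\<close>, the points of
    \<open>F\<close> outside \<open>V\<close> never appear, so \<open>ok V w\<close> holds; any
    \<open>A\<close> with \<open>ok A w\<close> has \<open>A \<inter> F\<close> inside
    \<open>V\<close>, hence \<open>A \<subseteq> V\<close>.\<close>
  have GV: "G w = V" if V: "V \<in> S" "\<And>y. y \<in> V \<longleftrightarrow> W (pt w y)" for w V
  proof
    have "ok V w" unfolding ok_def using V(2) pnorm_less[OF lq(1)] by blast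
    then show "V \<subseteq> G w" unfolding G_def using V(1) by blast
    have "A \<subseteq> V" if "A \<in> S" "ok A w" for A
      using F[OF that(1) V(1)] that(2) V(2) unfolding ok_def by blast
    then show "G w \<subseteq> V" unfolding G_def using A0(2)[OF V(1)] by blast
  qed
  have SE: "Eg n (\<lambda>x \<alpha>. x \<in> A)" if "A \<in> S" for A using that S E11_iff[OF n] by blast
  have "Eg n (\<lambda>v \<alpha>. ok A (p1 v))" for A
  proof -
    have "Eg n (\<lambda>v \<alpha>. W (pt (p1 v) z))" for z
      unfolding pt_def by (intro Eg_comp[OF W] D_intros)
    moreover have "Eg n (\<lambda>v \<alpha>. \<not> lq (pt (p1 v) y) (pt (p1 v) z))" for y z
      using Eg_comp[OF lq(2), of "\<lambda>v \<alpha>. pr (pt (p1 v) z) (pt (p1 v) y)"]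
      unfolding pt_def by (simp add: D_intros)
    ultimately show ?thesis unfolding ok_def using finF by (intro Eg_Ball Eg_conj) auto
  qed
  then have "Eg n (\<lambda>v \<alpha>. p2 v \<in> A0 \<or> (\<exists>A\<in>S. p2 v \<in> A \<and> ok A (p1 v)))"
    using fin A0(1) by (intro Eg_disj Eg_Bex Eg_conj Eg_comp[OF SE] Dfun_p2 Dfun_id) auto
  moreover have "(p2 v \<in> A0 \<or> (\<exists>A\<in>S. p2 v \<in> A \<and> ok A (p1 v))) \<longleftrightarrow> p2 v \<in> G (p1 v)" for v
    unfolding G_def by blast
  ultimately have GE: "Eg n (\<lambda>v \<alpha>. p2 v \<in> G (p1 v))" by simp
  have index: "\<exists>e. \<forall>k. G (pr e k) = \<nu> k" if \<nu>: "Eg n (\<lambda>z \<alpha>. p2 z \<in> \<nu> (p1 z))" "range \<nu> \<subseteq> S" for \<nu>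
  proof -
    obtain e where e: "\<And>x. p2 x \<in> \<nu> (p1 x) \<longleftrightarrow> W (pr e x)" using WU[OF \<nu>(1)] by blast
    have "G (pr e k) = \<nu> k" for k
      using \<nu>(2) e[of "pr k y" for y] by (intro GV) (auto simp: pt_def)
    then show ?thesis by blast
  qed
  have "\<exists>w. G w = A" if "A \<in> S" for A
    using index[of "\<lambda>_. A", OF Eg_comp[OF SE[OF that] Dfun_p2[OF Dfun_id]]] that by auto
  then have "S \<subseteq> range G" by (metis rangeI subsetI)
  then have "range G = S" using GS by blast
  then have "G \<in> E11_numberings n S" using GE numbering_iff[OF n] by blast
  moreover have "reducible \<nu> G" if \<nu>: "\<nu> \<in> E11_numberings n S" for \<nu>
  proof -
    obtain e where "\<And>k. G (pr e k) = \<nu> k"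
      using index[of \<nu>] \<nu> numbering_iff[OF n, of \<nu> S] by blast
    then have "\<nu> = G \<circ> pr e" by (simp add: fun_eq_iff)
    then show ?thesis unfolding reducible_def using computable_pr by blast
  qed
  ultimately show ?thesis by blast
qed

section \<open>Diagonalization when there is no least member\<close>

lemma least_if_greatest_numbering:
  assumes PD: "PD" and n: "n \<ge> 1" and fin: "finite S" and S: "S \<subseteq> E11 n" and ne: "S \<noteq> {}"
    and \<mu>: "\<mu> \<in> E11_numberings n S" "\<And>\<nu>. \<nu> \<in> E11_numberings n S \<Longrightarrow> reducible \<nu> \<mu>"
  shows "\<exists>A\<in>S. \<forall>B\<in>S. A \<subseteq> B"
proof (rule ccontr)
  assume "\<not> (\<exists>A\<in>S. \<forall>B\<in>S. A \<subseteq> B)"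
  then have "\<forall>A\<in>S. \<exists>B a. B \<in> S \<and> a \<in> A \<and> a \<notin> B" by blast
  then obtain B a where Ba: "\<And>A. A \<in> S \<Longrightarrow> B A \<in> S \<and> a A \<in> A \<and> a A \<notin> B A" by metis
  obtain m f where mf: "S = f ` {i::nat. i < m}" using finite_imp_nat_seg_image_inj_on[OF fin] by blast
  have m: "0 < m" using ne mf by auto
  have fS: "f i \<in> S" if "i < m" for i using that mf by blast
  have SE: "Eg n (\<lambda>x \<alpha>. x \<in> A)" if "A \<in> S" for A using that S E11_iff[OF n] by blast
  define W where "W v \<longleftrightarrow> p2 v \<in> \<mu> (p1 v)" for v
  have r\<mu>: "range \<mu> = S" and W: "Eg n (\<lambda>v \<alpha>. W v)" using \<mu>(1) numbering_iff[OF n] unfolding W_def by auto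
  obtain lq where lq: "pnorm W lq" "Eg n (\<lambda>z \<alpha>. W (p1 z) \<and> lq (p1 z) (p2 z))"
     "Eg n (\<lambda>z \<alpha>. \<not> lq (p2 z) (p1 z))"
    using Eg_norm[OF PD n W] by blast
  define pt where "pt i y = pr y (a (f i))" for i y
  \<comment> \<open>\<open>i\<close> is the least index for which \<open>a (f i)\<close> is among the first to appear in \<open>\<mu> y\<close>\<close>
  define R where "R i y \<longleftrightarrow> (\<forall>j\<in>{..<m}. W (pt i y) \<and> lq (pt i y) (pt j y)) \<and> (\<forall>j\<in>{..<i}. \<not> lq (pt j y) (pt i y))"
    for i y
  have R_ex: "\<exists>i<m. R i y" for y
  proof -
    \<comment> \<open>\<open>\<mu> y\<close> is some \<open>f j\<close>, so at least one of the
      \<open>m\<close> points is enumerated, and then so is any point of least norm.\<close>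
    obtain j where j: "j < m" "\<mu> y = f j" using r\<mu> mf by blast
    then have Wj: "W (pt j y)" using Ba[OF fS[OF j(1)]] by (simp add: W_def pt_def)
    obtain z where z: "z \<in> (\<lambda>i. pt i y) ` {..<m}"
      "\<And>z'. (z', z) \<in> {(x, y). \<not> lq y x} \<Longrightarrow> z' \<notin> (\<lambda>i. pt i y) ` {..<m}"
      using wfE_min[OF pnorm_wf[OF lq(1)], of "pt 0 y" "(\<lambda>i. pt i y) ` {..<m}"] m by blast
    define mn where "mn i \<longleftrightarrow> i < m \<and> (\<forall>j<m. lq (pt i y) (pt j y))" for i
    obtain i0 where i0: "i0 < m" "z = pt i0 y" using z(1) by blast
    have "mn i0" unfolding mn_def
    proof (intro conjI allI impI)
      fix j assume "j < m"
      then show "lq (pt i0 y) (pt j y)" using z(2)[of "pt j y"] i0 by blast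
    qed (rule i0)
    then have "\<exists>i. mn i" by blast
    define i where "i = (LEAST i. mn i)"
    have "mn i" unfolding i_def using \<open>\<exists>i. mn i\<close> by (rule LeastI_ex)
    then have im: "i < m" "\<And>j. j < m \<Longrightarrow> lq (pt i y) (pt j y)" unfolding mn_def by blast+
    have "W (pt i y)" using im(2)[OF j(1)] Wj pnorm_less[OF lq(1)] by blast
    moreover have "\<not> lq (pt j y) (pt i y)" if "j < i" for j
    proof
      assume "lq (pt j y) (pt i y)"
      then have "mn j" unfolding mn_def using im that pnorm_trans[OF lq(1)] by (meson less_trans)
      then show False using that not_less_Least[of j mn] unfolding i_def by blast
    qed
    ultimately show ?thesis unfolding R_def using im by blast
  qed
  have R_unique: "i = j" if "R i y" "R j y" "i < m" "j < m" for i j y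
    using that unfolding R_def by (metis lessThan_iff linorder_neqE_nat)
  \<comment> \<open>Only one \<open>i\<close> contributes; the union makes membership a finite
    disjunction of E^1_n conditions.\<close>
  define g where "g y = \<Union>{B (f i) | i. i < m \<and> R i y}" for y
  have g: "\<exists>i<m. R i y \<and> g y = B (f i)" for y
  proof -
    obtain i where i: "i < m" "R i y" using R_ex by blast
    then have "{B (f i) | i. i < m \<and> R i y} = {B (f i)}" using R_unique by blast
    then show ?thesis using i unfolding g_def by auto
  qed
  have gS: "g y \<in> S" for y using g[of y] Ba fS by metis
  have g\<mu>: "g y \<noteq> \<mu> y" for y
  proof -
    obtain i where i: "i < m" "R i y" "g y = B (f i)" using g by blast
    then have "a (f i) \<in> \<mu> y" unfolding R_def by (auto simp: W_def pt_def)
    then show ?thesis using i Ba[OF fS[OF i(1)]] by metis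
  qed
  have RE: "Eg n (\<lambda>v \<alpha>. R i (p1 v))" for i
  proof -
    \<comment> \<open>The weak comparison is known to be E^1_n only together with membership of its
      first point, which is why \<open>R\<close> keeps \<open>W (pt i y)\<close> beside it.\<close>
    have "Eg n (\<lambda>v \<alpha>. W (pt i (p1 v)) \<and> lq (pt i (p1 v)) (pt j (p1 v)))" for j
      using Eg_comp[OF lq(2), of "\<lambda>v \<alpha>. pr (pt i (p1 v)) (pt j (p1 v))"]
      unfolding pt_def by (simp add: D_intros)
    moreover have "Eg n (\<lambda>v \<alpha>. \<not> lq (pt j (p1 v)) (pt i (p1 v)))" for j
      using Eg_comp[OF lq(3), of "\<lambda>v \<alpha>. pr (pt i (p1 v)) (pt j (p1 v))"]
      unfolding pt_def by (simp add: D_intros)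
    ultimately show ?thesis unfolding R_def by (intro Eg_conj[OF Eg_Ball Eg_Ball]) auto
  qed
  have "Eg n (\<lambda>v \<alpha>. \<exists>i\<in>{..<m}. R i (p1 v) \<and> p2 v \<in> B (f i))"
    by (intro Eg_Bex Eg_conj RE Eg_comp[OF SE] Dfun_p2 Dfun_id) (use Ba fS in auto)
  moreover have "(\<exists>i\<in>{..<m}. R i y \<and> x \<in> B (f i)) \<longleftrightarrow> x \<in> g y" for x y unfolding g_def by blast
  ultimately have gE: "Eg n (\<lambda>v \<alpha>. p2 v \<in> g (p1 v))" by simp
  \<comment> \<open>\<open>u e\<close> runs through all coded functions with zero oracle, among them
    all computable ones. Its graph is \<Delta>^1_1, hence E^1_n because
    \<open>n \<ge> 1\<close>.\<close>
  define u where "u e x = den (\<lambda>_. 0) (dec e) x" for e x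
  have D: "Dpred (\<lambda>w \<alpha>. p2 w = p1 w)" by (intro D_intros)
  have uE: "Eg n (\<lambda>v \<alpha>. u (p1 (p1 v)) (p2 (p1 v)) = p2 v)"
    using Eg_subst[OF Eg_Delta[OF n den_graph_Delta[of "\<lambda>y w. w = y", OF D]] Dfun_id Dop_const[of 0]]
    unfolding u_def .
  \<comment> \<open>Row 0 diagonalizes: the function with code \<open>e\<close> is applied at the
    index \<open>pr 0 e\<close> itself. Rows 1 to \<open>m\<close> make \<open>\<nu>\<close> onto
    \<open>S\<close>, and later rows take the default \<open>f 0\<close>.\<close>
  define \<nu> where "\<nu> z = (if p1 z = 0 then g (u (p2 z) z) else if p1 z \<le> m then f (p1 z - 1) else f 0)" for z
  have "range \<nu> = S"
  proof
    show "range \<nu> \<subseteq> S" unfolding \<nu>_def using gS fS m by auto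
    show "S \<subseteq> range \<nu>"
    proof
      fix A assume "A \<in> S"
      then obtain i where "i < m" "A = f i" using mf by blast
      then have "\<nu> (pr (Suc i) 0) = A" by (simp add: \<nu>_def)
      then show "A \<in> range \<nu>" by blast
    qed
  qed
  moreover have "Eg n (\<lambda>v \<alpha>. p2 v \<in> \<nu> (p1 v))"
  proof -
    have "Eg n (\<lambda>w \<alpha>. u (p2 (p1 (p2 w))) (p1 (p2 w)) = p1 w)"
      using Eg_comp[OF uE, of "\<lambda>w \<alpha>. pr (pr (p2 (p1 (p2 w))) (p1 (p2 w))) (p1 w)"]
      by (simp add: D_intros)
    moreover have "Eg n (\<lambda>w \<alpha>. p2 (p2 w) \<in> g (p1 w))"
      using Eg_comp[OF gE, of "\<lambda>w \<alpha>. pr (p1 w) (p2 (p2 w))"] by (simp add: D_intros)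
    ultimately have 1: "Eg n (\<lambda>v \<alpha>. \<exists>y. u (p2 (p1 v)) (p1 v) = y \<and> p2 v \<in> g y)"
      by (intro Eg_exN Eg_conj)
    have 2: "Eg n (\<lambda>v \<alpha>. \<exists>i\<in>{..<m}. p1 (p1 v) = Suc i \<and> p2 v \<in> f i)"
      by (intro Eg_Bex Eg_conj Eg_Dpred Eg_comp[OF SE] D_intros) (use fS in auto)
    have 3: "Eg n (\<lambda>v \<alpha>. m < p1 (p1 v) \<and> p2 v \<in> f 0)"
      by (intro Eg_conj Eg_Dpred Eg_comp[OF SE] D_intros) (use fS m in auto)
    have "Eg n (\<lambda>v \<alpha>. (p1 (p1 v) = 0 \<and> (\<exists>y. u (p2 (p1 v)) (p1 v) = y \<and> p2 v \<in> g y)) \<or>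
       (\<exists>i\<in>{..<m}. p1 (p1 v) = Suc i \<and> p2 v \<in> f i) \<or> (m < p1 (p1 v) \<and> p2 v \<in> f 0))"
      by (intro Eg_disj 2 3 Eg_conj[OF Eg_Dpred 1] D_intros)
    moreover have "((p1 z = 0 \<and> (\<exists>y. u (p2 z) z = y \<and> x \<in> g y)) \<or>
       (\<exists>i\<in>{..<m}. p1 z = Suc i \<and> x \<in> f i) \<or> (m < p1 z \<and> x \<in> f 0)) \<longleftrightarrow> x \<in> \<nu> z" for x z
      unfolding \<nu>_def by (cases "p1 z") auto
    ultimately show ?thesis by simp
  qed
  ultimately have "reducible \<nu> \<mu>" using \<mu>(2) numbering_iff[OF n] by blast
  then obtain h where h: "computable h" "\<nu> = \<mu> \<circ> h" unfolding reducible_def by blast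
  obtain c where c: "\<And>x. h x = den (\<lambda>_. 0) c x" using computable_den[OF h(1)] by blast
  obtain e where e: "dec e = c" using dec_surj by blast
  have "\<nu> (pr 0 e) = g (h (pr 0 e))" by (simp add: \<nu>_def u_def e c)
  then show False using g\<mu>[of "h (pr 0 e)"] h(2) by simp
qed

theorem theorem4p4:
  fixes n :: nat and S :: "nat set set"
  assumes "PD"
    and "n \<ge> 1"
    and "finite S" and "S \<noteq> {}" and "S \<subseteq> E11 n"
  shows "(\<exists>g. greatest (Rogers n S) g (carrier (Rogers n S))) \<longleftrightarrow>
         (\<exists>A\<in>S. \<forall>B\<in>S. A \<subseteq> B)"
  unfolding greatest_Rogers_iff
  using greatest_numbering_if_least[OF assms(1-3,5)] least_if_greatest_numbering[OF assms(1-3,5,4)]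
  by blast

end
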